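(* Let $(\mathbf{G},o)$ be a random rooted graph which is almost surely infinite and which is the local (Benjamini–Schramm) limit of a sequence of finite connected graphs $G_1, G_2, \ldots$ that all share a common universal cover tree $T$. If $\rho(\mathbf{G}) = \rho(T)$, then $\mathbf{G}$ is isomorphic to $T$ almost surely.
   Context: A sequence of finite connected graphs $G_n$ converges locally to a random rooted (connected, locally finite) graph $(\mathbf{G},o)$ if for every $r$ and every finite rooted connected graph $(H,o)$ of radius at most $r$ about its root, the proportion of vertices $v$ of $G_n$ whose $r$-neighbourhood $B_r(G_n,v)$ is isomorphic as a rooted graph to $(H,o)$ converges to $\mathbb{P}[B_r(\mathbf{G},o) \cong (H,o)]$. The universal cover of a connected graph $G$ is the tree $T$ with a surjective homomorphism $\pi:T\to G$ that is bijective from the 1-neighbourhood of each $\hat v\in T$ onto that of $\pi(\hat v)$. $\rho(T)$ is the operator norm of the adjacency operator of $T$ on $\ell^2(V(T))$. For a random rooted graph, letting $|W|_{2k}(\mathbf{G},o)$ denote the number of closed walks of length $2k$ from $o$ in $\mathbf{G}$, the spectral radius is $\rho(\mathbf{G}) = \lim_{k\to\infty} \big(\mathbb{E}[|W|_{2k}(\mathbf{G},o)]\big)^{1/2k}$. *)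

theory Defs
  imports "HOL-Probability.Probability"
begin

text \<open>Graphs are simple and undirected, given by a vertex set and a symmetric irreflexive
  adjacency relation; they may be infinite.\<close>

record 'v graph =
  verts :: "'v set"
  adj :: "('v \<times> 'v) set"

definition simple_graph :: "'v graph \<Rightarrow> bool" where
  "simple_graph G \<longleftrightarrow> adj G \<subseteq> verts G \<times> verts G \<and> sym (adj G) \<and> irrefl (adj G)"

definition connected_graph :: "'v graph \<Rightarrow> bool" where
  "connected_graph G \<longleftrightarrow> simple_graph G \<and> verts G \<noteq> {} \<and>
     (\<forall>u\<in>verts G. \<forall>v\<in>verts G. (u, v) \<in> (adj G)\<^sup>*)"

definition nbrs :: "'v graph \<Rightarrow> 'v \<Rightarrow> 'v set" where
  "nbrs G v = adj G `` {v}"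

definition locally_finite_graph :: "'v graph \<Rightarrow> bool" where
  "locally_finite_graph G \<longleftrightarrow> (\<forall>v\<in>verts G. finite (nbrs G v))"

definition is_cycle :: "'v graph \<Rightarrow> 'v list \<Rightarrow> bool" where
  "is_cycle G xs \<longleftrightarrow> length xs \<ge> 3 \<and> distinct xs \<and>
     (\<forall>i. Suc i < length xs \<longrightarrow> (xs ! i, xs ! Suc i) \<in> adj G) \<and> (last xs, hd xs) \<in> adj G"

definition tree :: "'v graph \<Rightarrow> bool" where
  "tree T \<longleftrightarrow> connected_graph T \<and> (\<nexists>xs. is_cycle T xs)"

definition graph_isomorphism :: "('v \<Rightarrow> 'w) \<Rightarrow> 'v graph \<Rightarrow> 'w graph \<Rightarrow> bool" where
  "graph_isomorphism f G H \<longleftrightarrow> bij_betw f (verts G) (verts H) \<and>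
     (\<forall>u\<in>verts G. \<forall>v\<in>verts G. (u, v) \<in> adj G \<longleftrightarrow> (f u, f v) \<in> adj H)"

definition isomorphic :: "'v graph \<Rightarrow> 'w graph \<Rightarrow> bool" where
  "isomorphic G H \<longleftrightarrow> (\<exists>f. graph_isomorphism f G H)"

type_synonym 'v rooted_graph = "'v graph \<times> 'v"

definition rooted_isomorphic :: "'v rooted_graph \<Rightarrow> 'w rooted_graph \<Rightarrow> bool" where
  "rooted_isomorphic G H \<longleftrightarrow>
     (\<exists>f. graph_isomorphism f (fst G) (fst H) \<and> f (snd G) = snd H)"

definition ball_verts :: "nat \<Rightarrow> 'v rooted_graph \<Rightarrow> 'v set" where
  "ball_verts r G = {v \<in> verts (fst G). \<exists>k\<le>r. (snd G, v) \<in> adj (fst G) ^^ k}"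

text \<open>The \<open>r\<close>-neighbourhood of the root: the subgraph induced on the vertices at distance at
  most \<open>r\<close>, with the same root.\<close>

definition rooted_ball :: "nat \<Rightarrow> 'v rooted_graph \<Rightarrow> 'v rooted_graph" where
  "rooted_ball r G =
     (\<lparr>verts = ball_verts r G,
       adj = adj (fst G) \<inter> (ball_verts r G \<times> ball_verts r G)\<rparr>, snd G)"

definition finite_rooted_graphs :: "nat \<Rightarrow> 'v rooted_graph set" where
  "finite_rooted_graphs r =
     {(H, p). connected_graph H \<and> finite (verts H) \<and> p \<in> verts H \<and> ball_verts r (H, p) = verts H}"

text \<open>The space of connected, locally finite rooted graphs with the \<open>\<sigma>\<close>-algebra generated by the
  events that the \<open>r\<close>-neighbourhood of the root has a prescribed isomorphism type, i.e. the
  Borel sets of the local topology on isomorphism classes. Every finite graph is isomorphic to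
  one with vertices in \<open>nat\<close>, so it suffices to let the test graphs \<open>H\<close> range over those.\<close>

definition rooted_graphs :: "'v rooted_graph set" where
  "rooted_graphs = {(G, p). connected_graph G \<and> locally_finite_graph G \<and> p \<in> verts G}"

definition rooted_graph_space :: "'v rooted_graph measure" where
  "rooted_graph_space = sigma rooted_graphs
     {{G \<in> rooted_graphs. rooted_isomorphic (rooted_ball r G) H} | r (H :: nat rooted_graph).
        H \<in> finite_rooted_graphs r}"

definition random_rooted_graph :: "'\<omega> measure \<Rightarrow> ('\<omega> \<Rightarrow> 'v rooted_graph) \<Rightarrow> bool" where
  "random_rooted_graph M G \<longleftrightarrow> prob_space M \<and> G \<in> measurable M rooted_graph_space"

definition converges_locally ::
    "(nat \<Rightarrow> 'u graph) \<Rightarrow> '\<omega> measure \<Rightarrow> ('\<omega> \<Rightarrow> 'v rooted_graph) \<Rightarrow> bool" where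
  "converges_locally Gs M G \<longleftrightarrow>
     (\<forall>r. \<forall>H \<in> (finite_rooted_graphs r :: nat rooted_graph set).
        (\<lambda>n. real (card {v \<in> verts (Gs n). rooted_isomorphic (rooted_ball r (Gs n, v)) H})
               / real (card (verts (Gs n))))
          \<longlonglongrightarrow> \<P>(\<omega> in M. rooted_isomorphic (rooted_ball r (G \<omega>)) H))"

definition covering_map :: "('t \<Rightarrow> 'v) \<Rightarrow> 't graph \<Rightarrow> 'v graph \<Rightarrow> bool" where
  "covering_map \<pi> T G \<longleftrightarrow> \<pi> ` verts T = verts G \<and>
     (\<forall>u v. (u, v) \<in> adj T \<longrightarrow> (\<pi> u, \<pi> v) \<in> adj G) \<and>
     (\<forall>v\<in>verts T. bij_betw \<pi> (insert v (nbrs T v)) (insert (\<pi> v) (nbrs G (\<pi> v))))"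

definition universal_cover :: "'t graph \<Rightarrow> 'v graph \<Rightarrow> bool" where
  "universal_cover T G \<longleftrightarrow> tree T \<and> (\<exists>\<pi>. covering_map \<pi> T G)"

definition ell2 :: "'v set \<Rightarrow> ('v \<Rightarrow> real) set" where
  "ell2 V = {f. (\<lambda>v. (f v)\<^sup>2) summable_on V}"

definition ell2_norm :: "'v set \<Rightarrow> ('v \<Rightarrow> real) \<Rightarrow> real" where
  "ell2_norm V f = sqrt (\<Sum>\<^sub>\<infinity>v\<in>V. (f v)\<^sup>2)"

definition adjacency_operator :: "'v graph \<Rightarrow> ('v \<Rightarrow> real) \<Rightarrow> 'v \<Rightarrow> real" where
  "adjacency_operator G f v = (\<Sum>w\<in>nbrs G v. f w)"

text \<open>The operator norm of the adjacency operator on \<open>\<ell>\<^sup>2\<close> of the vertex set. It is meaningful for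
  graphs of bounded degree, such as universal covers of finite graphs; there the operator is
  bounded and the supremum is over a nonempty bounded set.\<close>

definition adjacency_norm :: "'v graph \<Rightarrow> real" where
  "adjacency_norm G =
     (SUP f \<in> {f \<in> ell2 (verts G). ell2_norm (verts G) f \<le> 1}.
        ell2_norm (verts G) (adjacency_operator G f))"

definition closed_walks :: "nat \<Rightarrow> 'v rooted_graph \<Rightarrow> 'v list set" where
  "closed_walks n G =
     {xs. length xs = Suc n \<and> hd xs = snd G \<and> last xs = snd G \<and> set xs \<subseteq> verts (fst G) \<and>
          (\<forall>i<n. (xs ! i, xs ! Suc i) \<in> adj (fst G))}"

definition spectral_radius :: "'\<omega> measure \<Rightarrow> ('\<omega> \<Rightarrow> 'v rooted_graph) \<Rightarrow> real" where
  "spectral_radius M G =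
     lim (\<lambda>k. root (2 * k) (\<integral>\<omega>. real (card (closed_walks (2 * k) (G \<omega>))) \<partial>M))"

end

theory Submission
  imports Defs
begin

text \<open>Write \<open>A\<close> for adjacency operators. Suppose that the limit is not almost surely a tree. Then a positive
  proportion of the vertices of \<open>G\<^sub>n\<close> lie near a short cycle, and since \<open>|G\<^sub>n|\<close> tends to infinity, double
  counting shows that a positive proportion are even near two short cycles with different vertex sets;
  call these good.

  Let \<open>\<pi> : T \<rightarrow> G\<^sub>n\<close> be the covering. Replace, in the kernel of \<open>A\<^bsup>2l\<^esup>\<close> on \<open>T\<close>, one walk from \<open>u\<close> to each other
  point \<open>v\<close> of the same fibre (at even distance at most \<open>2l\<close>) by staying at \<open>u\<close>. The new symmetric
  kernel still projects to \<open>A\<^bsup>2l\<^esup>\<close> on \<open>G\<^sub>n\<close>, so its powers bound numbers of closed walks in \<open>G\<^sub>n\<close> from below,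
  while its quadratic form exceeds that of \<open>A\<^bsup>2l\<^esup>\<close> on \<open>T\<close> by the Dirichlet energy of the graph joining such
  \<open>u\<close> and \<open>v\<close>. Order the vertices of \<open>T\<close> by their distance to a fixed root: a deck transformation and its
  inverse cannot both move \<open>u\<close> towards the root, and for good \<open>\<pi> u\<close> some pair of them moves \<open>u\<close> away both
  times, so \<open>u\<close> has more neighbours above than below. Hence the energy of \<open>f\<close> is at least a constant
  times the mass of \<open>f\<close> above the good vertices.

  For the test functions \<open>A\<^sup>k \<delta>\<^sub>u\<close>, with \<open>u\<close> running through lifts of all vertices of \<open>G\<^sub>n\<close>, mass transport
  over the deck group shows that this mass is a fixed proportion of the total, whereas for large \<open>k\<close>
  the form of \<open>A\<^bsup>2l\<^esup>\<close> is arbitrarily close to \<open>\<rho>(T)\<^bsup>2l\<^esup>\<close>. By log-convexity the closed walks in \<open>G\<^sub>n\<close> grow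
  at a rate larger than \<open>\<rho>(T)\<close>, uniformly in \<open>n\<close>, and this passes to the limit. So \<open>\<rho>(G) = \<rho>(T)\<close>
  forces all balls of the limit to be trees, and then they are balls of \<open>T\<close>.\<close>

section \<open>Walks, reduced walks and trees\<close>

text \<open>One short cycle would not be enough: it gives a cyclic group of translations, and if the
  geodesic from \<open>u\<close> to the root runs along their axis, each translation moving
  \<open>u\<close> away is balanced by its inverse moving \<open>u\<close> closer. A geodesic to the
  root cannot project onto two different cycles through the same window of times, and this breaks
  the balance.

  The order of choices matters. The gain per step depends on the tree, the radii and the density of
  good vertices, but not on the power \<open>k\<close> in the test functions, because return counts
  at any two vertices of \<open>T\<close> are comparable with a constant independent of
  \<open>k\<close>. Hence \<open>k\<close> can be taken so large that the loss against \<Lambda>^l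
  is below half the gain, where \<Lambda> is the supremal ratio of successive return counts on
  \<open>T\<close>. A single near-extremal function might avoid the good fibres; averaging over one
  lift of every vertex excludes this. All operators act on finitely supported functions;
  square-summable ones appear only when the norm of \<open>T\<close> is bounded by sqrt
  \<Lambda>.\<close>

definition walk :: "'v graph \<Rightarrow> (nat \<Rightarrow> 'v) \<Rightarrow> nat \<Rightarrow> bool" where
  "walk G w k \<longleftrightarrow> w 0 \<in> verts G \<and> (\<forall>i<k. (w i, w (Suc i)) \<in> adj G)"

text \<open>Non-backtracking. Walks are total functions read only up to their length, so that
  shifting, reversing and gluing are plain index arithmetic.\<close>

definition reduced_walk :: "(nat \<Rightarrow> 'v) \<Rightarrow> nat \<Rightarrow> bool" where
  "reduced_walk w k \<longleftrightarrow> (\<forall>i. i + 2 \<le> k \<longrightarrow> w i \<noteq> w (i + 2))"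

definition join_walk :: "(nat \<Rightarrow> 'v) \<Rightarrow> nat \<Rightarrow> (nat \<Rightarrow> 'v) \<Rightarrow> nat \<Rightarrow> 'v" where
  "join_walk w a w' = (\<lambda>i. if i \<le> a then w i else w' (i - a))"

text \<open>Meaningful only within one component; elsewhere \<open>LEAST\<close> ranges over an
  empty predicate.\<close>

definition gdist :: "'v graph \<Rightarrow> 'v \<Rightarrow> 'v \<Rightarrow> nat" where
  "gdist G u v = (LEAST k. (u, v) \<in> adj G ^^ k)"

lemma simple_graph_adj_verts:
  assumes "simple_graph G" "(u, v) \<in> adj G"
  shows "u \<in> verts G" "v \<in> verts G"
  using assms unfolding simple_graph_def by auto

lemma simple_graph_adj_sym: "simple_graph G \<Longrightarrow> (u, v) \<in> adj G \<Longrightarrow> (v, u) \<in> adj G"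
  unfolding simple_graph_def by (auto dest: symD)

lemma simple_graph_adj_neq: "simple_graph G \<Longrightarrow> (u, v) \<in> adj G \<Longrightarrow> u \<noteq> v"
  unfolding simple_graph_def irrefl_def by auto

lemma connected_graph_simple: "connected_graph G \<Longrightarrow> simple_graph G"
  unfolding connected_graph_def by simp

lemma tree_connected: "tree T \<Longrightarrow> connected_graph T"
  unfolding tree_def by simp

lemma tree_simple: "tree T \<Longrightarrow> simple_graph T"
  by (simp add: tree_connected connected_graph_simple)

lemma walk_verts:
  assumes "simple_graph G" "walk G w k" "i \<le> k"
  shows "w i \<in> verts G"
proof (cases i)
  case 0
  then show ?thesis using assms unfolding walk_def by simp
next
  case (Suc j)
  then have "(w j, w i) \<in> adj G" using assms unfolding walk_def by simp
  then show ?thesis using simple_graph_adj_verts assms(1) by metis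
qed

lemma walk_mono: "walk G w k \<Longrightarrow> j \<le> k \<Longrightarrow> walk G w j"
  unfolding walk_def by auto

lemma reduced_mono: "reduced_walk w k \<Longrightarrow> j \<le> k \<Longrightarrow> reduced_walk w j"
  unfolding reduced_walk_def by auto

lemma walk_shift:
  "simple_graph G \<Longrightarrow> walk G w k \<Longrightarrow> j \<le> k \<Longrightarrow> walk G (\<lambda>i. w (j + i)) (k - j)"
  using walk_verts[of G w k j] unfolding walk_def by auto

lemma reduced_shift: "reduced_walk w k \<Longrightarrow> reduced_walk (\<lambda>i. w (j + i)) (k - j)"
  unfolding reduced_walk_def
proof (intro allI impI)
  fix i assume *: "\<forall>i. i + 2 \<le> k \<longrightarrow> w i \<noteq> w (i + 2)" and "i + 2 \<le> k - j"
  then have "(j + i) + 2 \<le> k" by simp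
  with * have "w (j + i) \<noteq> w ((j + i) + 2)" by blast
  then show "w (j + i) \<noteq> w (j + (i + 2))" by (simp add: add.assoc)
qed

lemma walk_rev:
  assumes "simple_graph G" "walk G w k"
  shows "walk G (\<lambda>i. w (k - i)) k"
  unfolding walk_def
proof (intro conjI allI impI)
  show "w (k - 0) \<in> verts G" using walk_verts[OF assms] by simp
  fix i assume "i < k"
  then have "(w (k - Suc i), w (Suc (k - Suc i))) \<in> adj G" using assms(2) unfolding walk_def by simp
  moreover have "Suc (k - Suc i) = k - i" using \<open>i < k\<close> by simp
  ultimately show "(w (k - i), w (k - Suc i)) \<in> adj G" using simple_graph_adj_sym[OF assms(1)] by metis
qed

lemma reduced_rev:
  assumes "reduced_walk w k"
  shows "reduced_walk (\<lambda>i. w (k - i)) k"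
  unfolding reduced_walk_def
proof (intro allI impI)
  fix i assume i: "i + 2 \<le> k"
  have "(k - (i + 2)) + 2 \<le> k" using i by simp
  then have "w (k - (i + 2)) \<noteq> w (k - (i + 2) + 2)" using assms unfolding reduced_walk_def by blast
  moreover have "k - (i + 2) + 2 = k - i" using i by simp
  ultimately show "w (k - i) \<noteq> w (k - (i + 2))" by metis
qed

lemma join_walk_simps [simp]:
  "i \<le> a \<Longrightarrow> join_walk w a w' i = w i"
  "w a = w' 0 \<Longrightarrow> join_walk w a w' (a + i) = w' i"
  unfolding join_walk_def by auto

lemma join_walk_later: "w a = w' 0 \<Longrightarrow> a \<le> i \<Longrightarrow> join_walk w a w' i = w' (i - a)"
  unfolding join_walk_def by auto

lemma walk_join:
  assumes "walk G w a" "walk G w' b" "w a = w' 0"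
  shows "walk G (join_walk w a w') (a + b)"
  unfolding walk_def
proof (intro conjI allI impI)
  show "join_walk w a w' 0 \<in> verts G" using assms unfolding walk_def by simp
  fix i assume i: "i < a + b"
  show "(join_walk w a w' i, join_walk w a w' (Suc i)) \<in> adj G"
  proof (cases "i < a")
    case True
    then show ?thesis using assms(1) unfolding walk_def by simp
  next
    case False
    then have "join_walk w a w' i = w' (i - a)" "join_walk w a w' (Suc i) = w' (Suc (i - a))"
      using join_walk_later[of w a w'] assms(3) by (auto simp: Suc_diff_le)
    moreover have "i - a < b" using False i by simp
    ultimately show ?thesis using assms(2) unfolding walk_def by simp
  qed
qed

lemma reduced_join:
  assumes "reduced_walk w a" "reduced_walk w' b" "w a = w' 0"
    and "a > 0 \<Longrightarrow> b > 0 \<Longrightarrow> w (a - 1) \<noteq> w' 1"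
  shows "reduced_walk (join_walk w a w') (a + b)"
  unfolding reduced_walk_def
proof (intro allI impI)
  fix i assume i: "i + 2 \<le> a + b"
  consider "i + 2 \<le> a" | "i + 1 = a" | "a \<le> i" by linarith
  then show "join_walk w a w' i \<noteq> join_walk w a w' (i + 2)"
  proof cases
    case 1
    then show ?thesis using assms(1) unfolding reduced_walk_def by simp
  next
    case 2
    then have "join_walk w a w' i = w (a - 1)" "join_walk w a w' (i + 2) = w' 1"
      using join_walk_later[of w a w' "i+2"] assms(3) by auto
    then show ?thesis using assms(4) 2 i by simp
  next
    case 3
    have "join_walk w a w' i = w' (i - a)" "join_walk w a w' (i + 2) = w' (i - a + 2)"
      using join_walk_later[of w a w'] assms(3) 3 by (auto simp: Suc_diff_le)
    then show ?thesis using assms(2) 3 i unfolding reduced_walk_def by simp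
  qed
qed

lemma walk_relpow:
  assumes "walk G w k" "i \<le> j" "j \<le> k"
  shows "(w i, w j) \<in> adj G ^^ (j - i)"
  unfolding relpow_fun_conv
  by (rule exI[of _ "\<lambda>n. w (i + n)"]) (use assms in \<open>auto simp: walk_def\<close>)

lemma relpow_walk:
  assumes "(u, v) \<in> adj G ^^ k" "u \<in> verts G"
  obtains w where "walk G w k" "w 0 = u" "w k = v"
  using assms unfolding relpow_fun_conv walk_def by auto

lemma gdist_relpow:
  assumes "connected_graph G" "u \<in> verts G" "v \<in> verts G"
  shows "(u, v) \<in> adj G ^^ gdist G u v"
proof -
  have "(u, v) \<in> (adj G)\<^sup>*" using assms unfolding connected_graph_def by blast
  then obtain k where "(u, v) \<in> adj G ^^ k" using rtrancl_power by metis
  then show ?thesis unfolding gdist_def by (rule LeastI)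
qed

lemma gdist_le: "(u, v) \<in> adj G ^^ k \<Longrightarrow> gdist G u v \<le> k"
  unfolding gdist_def by (rule Least_le)

lemma relpow_sym:
  assumes "simple_graph G" "(u, v) \<in> adj G ^^ k"
  shows "(v, u) \<in> adj G ^^ k"
proof -
  obtain f where f: "f 0 = u" "f k = v" "\<And>i. i < k \<Longrightarrow> (f i, f (Suc i)) \<in> adj G"
    using assms(2) unfolding relpow_fun_conv by auto
  have "(f (k - i), f (k - Suc i)) \<in> adj G" if "i < k" for i
  proof -
    have "Suc (k - Suc i) = k - i" using that by simp
    then show ?thesis using f(3)[of "k - Suc i"] that simple_graph_adj_sym[OF assms(1)] by simp
  qed
  then show ?thesis unfolding relpow_fun_conv
    by (intro exI[of _ "\<lambda>i. f (k - i)"]) (use f in auto)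
qed

lemma gdist_sym:
  assumes "simple_graph G"
  shows "gdist G u v = gdist G v u"
  unfolding gdist_def using relpow_sym[OF assms] by metis

text \<open>A backtrack could be cut out, leaving a walk that is shorter by two.\<close>

lemma shortest_walk_reduced:
  assumes "simple_graph G" "walk G w k" "\<And>j. (w 0, w k) \<in> adj G ^^ j \<Longrightarrow> k \<le> j"
  shows "reduced_walk w k"
  unfolding reduced_walk_def
proof (intro allI impI notI)
  fix i assume i: "i + 2 \<le> k" and eq: "w i = w (i + 2)"
  have "(w 0, w i) \<in> adj G ^^ i" using walk_relpow[OF assms(2), of 0 i] i by simp
  moreover have "(w i, w k) \<in> adj G ^^ (k - (i + 2))"
    using walk_relpow[OF assms(2), of "i+2" k] i eq by simp
  ultimately have "(w 0, w k) \<in> adj G ^^ (i + (k - (i + 2)))"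
    by (subst relpow_add) blast
  then show False using assms(3)[of "i + (k - (i + 2))"] i by simp
qed

section \<open>Geodesics, cycles and uniqueness of reduced walks in trees\<close>

lemma geodesic_walk:
  assumes "connected_graph G" "u \<in> verts G" "v \<in> verts G"
  obtains w where "walk G w (gdist G u v)" "w 0 = u" "w (gdist G u v) = v" "reduced_walk w (gdist G u v)"
proof -
  obtain w where w: "walk G w (gdist G u v)" "w 0 = u" "w (gdist G u v) = v"
    using relpow_walk[OF gdist_relpow[OF assms] assms(2)] by blast
  moreover have "reduced_walk w (gdist G u v)"
    by (rule shortest_walk_reduced[OF connected_graph_simple[OF assms(1)] w(1)])
      (use w gdist_le in metis)
  ultimately show thesis using that by blast
qed

text \<open>A coincidence \<open>w i = w j\<close> with \<open>j - i\<close> minimal encloses no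
  other repetition. Its length is not 1 by irreflexivity and not 2 by reducedness, so it is a cycle;
  the induction passes to a shorter coincidence whenever there is one.\<close>

lemma reduced_closed_imp_cycle:
  assumes "simple_graph G" "walk G w k" "reduced_walk w k" "i < j" "j \<le> k" "w i = w j"
  shows "\<exists>xs. is_cycle G xs \<and> set xs \<subseteq> w ` {i..j}"
  using assms(4-6)
proof (induction "j - i" arbitrary: i j rule: less_induct)
  case less
  show ?case
  proof (cases "\<exists>i' j'. i \<le> i' \<and> i' < j' \<and> j' \<le> j \<and> j' - i' < j - i \<and> w i' = w j'")
    case True
    then obtain i' j' where *: "i \<le> i'" "i' < j'" "j' \<le> j" "j' - i' < j - i" "w i' = w j'" by blast
    then have "\<exists>xs. is_cycle G xs \<and> set xs \<subseteq> w ` {i'..j'}" using less by auto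
    moreover have "w ` {i'..j'} \<subseteq> w ` {i..j}" using * by auto
    ultimately show ?thesis by blast
  next
    case False
    have inj: "inj_on w {i..<j}"
    proof (rule linorder_inj_onI)
      fix x y assume "x < y" "x \<in> {i..<j}" "y \<in> {i..<j}"
      then have "i \<le> x" "x < y" "y \<le> j" "y - x < j - i" by auto
      then show "w x \<noteq> w y" using False by blast
    qed auto
    have adj: "(w n, w (Suc n)) \<in> adj G" if "n < j" for n
      using assms(2) less that unfolding walk_def by auto
    have "j - i \<noteq> 1"
    proof
      assume "j - i = 1"
      then have "j = Suc i" by simp
      then show False using adj[of i] less simple_graph_adj_neq[OF assms(1)] by auto
    qed
    moreover have "j - i \<noteq> 2"
    proof
      assume "j - i = 2"
      then have "j = i + 2" by simp
      then show False using assms(3) less unfolding reduced_walk_def by auto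
    qed
    ultimately have len: "j - i \<ge> 3" using less by linarith
    have "is_cycle G (map w [i..<j])"
      unfolding is_cycle_def
    proof (intro conjI allI impI)
      show "length (map w [i..<j]) \<ge> 3" using len by simp
      show "distinct (map w [i..<j])" using inj by (simp add: distinct_map)
      show "(map w [i..<j] ! n, map w [i..<j] ! Suc n) \<in> adj G" if "Suc n < length (map w [i..<j])" for n
        using that adj[of "i + n"] by simp
      have "last (map w [i..<j]) = w (j - 1)" "hd (map w [i..<j]) = w i"
        using less by (auto simp: last_map hd_map)
      then show "(last (map w [i..<j]), hd (map w [i..<j])) \<in> adj G"
        using adj[of "j - 1"] less by auto
    qed
    moreover have "set (map w [i..<j]) \<subseteq> w ` {i..j}" by auto
    ultimately show ?thesis by blast
  qed
qed

lemma tree_reduced_neq: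
  assumes "tree T" "walk T w k" "reduced_walk w k" "i < j" "j \<le> k"
  shows "w i \<noteq> w j"
  using reduced_closed_imp_cycle[OF tree_simple[OF assms(1)] assms(2-5)] assms(1)
  unfolding tree_def by blast

text \<open>Compare the last steps. Equal ones are removed by induction; if they differ,
  \<open>w\<close> followed by the reverse of \<open>w'\<close> is a reduced closed walk, which a
  tree does not have.\<close>

lemma tree_reduced_unique:
  assumes "tree T" "walk T w k" "reduced_walk w k" "walk T w' k'" "reduced_walk w' k'"
    and "w 0 = w' 0" "w k = w' k'"
  shows "k = k' \<and> (\<forall>i\<le>k. w i = w' i)"
  using assms(2-)
proof (induction k arbitrary: k')
  case 0
  have "k' = 0"
  proof (rule ccontr)
    assume "k' \<noteq> 0"
    then have "w' 0 \<noteq> w' k'" using tree_reduced_neq[OF assms(1) 0(3,4), of 0 k'] by simp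
    then show False using 0 by simp
  qed
  then show ?case using 0 by simp
next
  case (Suc k)
  have "k' \<noteq> 0"
  proof
    assume "k' = 0"
    then show False using tree_reduced_neq[OF assms(1) Suc.prems(1,2), of 0 "Suc k"] Suc.prems by simp
  qed
  then obtain m where m: "k' = Suc m" using not0_implies_Suc by blast
  have sg: "simple_graph T" using assms(1) tree_simple by blast
  show ?case
  proof (cases "w k = w' m")
    case True
    have "k = m \<and> (\<forall>i\<le>k. w i = w' i)"
      by (rule Suc.IH[OF walk_mono[OF Suc.prems(1)] reduced_mono[OF Suc.prems(2)]
        walk_mono[OF Suc.prems(3)] reduced_mono[OF Suc.prems(4)]]) (use Suc.prems True m in auto)
    then show ?thesis using Suc.prems m by (auto simp: le_Suc_eq)
  next
    case False
    let ?r = "\<lambda>i. w' (k' - i)"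
    let ?j = "join_walk w (Suc k) ?r"
    have e: "w (Suc k) = ?r 0" using Suc.prems by simp
    have "walk T ?j (Suc k + k')"
      by (rule walk_join) (use Suc.prems walk_rev[OF sg] e in auto)
    moreover have "reduced_walk ?j (Suc k + k')"
      by (rule reduced_join) (use Suc.prems reduced_rev e False m in auto)
    ultimately have "?j 0 \<noteq> ?j (Suc k + k')"
      by (rule tree_reduced_neq[OF assms(1)]) auto
    moreover have "?j (Suc k + k') = w' 0" using join_walk_simps(2)[of w "Suc k" ?r k'] e by simp
    ultimately show ?thesis using Suc.prems by simp
  qed
qed

lemma tree_reduced_gdist:
  assumes "tree T" "walk T w k" "reduced_walk w k"
  shows "gdist T (w 0) (w k) = k"
proof -
  have v: "w 0 \<in> verts T" "w k \<in> verts T" using walk_verts[OF tree_simple[OF assms(1)] assms(2)] by auto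
  obtain w' where w': "walk T w' (gdist T (w 0) (w k))" "w' 0 = w 0" "w' (gdist T (w 0) (w k)) = w k"
    "reduced_walk w' (gdist T (w 0) (w k))"
    using geodesic_walk[OF tree_connected[OF assms(1)] v] by blast
  show ?thesis
    using tree_reduced_unique[OF assms w'(1,4) w'(2)[symmetric] w'(3)[symmetric]] by (elim conjE) (rule sym)
qed

text \<open>If \<open>q\<close> left \<open>w\<close> or ended at a time \<open>j < l\<close>, going
  back along \<open>q\<close> and on along \<open>w\<close> would be a reduced walk of length
  \<open>n - j + (2 * l - j)\<close>. This exceeds \<open>n\<close>, so the end of \<open>q\<close>
  would be closer to the start than to \<open>w (2 * l)\<close>.\<close>

lemma tree_geodesic_half_common:
  assumes "tree T" "walk T w (2 * l)" "reduced_walk w (2 * l)" "walk T q n" "reduced_walk q n" "q 0 = w 0"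
    and "gdist T (q n) (w (2 * l)) \<le> gdist T (q n) (w 0)"
  shows "l \<le> n \<and> (\<forall>i\<le>l. q i = w i)"
proof -
  have sg: "simple_graph T" using assms(1) tree_simple by blast
  define P where "P j \<longleftrightarrow> j \<le> n \<and> j \<le> l \<and> (\<forall>i\<le>j. q i = w i)" for j
  have P0: "P 0" using assms unfolding P_def by simp
  have Pb: "\<And>j. P j \<Longrightarrow> j \<le> l" unfolding P_def by simp
  \<comment> \<open>The time at which \<open>q\<close> leaves \<open>w\<close>, capped at
    \<open>l\<close>.\<close>
  define j where "j = (GREATEST j. P j)"
  have Pj: "P j" unfolding j_def by (rule GreatestI_nat[of P, OF P0 Pb])
  have max: "i \<le> j" if "P i" for i unfolding j_def by (rule Greatest_le_nat[of P, OF that Pb])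
  have "j = l"
  proof (rule ccontr)
    assume "j \<noteq> l"
    then have jl: "j < l" using Pj P_def by simp
    let ?a = "\<lambda>i. q (n - i)"
    let ?b = "\<lambda>i. w (j + i)"
    let ?w = "join_walk ?a (n - j) ?b"
    have jn: "j \<le> n" and qj: "q j = w j" using Pj P_def by auto
    have e: "?a (n - j) = ?b 0" using jn qj by simp
    have "walk T ?w (n - j + (2 * l - j))"
      by (rule walk_join[OF walk_mono[OF walk_rev[OF sg assms(4)]] walk_shift[OF sg assms(2)]]) (use jl e in auto)
    moreover have "reduced_walk ?w (n - j + (2 * l - j))"
    proof (rule reduced_join)
      show "reduced_walk ?a (n - j)" by (rule reduced_mono[OF reduced_rev[OF assms(5)]]) simp
      show "reduced_walk ?b (2 * l - j)" using reduced_shift[OF assms(3)] .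
      show "?a (n - j) = ?b 0" by (rule e)
      assume "n - j > 0"
      then have "n - (n - j - 1) = Suc j" by simp
      moreover have "q (Suc j) \<noteq> w (Suc j)"
      proof
        assume "q (Suc j) = w (Suc j)"
        then have "P (Suc j)" using Pj jl \<open>n - j > 0\<close> unfolding P_def by (auto simp: le_Suc_eq)
        then show False using max[of "Suc j"] by simp
      qed
      ultimately show "?a (n - j - 1) \<noteq> ?b 1" by simp
    qed
    ultimately have "gdist T (?w 0) (?w (n - j + (2 * l - j))) = n - j + (2 * l - j)"
      by (rule tree_reduced_gdist[OF assms(1)])
    moreover have "?w 0 = q n" by simp
    moreover have "?w (n - j + (2 * l - j)) = w (2 * l)" using join_walk_simps(2)[of ?a "n - j" ?b "2 * l - j", OF e] jl by simp
    moreover have "gdist T (q n) (w 0) = n"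
      using tree_reduced_gdist[OF assms(1,4,5)] assms(6) gdist_sym[OF sg] by metis
    ultimately show False using assms(7) jl jn by simp
  qed
  then show ?thesis using Pj unfolding P_def by simp
qed

section \<open>Lifting along a covering by a tree, and deck transformations\<close>

locale tree_cover =
  fixes T :: "'t graph" and G :: "'v graph" and \<pi> :: "'t \<Rightarrow> 'v"
  assumes tree: "tree T" and simple: "simple_graph G" and cover: "covering_map \<pi> T G"
begin

lemma simple_T: "simple_graph T"
  using tree tree_simple by blast

lemma connected_T: "connected_graph T"
  using tree tree_connected by blast

lemma proj_verts: "x \<in> verts T \<Longrightarrow> \<pi> x \<in> verts G"
  using cover unfolding covering_map_def by auto

lemma proj_adj: "(x, y) \<in> adj T \<Longrightarrow> (\<pi> x, \<pi> y) \<in> adj G"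
  using cover unfolding covering_map_def by auto

lemma proj_surj: "y \<in> verts G \<Longrightarrow> \<exists>x\<in>verts T. \<pi> x = y"
  using cover unfolding covering_map_def by force

text \<open>The covering condition concerns closed neighbourhoods; the centre can be removed on both
  sides because both graphs are irreflexive.\<close>

lemma proj_nbrs_bij:
  assumes "x \<in> verts T"
  shows "bij_betw \<pi> (nbrs T x) (nbrs G (\<pi> x))"
proof -
  have b: "bij_betw \<pi> (insert x (nbrs T x)) (insert (\<pi> x) (nbrs G (\<pi> x)))"
    using cover assms unfolding covering_map_def by auto
  have x: "x \<notin> nbrs T x" "\<pi> x \<notin> nbrs G (\<pi> x)"
    using simple_graph_adj_neq[OF simple_T] simple_graph_adj_neq[OF simple] unfolding nbrs_def by auto
  have "inj_on \<pi> (nbrs T x)" using b unfolding bij_betw_def by (auto intro: inj_on_subset)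
  moreover have "\<pi> ` nbrs T x = nbrs G (\<pi> x)"
  proof -
    have "insert (\<pi> x) (\<pi> ` nbrs T x) = insert (\<pi> x) (nbrs G (\<pi> x))"
      using b unfolding bij_betw_def by simp
    moreover have "\<pi> x \<notin> \<pi> ` nbrs T x"
      using proj_adj simple_graph_adj_neq[OF simple] unfolding nbrs_def by fastforce
    ultimately show ?thesis using x(2) by (simp add: insert_ident)
  qed
  ultimately show ?thesis unfolding bij_betw_def by simp
qed

lemma step_unique:
  assumes "(x, y) \<in> adj T" "(x, z) \<in> adj T" "\<pi> y = \<pi> z"
  shows "y = z"
proof -
  have "x \<in> verts T" using assms simple_graph_adj_verts[OF simple_T] by blast
  then show ?thesis using proj_nbrs_bij[of x] assms unfolding bij_betw_def inj_on_def nbrs_def by auto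
qed

lemma step_exists:
  assumes "x \<in> verts T" "(\<pi> x, b) \<in> adj G"
  shows "\<exists>y. (x, y) \<in> adj T \<and> \<pi> y = b"
proof -
  have "b \<in> \<pi> ` nbrs T x" using proj_nbrs_bij[OF assms(1)] assms(2) unfolding bij_betw_def nbrs_def by auto
  then show ?thesis unfolding nbrs_def by auto
qed

lemma lift_exists:
  assumes "walk G w k" "u \<in> verts T" "\<pi> u = w 0"
  shows "\<exists>w'. walk T w' k \<and> w' 0 = u \<and> (\<forall>i\<le>k. \<pi> (w' i) = w i)"
  using assms(1)
proof (induction k)
  case 0
  then show ?case using assms by (intro exI[of _ "\<lambda>_. u"]) (auto simp: walk_def)
next
  case (Suc k)
  then obtain w' where w': "walk T w' k" "w' 0 = u" "\<forall>i\<le>k. \<pi> (w' i) = w i"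
    using walk_mono[OF Suc.prems, of k] by auto
  have "w' k \<in> verts T" using walk_verts[OF simple_T w'(1)] by simp
  moreover have "(\<pi> (w' k), w (Suc k)) \<in> adj G" using Suc.prems w'(3) unfolding walk_def by simp
  ultimately obtain y where y: "(w' k, y) \<in> adj T" "\<pi> y = w (Suc k)" using step_exists by blast
  have "walk T (w'(Suc k := y)) (Suc k)" using w'(1) y(1) unfolding walk_def by (auto simp: less_Suc_eq)
  moreover have "(w'(Suc k := y)) 0 = u" "\<forall>i\<le>Suc k. \<pi> ((w'(Suc k := y)) i) = w i"
    using w' y by (auto simp: le_Suc_eq)
  ultimately show ?case by blast
qed

lemma lift_unique:
  assumes "walk T w k" "walk T w' k" "w 0 = w' 0" "\<forall>i\<le>k. \<pi> (w i) = \<pi> (w' i)"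
  shows "\<forall>i\<le>k. w i = w' i"
proof (intro allI impI)
  fix i assume "i \<le> k"
  then show "w i = w' i"
  proof (induction i)
    case 0
    then show ?case using assms by simp
  next
    case (Suc i)
    then have "(w i, w (Suc i)) \<in> adj T" "(w i, w' (Suc i)) \<in> adj T"
      using assms(1,2) unfolding walk_def by (auto simp: Suc_le_eq)
    then show ?case using step_unique assms(4) Suc.prems by blast
  qed
qed

lemma proj_walk: "walk T w k \<Longrightarrow> walk G (\<lambda>i. \<pi> (w i)) k"
  unfolding walk_def using proj_adj proj_verts by blast

text \<open>A backtrack of the projection would give two neighbours of one vertex the same image;
  local injectivity then makes them equal upstairs.\<close>

lemma proj_reduced:
  assumes "walk T w k" "reduced_walk w k"
  shows "reduced_walk (\<lambda>i. \<pi> (w i)) k"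
  unfolding reduced_walk_def
proof (intro allI impI notI)
  fix i assume i: "i + 2 \<le> k" and eq: "\<pi> (w i) = \<pi> (w (i + 2))"
  have "(w (Suc i), w i) \<in> adj T" "(w (Suc i), w (i + 2)) \<in> adj T"
    using assms(1) i simple_graph_adj_sym[OF simple_T] unfolding walk_def by auto
  then have "w i = w (i + 2)" using step_unique eq by blast
  then show False using assms(2) i unfolding reduced_walk_def by blast
qed

lemma lift_reduced:
  assumes "reduced_walk w k" "\<forall>i\<le>k. \<pi> (w' i) = w i"
  shows "reduced_walk w' k"
  unfolding reduced_walk_def
proof (intro allI impI)
  fix i assume "i + 2 \<le> k"
  then have "w i \<noteq> w (i + 2)" "\<pi> (w' i) = w i" "\<pi> (w' (i + 2)) = w (i + 2)"
    using assms unfolding reduced_walk_def by auto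
  then show "w' i \<noteq> w' (i + 2)" by metis
qed

section \<open>Deck transformations, obtained by transport along reduced walks\<close>

definition deck :: "('t \<Rightarrow> 't) \<Rightarrow> bool" where
  "deck g \<longleftrightarrow> graph_isomorphism g T T \<and> (\<forall>x\<in>verts T. \<pi> (g x) = \<pi> x)"

text \<open>Change of base point by path lifting: \<open>x'\<close> ends the lift at
  \<open>u'\<close> of the projected geodesic from \<open>u\<close> to \<open>x\<close>. The
  relational form is symmetric in the two base points, which later gives bijectivity.\<close>

definition transported :: "'t \<Rightarrow> 't \<Rightarrow> 't \<Rightarrow> 't \<Rightarrow> bool" where
  "transported u u' x x' \<longleftrightarrow> (\<exists>k w w'. walk T w k \<and> reduced_walk w k \<and> walk T w' k \<and>
     w 0 = u \<and> w' 0 = u' \<and> (\<forall>i\<le>k. \<pi> (w i) = \<pi> (w' i)) \<and> w k = x \<and> w' k = x')"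

lemma transported_exists:
  assumes "u \<in> verts T" "u' \<in> verts T" "\<pi> u = \<pi> u'" "x \<in> verts T"
  shows "\<exists>x'. transported u u' x x'"
proof -
  obtain w where w: "walk T w (gdist T u x)" "w 0 = u" "w (gdist T u x) = x" "reduced_walk w (gdist T u x)"
    using geodesic_walk[OF connected_T assms(1,4)] by blast
  obtain w' where "walk T w' (gdist T u x)" "w' 0 = u'" "\<forall>i\<le>gdist T u x. \<pi> (w' i) = \<pi> (w i)"
    using lift_exists[OF proj_walk[OF w(1)], of u'] assms w(2) by auto
  then show ?thesis unfolding transported_def using w by metis
qed

lemma transported_unique:
  assumes "transported u u' x x'" "transported u u' x x''"
  shows "x' = x''"
proof -
  obtain k w w' where a: "walk T w k" "reduced_walk w k" "walk T w' k"
     "w 0 = u" "w' 0 = u'" "\<forall>i\<le>k. \<pi> (w i) = \<pi> (w' i)" "w k = x" "w' k = x'"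
    using assms(1) unfolding transported_def by blast
  obtain l v v' where b: "walk T v l" "reduced_walk v l" "walk T v' l"
     "v 0 = u" "v' 0 = u'" "\<forall>i\<le>l. \<pi> (v i) = \<pi> (v' i)" "v l = x" "v' l = x''"
    using assms(2) unfolding transported_def by blast
  have kl: "k = l" and eq: "\<forall>i\<le>k. w i = v i"
    using tree_reduced_unique[OF tree a(1,2) b(1,2)] a b by auto
  have "\<forall>i\<le>k. w' i = v' i"
    by (rule lift_unique) (use a b kl eq in auto)
  then show ?thesis using a b kl by auto
qed

lemma transported_sym:
  assumes "transported u u' x x'"
  shows "transported u' u x' x"
proof -
  obtain k w w' where a: "walk T w k" "reduced_walk w k" "walk T w' k"
     "w 0 = u" "w' 0 = u'" "\<forall>i\<le>k. \<pi> (w i) = \<pi> (w' i)" "w k = x" "w' k = x'"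
    using assms(1) unfolding transported_def by blast
  have "reduced_walk w' k" by (rule lift_reduced[OF proj_reduced[OF a(1,2)]]) (use a in auto)
  then show ?thesis unfolding transported_def using a by metis
qed

text \<open>Either \<open>y\<close> is the last but one vertex of the reduced walk to
  \<open>x\<close>, and the walk is shortened; or appending \<open>y\<close> keeps the walk reduced,
  and the lift is extended by one step.\<close>

lemma transported_adj:
  assumes "transported u u' x x'" "(x, y) \<in> adj T" "transported u u' y y'"
  shows "(x', y') \<in> adj T"
proof -
  obtain k w w' where a: "walk T w k" "reduced_walk w k" "walk T w' k"
     "w 0 = u" "w' 0 = u'" "\<forall>i\<le>k. \<pi> (w i) = \<pi> (w' i)" "w k = x" "w' k = x'"
    using assms(1) unfolding transported_def by blast
  show ?thesis
  proof (cases "k > 0 \<and> w (k - 1) = y")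
    case True
    have "transported u u' y (w' (k - 1))"
      unfolding transported_def
      by (rule exI[of _ "k - 1"], rule exI[of _ w], rule exI[of _ w'])
        (use a True walk_mono[of T _ k "k - 1"] reduced_mono[of w k "k - 1"] in auto)
    then have "y' = w' (k - 1)" using transported_unique assms(3) by blast
    moreover have "(w' (k - 1), w' (Suc (k - 1))) \<in> adj T"
      using a(3) True unfolding walk_def by (metis One_nat_def diff_Suc_less)
    ultimately show ?thesis using a True simple_graph_adj_sym[OF simple_T] by auto
  next
    case False
    have "x' \<in> verts T" using walk_verts[OF simple_T a(3)] a by auto
    moreover have "(\<pi> x', \<pi> y) \<in> adj G" using proj_adj[OF assms(2)] a by auto
    ultimately obtain z where z: "(x', z) \<in> adj T" "\<pi> z = \<pi> y" using step_exists by blast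
    let ?w = "w(Suc k := y)" and ?w' = "w'(Suc k := z)"
    have "walk T ?w (Suc k)" "walk T ?w' (Suc k)"
      using a assms(2) z unfolding walk_def by (auto simp: less_Suc_eq)
    moreover have "reduced_walk ?w (Suc k)"
      unfolding reduced_walk_def
    proof (intro allI impI)
      fix i assume "i + 2 \<le> Suc k"
      then consider "i + 2 \<le> k" | "i + 2 = Suc k" by linarith
      then show "?w i \<noteq> ?w (i + 2)"
      proof cases
        case 1
        then show ?thesis using a(2) unfolding reduced_walk_def by auto
      next
        case 2
        then have "i = k - 1" "k > 0" by auto
        then show ?thesis using False 2 by auto
      qed
    qed
    ultimately have "transported u u' y z"
      unfolding transported_def
      by (intro exI[of _ "Suc k"] exI[of _ ?w] exI[of _ ?w']) (use a z in \<open>auto simp: le_Suc_eq\<close>)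
    then show ?thesis using transported_unique assms(3) z by blast
  qed
qed

text \<open>Transport from \<open>u\<close> to \<open>u'\<close> is inverted by transport from
  \<open>u'\<close> to \<open>u\<close>. Thus the deck group is transitive on every fibre.\<close>

lemma deck_exists:
  assumes "u \<in> verts T" "u' \<in> verts T" "\<pi> u = \<pi> u'"
  shows "\<exists>g. deck g \<and> g u = u'"
proof -
  define g where "g x = (THE x'. transported u u' x x')" for x
  have g: "transported u u' x (g x)" if "x \<in> verts T" for x
    unfolding g_def
    by (rule theI') (use transported_exists[OF assms that] transported_unique in blast)
  have verts: "x' \<in> verts T \<and> \<pi> x' = \<pi> x" if t: "transported u u' x x'" for x x'
  proof -
    obtain k w w' where a: "walk T w' k" "\<forall>i\<le>k. \<pi> (w i) = \<pi> (w' i)" "w k = x" "w' k = x'"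
      using t unfolding transported_def by blast
    then show ?thesis using walk_verts[OF simple_T a(1), of k] by auto
  qed
  have inj: "inj_on g (verts T)"
  proof (rule inj_onI)
    fix x y assume "x \<in> verts T" "y \<in> verts T" "g x = g y"
    then have "transported u' u (g x) x" "transported u' u (g x) y"
      using g transported_sym by metis+
    then show "x = y" by (rule transported_unique)
  qed
  have surj: "g ` verts T = verts T"
  proof
    show "g ` verts T \<subseteq> verts T" using g verts by blast
    show "verts T \<subseteq> g ` verts T"
    proof
      fix y assume y: "y \<in> verts T"
      obtain x where x: "transported u' u y x"
        using transported_exists[OF assms(2,1) assms(3)[symmetric] y] by blast
      then obtain k w' where "walk T w' k" "w' k = x" unfolding transported_def by blast
      then have "x \<in> verts T" using walk_verts[OF simple_T] by blast
      moreover have "g x = y" using transported_unique[OF g[OF calculation] transported_sym[OF x]] .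
      ultimately show "y \<in> g ` verts T" by blast
    qed
  qed
  have "graph_isomorphism g T T"
    unfolding graph_isomorphism_def
  proof (intro conjI ballI)
    show "bij_betw g (verts T) (verts T)" using inj surj unfolding bij_betw_def by simp
    fix x y assume xy: "x \<in> verts T" "y \<in> verts T"
    show "(x, y) \<in> adj T \<longleftrightarrow> (g x, g y) \<in> adj T"
      using transported_adj[OF g[OF xy(1)] _ g[OF xy(2)]]
        transported_adj[OF transported_sym[OF g[OF xy(1)]] _ transported_sym[OF g[OF xy(2)]]] by blast
  qed
  moreover have "g u = u'"
  proof -
    have "transported u u' u u'"
      unfolding transported_def
      by (rule exI[of _ 0], rule exI[of _ "\<lambda>_. u"], rule exI[of _ "\<lambda>_. u'"])
        (use assms in \<open>auto simp: walk_def reduced_walk_def\<close>)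
    then show ?thesis using transported_unique g assms(1) by blast
  qed
  ultimately show ?thesis unfolding deck_def using g verts by metis
qed

lemma deck_verts: "deck g \<Longrightarrow> x \<in> verts T \<Longrightarrow> g x \<in> verts T"
  unfolding deck_def graph_isomorphism_def bij_betw_def by auto

lemma deck_proj: "deck g \<Longrightarrow> x \<in> verts T \<Longrightarrow> \<pi> (g x) = \<pi> x"
  unfolding deck_def by auto

lemma deck_adj: "deck g \<Longrightarrow> (x, y) \<in> adj T \<Longrightarrow> (g x, g y) \<in> adj T"
  unfolding deck_def graph_isomorphism_def using simple_graph_adj_verts[OF simple_T] by blast

lemma deck_inj: "deck g \<Longrightarrow> inj_on g (verts T)"
  unfolding deck_def graph_isomorphism_def bij_betw_def by auto

lemma deck_walk: "deck g \<Longrightarrow> walk T w k \<Longrightarrow> walk T (\<lambda>i. g (w i)) k"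
  unfolding walk_def using deck_adj deck_verts by blast

lemma deck_reduced:
  assumes "deck g" "walk T w k" "reduced_walk w k"
  shows "reduced_walk (\<lambda>i. g (w i)) k"
  unfolding reduced_walk_def
proof (intro allI impI notI)
  fix i assume i: "i + 2 \<le> k" and eq: "g (w i) = g (w (i + 2))"
  have "w i \<in> verts T" "w (i + 2) \<in> verts T" using walk_verts[OF simple_T assms(2)] i by auto
  then have "w i = w (i + 2)" using deck_inj[OF assms(1)] eq by (meson inj_onD)
  then show False using assms(3) i unfolding reduced_walk_def by blast
qed

text \<open>Along a walk from \<open>x\<close> to \<open>y\<close> the two images are lifts of one
  walk with the same start. So the deck group acts freely.\<close>

lemma deck_unique:
  assumes "deck g" "deck h" "x \<in> verts T" "g x = h x" "y \<in> verts T"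
  shows "g y = h y"
proof -
  obtain w where w: "walk T w (gdist T x y)" "w 0 = x" "w (gdist T x y) = y"
    using geodesic_walk[OF connected_T assms(3,5)] by blast
  have "\<forall>i\<le>gdist T x y. g (w i) = h (w i)"
    by (rule lift_unique[OF deck_walk[OF assms(1) w(1)] deck_walk[OF assms(2) w(1)]])
      (use assms w deck_proj walk_verts[OF simple_T w(1)] in auto)
  then show ?thesis using w by auto
qed

lemma deck_id: "deck (\<lambda>x. x)"
  unfolding deck_def graph_isomorphism_def by (auto simp: bij_betw_def)

lemma deck_inverse:
  assumes "deck g"
  obtains h where "deck h" "\<And>x. x \<in> verts T \<Longrightarrow> h (g x) = x" "\<And>x. x \<in> verts T \<Longrightarrow> g (h x) = x"
proof -
  have bij: "bij_betw g (verts T) (verts T)"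
    using assms unfolding deck_def graph_isomorphism_def by simp
  define h where "h = inv_into (verts T) g"
  have hb: "bij_betw h (verts T) (verts T)" unfolding h_def by (rule bij_betw_inv_into[OF bij])
  have hg: "h (g x) = x" if "x \<in> verts T" for x
    unfolding h_def using bij that by (simp add: bij_betw_inv_into_left)
  have gh: "g (h x) = x" if "x \<in> verts T" for x
    unfolding h_def using bij that by (simp add: bij_betw_inv_into_right)
  have hv: "h x \<in> verts T" if "x \<in> verts T" for x using hb that unfolding bij_betw_def by auto
  have "deck h"
    unfolding deck_def graph_isomorphism_def
  proof (intro conjI ballI)
    show "bij_betw h (verts T) (verts T)" by (rule hb)
    fix x y assume xy: "x \<in> verts T" "y \<in> verts T"
    have "(h x, h y) \<in> adj T \<longleftrightarrow> (g (h x), g (h y)) \<in> adj T"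
      using assms hv xy unfolding deck_def graph_isomorphism_def by blast
    then show "(x, y) \<in> adj T \<longleftrightarrow> (h x, h y) \<in> adj T" using gh xy by simp
  next
    fix x assume x: "x \<in> verts T"
    then show "\<pi> (h x) = \<pi> x" using deck_proj[OF assms hv[OF x]] gh by simp
  qed
  then show thesis using that hg gh by blast
qed

end

section \<open>Finitely supported functions and symmetric operators\<close>

definition fin_supp :: "('a \<Rightarrow> real) \<Rightarrow> bool" where
  "fin_supp f \<longleftrightarrow> finite {x. f x \<noteq> 0}"

text \<open>Summing over the support of the product gives the expected value as soon as one factor
  is finitely supported; if that set is infinite, the value is 0 by the convention for sums.\<close>

definition ip :: "('a \<Rightarrow> real) \<Rightarrow> ('a \<Rightarrow> real) \<Rightarrow> real" where
  "ip f g = (\<Sum>x | f x * g x \<noteq> 0. f x * g x)"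

definition pt :: "'a \<Rightarrow> 'a \<Rightarrow> real" where
  "pt u = (\<lambda>x. if x = u then 1 else 0)"

definition nbr_sum :: "('a \<Rightarrow> 'a set) \<Rightarrow> ('a \<Rightarrow> real) \<Rightarrow> 'a \<Rightarrow> real" where
  "nbr_sum N f u = (\<Sum>v\<in>N u. f v)"

text \<open>A locally finite symmetric relation given by neighbour sets; it covers both the
  adjacency of a graph and the later fibre graph on the tree.\<close>

definition sym_nbrs :: "('a \<Rightarrow> 'a set) \<Rightarrow> bool" where
  "sym_nbrs N \<longleftrightarrow> (\<forall>u. finite (N u)) \<and> (\<forall>u v. v \<in> N u \<longleftrightarrow> u \<in> N v)"

lemma adjacency_operator_nbr_sum: "adjacency_operator G = nbr_sum (nbrs G)"
  unfolding adjacency_operator_def nbr_sum_def by (intro ext) simp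

lemma ip_eq_sum:
  assumes "finite B" "\<And>x. x \<notin> B \<Longrightarrow> f x = 0 \<or> g x = 0"
  shows "ip f g = (\<Sum>x\<in>B. f x * g x)"
  unfolding ip_def by (rule sum.mono_neutral_left) (use assms in auto)

lemma ip_commute: "ip f g = ip g f"
  unfolding ip_def by (simp add: mult.commute)

lemma ip_supp: "fin_supp f \<Longrightarrow> ip f g = (\<Sum>x | f x \<noteq> 0. f x * g x)"
  unfolding fin_supp_def by (rule ip_eq_sum) auto

lemma ip_add: "fin_supp f \<Longrightarrow> ip f (\<lambda>x. g x + h x) = ip f g + ip f h"
  by (simp add: ip_supp algebra_simps sum.distrib)

lemma ip_self_nonneg: "0 \<le> ip f f"
  unfolding ip_def by (intro sum_nonneg) auto

lemma fin_supp_pt [simp]: "fin_supp (pt u)"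
  unfolding fin_supp_def pt_def by (rule finite_subset[of _ "{u}"]) auto

lemma pt_nonneg: "0 \<le> pt u x"
  unfolding pt_def by simp

lemma ip_pt: "ip (pt u) f = f u"
  by (subst ip_eq_sum[of "{u}"]) (auto simp: pt_def)

lemma ip_Cauchy_Schwarz:
  assumes "fin_supp f" "fin_supp g"
  shows "(ip f g)\<^sup>2 \<le> ip f f * ip g g"
proof -
  let ?B = "{x. f x \<noteq> 0} \<union> {x. g x \<noteq> 0}"
  have B: "finite ?B" using assms unfolding fin_supp_def by simp
  have "ip f g = (\<Sum>x\<in>?B. f x * g x)" "ip f f = (\<Sum>x\<in>?B. f x * f x)" "ip g g = (\<Sum>x\<in>?B. g x * g x)"
    by (rule ip_eq_sum[OF B], auto)+
  then show ?thesis using Cauchy_Schwarz_ineq_sum[of f g ?B] by (simp add: power2_eq_square)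
qed

lemma ip_mono:
  assumes "fin_supp g" "\<And>x. 0 \<le> f x" "\<And>x. f x \<le> g x"
  shows "ip f f \<le> ip g g"
proof -
  have B: "finite {x. g x \<noteq> 0}" using assms(1) unfolding fin_supp_def .
  have z: "f x = 0" if "g x = 0" for x using assms(2,3)[of x] that by simp
  have "ip f f = (\<Sum>x | g x \<noteq> 0. f x * f x)" by (rule ip_eq_sum[OF B]) (use z in auto)
  also have "\<dots> \<le> (\<Sum>x | g x \<noteq> 0. g x * g x)" by (intro sum_mono mult_mono) (use assms in \<open>auto intro: order_trans\<close>)
  also have "\<dots> = ip g g" by (rule ip_eq_sum[OF B, symmetric]) auto
  finally show ?thesis .
qed

lemma fin_supp_nbr_sum:
  assumes "sym_nbrs N" "fin_supp f"
  shows "fin_supp (nbr_sum N f)"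
proof -
  have "{x. nbr_sum N f x \<noteq> 0} \<subseteq> (\<Union>v\<in>{x. f x \<noteq> 0}. N v)"
  proof
    fix x assume "x \<in> {x. nbr_sum N f x \<noteq> 0}"
    then obtain v where "v \<in> N x" "f v \<noteq> 0" unfolding nbr_sum_def using sum.not_neutral_contains_not_neutral by blast
    then show "x \<in> (\<Union>v\<in>{x. f x \<noteq> 0}. N v)" using assms(1) unfolding sym_nbrs_def by blast
  qed
  moreover have "finite (\<Union>v\<in>{x. f x \<noteq> 0}. N v)" using assms unfolding sym_nbrs_def fin_supp_def by auto
  ultimately show ?thesis unfolding fin_supp_def by (rule finite_subset)
qed

lemma nbr_sum_restrict:
  assumes "sym_nbrs N" "finite S" "\<And>v. v \<notin> S \<Longrightarrow> f v = 0"
  shows "nbr_sum N f x = (\<Sum>v\<in>S. if v \<in> N x then f v else 0)"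
proof -
  have "nbr_sum N f x = (\<Sum>v\<in>N x \<inter> S. f v)"
    unfolding nbr_sum_def by (rule sum.mono_neutral_right) (use assms in \<open>auto simp: sym_nbrs_def\<close>)
  also have "\<dots> = (\<Sum>v\<in>S. if v \<in> N x then f v else 0)"
    using assms(2) by (subst Int_commute) (rule sum.inter_restrict)
  finally show ?thesis .
qed

lemma nbr_sum_adjoint:
  assumes "sym_nbrs N" "fin_supp f" "fin_supp g"
  shows "ip (nbr_sum N f) g = ip f (nbr_sum N g)"
proof -
  let ?S = "{x. f x \<noteq> 0}" and ?R = "{x. g x \<noteq> 0}"
  have fS: "finite ?S" "finite ?R" using assms unfolding fin_supp_def by auto
  have "ip (nbr_sum N f) g = (\<Sum>x\<in>?R. nbr_sum N f x * g x)" by (rule ip_eq_sum[OF fS(2)]) auto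
  also have "\<dots> = (\<Sum>x\<in>?R. (\<Sum>v\<in>?S. if v \<in> N x then f v else 0) * g x)"
    by (intro sum.cong refl arg_cong2[of _ _ _ _ "(*)"] nbr_sum_restrict[OF assms(1) fS(1)]) auto
  also have "\<dots> = (\<Sum>x\<in>?R. \<Sum>v\<in>?S. (if v \<in> N x then f v else 0) * g x)"
    by (simp add: sum_distrib_right)
  also have "\<dots> = (\<Sum>v\<in>?S. \<Sum>x\<in>?R. (if v \<in> N x then f v else 0) * g x)" by (rule sum.swap)
  also have "\<dots> = (\<Sum>v\<in>?S. f v * (\<Sum>x\<in>?R. if x \<in> N v then g x else 0))"
    unfolding sum_distrib_left using assms(1) by (intro sum.cong refl) (auto simp: sym_nbrs_def)
  also have "\<dots> = (\<Sum>v\<in>?S. f v * nbr_sum N g v)"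
    by (intro sum.cong refl arg_cong2[of _ _ _ _ "(*)"] nbr_sum_restrict[OF assms(1) fS(2), symmetric]) auto
  also have "\<dots> = ip f (nbr_sum N g)" by (rule ip_eq_sum[OF fS(1), symmetric]) auto
  finally show ?thesis .
qed

section \<open>Symmetric operators and log-convexity of their moments\<close>

definition sym_operator :: "(('a \<Rightarrow> real) \<Rightarrow> 'a \<Rightarrow> real) \<Rightarrow> bool" where
  "sym_operator C \<longleftrightarrow> (\<forall>f. fin_supp f \<longrightarrow> fin_supp (C f)) \<and>
     (\<forall>f g. fin_supp f \<longrightarrow> fin_supp g \<longrightarrow> ip (C f) g = ip f (C g))"

lemma sym_operator_nbr_sum: "sym_nbrs N \<Longrightarrow> sym_operator (nbr_sum N)"
  unfolding sym_operator_def using fin_supp_nbr_sum nbr_sum_adjoint by blast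

lemma sym_operator_fin_pow: "sym_operator C \<Longrightarrow> fin_supp f \<Longrightarrow> fin_supp ((C ^^ k) f)"
  by (induction k) (auto simp: sym_operator_def)

lemma sym_operator_pow: "sym_operator C \<Longrightarrow> sym_operator (C ^^ k)"
proof (induction k)
  case 0
  then show ?case by (simp add: sym_operator_def)
next
  case (Suc k)
  have "ip ((C ^^ Suc k) f) g = ip f ((C ^^ Suc k) g)" if "fin_supp f" "fin_supp g" for f g
  proof -
    have "ip ((C ^^ Suc k) f) g = ip ((C ^^ k) f) (C g)"
      using Suc.prems sym_operator_fin_pow[OF Suc.prems that(1)] that(2) unfolding sym_operator_def by simp
    also have "\<dots> = ip f ((C ^^ k) (C g))"
      using Suc that unfolding sym_operator_def by simp
    finally show ?thesis by (simp add: funpow_swap1)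
  qed
  then show ?case using sym_operator_fin_pow[OF Suc.prems] unfolding sym_operator_def by blast
qed

lemma ip_pow_shift:
  assumes "sym_operator C" "fin_supp f"
  shows "ip ((C ^^ a) f) ((C ^^ (b + c)) f) = ip ((C ^^ (a + b)) f) ((C ^^ c) f)"
proof -
  have "ip ((C ^^ b) ((C ^^ a) f)) ((C ^^ c) f) = ip ((C ^^ a) f) ((C ^^ b) ((C ^^ c) f))"
    using sym_operator_pow[OF assms(1), of b] sym_operator_fin_pow[OF assms] unfolding sym_operator_def by blast
  then show ?thesis by (simp add: funpow_add add.commute[of a b])
qed

text \<open>Moving one operator across turns the middle squared norm into the pairing of the two
  neighbouring iterates; then Cauchy-Schwarz applies.\<close>

lemma sym_operator_log_convex:
  assumes "sym_operator C" "fin_supp f"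
  shows "(ip ((C ^^ Suc k) f) ((C ^^ Suc k) f))\<^sup>2 \<le>
    ip ((C ^^ k) f) ((C ^^ k) f) * ip ((C ^^ Suc (Suc k)) f) ((C ^^ Suc (Suc k)) f)"
proof -
  have "ip ((C ^^ Suc k) f) ((C ^^ Suc k) f) = ip ((C ^^ k) f) ((C ^^ Suc (Suc k)) f)"
    using ip_pow_shift[OF assms, of k 1 "Suc k"] by simp
  then show ?thesis using ip_Cauchy_Schwarz sym_operator_fin_pow[OF assms] by metis
qed

lemma sum_log_convex:
  fixes a b c :: "'i \<Rightarrow> real"
  assumes "\<And>i. i \<in> I \<Longrightarrow> 0 \<le> a i" "\<And>i. i \<in> I \<Longrightarrow> 0 \<le> c i" "\<And>i. i \<in> I \<Longrightarrow> (b i)\<^sup>2 \<le> a i * c i"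
  shows "(\<Sum>i\<in>I. b i)\<^sup>2 \<le> (\<Sum>i\<in>I. a i) * (\<Sum>i\<in>I. c i)"
proof -
  have "\<bar>\<Sum>i\<in>I. b i\<bar> \<le> (\<Sum>i\<in>I. sqrt (a i) * sqrt (c i))"
  proof (rule order_trans[OF sum_abs sum_mono])
    fix i assume "i \<in> I"
    then show "\<bar>b i\<bar> \<le> sqrt (a i) * sqrt (c i)"
      using assms(3)[of i] by (metis real_sqrt_abs real_sqrt_le_iff real_sqrt_mult)
  qed
  then have "(\<Sum>i\<in>I. b i)\<^sup>2 \<le> (\<Sum>i\<in>I. sqrt (a i) * sqrt (c i))\<^sup>2"
    by (metis abs_ge_zero power2_abs power_mono)
  also have "\<dots> \<le> (\<Sum>i\<in>I. (sqrt (a i))\<^sup>2) * (\<Sum>i\<in>I. (sqrt (c i))\<^sup>2)"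
    by (rule Cauchy_Schwarz_ineq_sum)
  also have "\<dots> = (\<Sum>i\<in>I. a i) * (\<Sum>i\<in>I. c i)" using assms by simp
  finally show ?thesis .
qed

text \<open>Log-convexity makes the ratios of successive terms nondecreasing, so a ratio that is at
  least \<open>x\<close> once stays so; positivity is carried along to allow the division.\<close>

lemma log_convex_growth:
  fixes q :: "nat \<Rightarrow> real"
  assumes "\<And>j. (q (Suc j))\<^sup>2 \<le> q j * q (Suc (Suc j))" "q i > 0" "x > 0" "x * q i \<le> q (Suc i)"
  shows "q i * x ^ m \<le> q (i + m)"
proof -
  have *: "q (i + j) > 0 \<and> x * q (i + j) \<le> q (Suc (i + j))" for j
  proof (induction j)
    case (Suc j)
    then have pos: "q (i + j) > 0" and le: "x * q (i + j) \<le> q (Suc (i + j))" by auto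
    have pos': "q (Suc (i + j)) > 0" using pos le assms(3) by (meson mult_pos_pos less_le_trans)
    have "(x * q (i + j)) * q (Suc (i + j)) \<le> (q (Suc (i + j)))\<^sup>2"
      using le pos' by (simp add: power2_eq_square mult_right_mono)
    also have "\<dots> \<le> q (i + j) * q (Suc (Suc (i + j)))" by (rule assms(1))
    finally have "x * q (Suc (i + j)) \<le> q (Suc (Suc (i + j)))" using pos by (simp add: algebra_simps)
    then show ?case using pos' by simp
  qed (use assms in auto)
  show ?thesis
  proof (induction m)
    case (Suc m)
    have "q i * x ^ Suc m = x * (q i * x ^ m)" by simp
    also have "\<dots> \<le> x * q (i + m)" using Suc assms(3) by simp
    also have "\<dots> \<le> q (i + Suc m)" using * by simp
    finally show ?case .
  qed simp
qed

section \<open>The adjacency operator and closed walks\<close>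

text \<open>Equals the number of closed walks of length \<open>2 * k\<close> at \<open>u\<close>;
  written as a squared norm it is visibly nonnegative and log-convex in \<open>k\<close>.\<close>

definition return_count :: "'v graph \<Rightarrow> nat \<Rightarrow> 'v \<Rightarrow> real" where
  "return_count G k u = ip ((adjacency_operator G ^^ k) (pt u)) ((adjacency_operator G ^^ k) (pt u))"

definition loc_fin :: "'v graph \<Rightarrow> bool" where
  "loc_fin G \<longleftrightarrow> simple_graph G \<and> locally_finite_graph G"

lemma loc_fin_sym_nbrs:
  assumes "loc_fin G"
  shows "sym_nbrs (nbrs G)"
proof -
  have s: "simple_graph G" using assms unfolding loc_fin_def by simp
  have "finite (nbrs G u)" for u
  proof (cases "u \<in> verts G")
    case True
    then show ?thesis using assms unfolding loc_fin_def locally_finite_graph_def by simp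
  next
    case False
    then have "nbrs G u = {}" using simple_graph_adj_verts[OF s] unfolding nbrs_def by auto
    then show ?thesis by simp
  qed
  then show ?thesis unfolding sym_nbrs_def nbrs_def using simple_graph_adj_sym[OF s] by auto
qed

lemma sym_operator_adjacency: "loc_fin G \<Longrightarrow> sym_operator (adjacency_operator G)"
  by (simp add: adjacency_operator_nbr_sum loc_fin_sym_nbrs sym_operator_nbr_sum)

lemma adjacency_pow_nonneg:
  "(\<And>x. 0 \<le> f x) \<Longrightarrow> 0 \<le> (adjacency_operator G ^^ k) f x"
  by (induction k arbitrary: x) (auto simp: adjacency_operator_def intro: sum_nonneg)

lemma adjacency_pow_mono:
  "(\<And>x. f x \<le> g x) \<Longrightarrow> (adjacency_operator G ^^ k) f x \<le> (adjacency_operator G ^^ k) g x"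
  by (induction k arbitrary: x) (auto simp: adjacency_operator_def intro: sum_mono)

lemma adjacency_pow_sym:
  assumes "loc_fin G"
  shows "(adjacency_operator G ^^ k) (pt u) v = (adjacency_operator G ^^ k) (pt v) u"
proof -
  have "ip (pt v) ((adjacency_operator G ^^ k) (pt u)) = ip ((adjacency_operator G ^^ k) (pt v)) (pt u)"
    using sym_operator_pow[OF sym_operator_adjacency[OF assms], of k] unfolding sym_operator_def by simp
  then show ?thesis by (simp add: ip_pt ip_commute[of _ "pt u"])
qed

lemma adjacency_pow_supp:
  assumes "simple_graph G" "\<And>x. x \<notin> verts G \<Longrightarrow> f x = 0" "x \<notin> verts G"
  shows "(adjacency_operator G ^^ k) f x = 0"
proof (cases k)
  case 0
  then show ?thesis using assms by simp
next
  case (Suc j)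
  have "nbrs G x = {}" using simple_graph_adj_verts[OF assms(1)] assms(3) unfolding nbrs_def by auto
  then show ?thesis using Suc by (simp add: adjacency_operator_def)
qed

text \<open>The right side sums the nonnegative \<open>h\<close> over the ends of all walks of
  length \<open>L\<close> from \<open>u\<close>, and every point of \<open>S\<close> is such an
  end.\<close>

lemma adjacency_pow_ge_sum:
  assumes "loc_fin G" "\<And>x. 0 \<le> h x" "finite S" "\<And>v. v \<in> S \<Longrightarrow> (u, v) \<in> adj G ^^ L"
  shows "(\<Sum>v\<in>S. h v) \<le> (adjacency_operator G ^^ L) h u"
  using assms(3,4)
proof (induction L arbitrary: u S)
  case 0
  then have "S \<subseteq> {u}" by auto
  then have "(\<Sum>v\<in>S. h v) \<le> (\<Sum>v\<in>{u}. h v)" by (intro sum_mono2) (use assms(2) in auto)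
  then show ?case by simp
next
  case (Suc L)
  have "\<exists>w. (u, w) \<in> adj G \<and> (w, v) \<in> adj G ^^ L" if "v \<in> S" for v
    using relpow_Suc_D2[OF Suc.prems(2)[OF that]] by blast
  \<comment> \<open>The targets are grouped by the first step of a chosen walk to each of
    them.\<close>
  then obtain c where c: "\<And>v. v \<in> S \<Longrightarrow> (u, c v) \<in> adj G \<and> (c v, v) \<in> adj G ^^ L" by metis
  have fin: "finite (nbrs G u)" using loc_fin_sym_nbrs[OF assms(1)] unfolding sym_nbrs_def by blast
  have "(\<Sum>v\<in>S. h v) = (\<Sum>w\<in>nbrs G u. \<Sum>v\<in>{v\<in>S. c v = w}. h v)"
    by (rule sum.group[symmetric]) (use Suc.prems fin c in \<open>auto simp: nbrs_def\<close>)
  also have "\<dots> \<le> (\<Sum>w\<in>nbrs G u. (adjacency_operator G ^^ L) h w)"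
    by (intro sum_mono Suc.IH) (use Suc.prems c in auto)
  also have "\<dots> = (adjacency_operator G ^^ Suc L) h u" by (simp add: adjacency_operator_def)
  finally show ?case .
qed

lemma return_count_log_convex:
  "loc_fin G \<Longrightarrow> (return_count G (Suc k) u)\<^sup>2 \<le> return_count G k u * return_count G (Suc (Suc k)) u"
  unfolding return_count_def
  by (rule sym_operator_log_convex) (simp_all add: sym_operator_adjacency)

lemma return_count_nonneg: "0 \<le> return_count G k u"
  unfolding return_count_def by (rule ip_self_nonneg)

lemma return_count_0: "return_count G 0 u = 1"
  unfolding return_count_def by (simp add: ip_pt) (simp add: pt_def)

lemma return_count_eq_pow:
  assumes "loc_fin G"
  shows "return_count G k u = (adjacency_operator G ^^ (2 * k)) (pt u) u"
  using ip_pow_shift[OF sym_operator_adjacency[OF assms], of "pt u" 0 k k]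
  unfolding return_count_def by (simp add: ip_pt mult_2)

text \<open>Cauchy-Schwarz at each vertex costs one factor \<open>D\<close>; moving the operator
  from the squares of \<open>f\<close> onto the indicator of the support of the image costs the
  other.\<close>

lemma adjacency_norm_bound_fin:
  assumes "loc_fin G" "\<And>u. card (nbrs G u) \<le> D" "fin_supp f"
  shows "ip (adjacency_operator G f) (adjacency_operator G f) \<le> (real D)\<^sup>2 * ip f f"
proof -
  let ?A = "adjacency_operator G"
  define g where "g x = (f x)\<^sup>2" for x
  have gf: "fin_supp g" using assms(3) unfolding fin_supp_def g_def by simp
  have sn: "sym_nbrs (nbrs G)" using loc_fin_sym_nbrs[OF assms(1)] .
  define B where "B = {x. ?A f x \<noteq> 0}"
  have B: "finite B"
    using fin_supp_nbr_sum[OF sn assms(3)] unfolding B_def fin_supp_def adjacency_operator_nbr_sum .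
  define i where "i x = (if x \<in> B then 1 else 0 :: real)" for x
  have fi: "fin_supp i" unfolding fin_supp_def i_def by (rule finite_subset[OF _ B]) auto
  have "ip (?A f) (?A f) = (\<Sum>x\<in>B. (?A f x)\<^sup>2)"
    unfolding power2_eq_square by (rule ip_eq_sum[OF B]) (auto simp: B_def)
  also have "\<dots> \<le> (\<Sum>x\<in>B. real D * ?A g x)"
  proof (rule sum_mono)
    fix x
    have "(?A f x)\<^sup>2 \<le> real (card (nbrs G x)) * ?A g x"
      using Cauchy_Schwarz_ineq_sum[of "\<lambda>_. 1" f "nbrs G x"] unfolding adjacency_operator_def g_def by simp
    also have "\<dots> \<le> real D * ?A g x"
      by (intro mult_right_mono) (use assms(2) in \<open>auto simp: adjacency_operator_def g_def intro: sum_nonneg\<close>)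
    finally show "(?A f x)\<^sup>2 \<le> real D * ?A g x" .
  qed
  also have "\<dots> = real D * ip (?A g) i"
    by (subst ip_eq_sum[OF B]) (auto simp: i_def sum_distrib_left)
  also have "\<dots> = real D * ip g (?A i)"
    unfolding adjacency_operator_nbr_sum by (simp add: nbr_sum_adjoint[OF sn gf fi])
  also have "\<dots> \<le> real D * (real D * ip f f)"
  proof (rule mult_left_mono)
    have "?A i x \<le> real D" for x
    proof -
      have "?A i x \<le> (\<Sum>v\<in>nbrs G x. 1)" unfolding adjacency_operator_def i_def by (intro sum_mono) auto
      then show ?thesis using assms(2)[of x] by simp
    qed
    then have "(\<Sum>x | g x \<noteq> 0. g x * ?A i x) \<le> (\<Sum>x | g x \<noteq> 0. g x * real D)"
      by (intro sum_mono mult_left_mono) (auto simp: g_def)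
    also have "\<dots> = real D * (\<Sum>x | f x \<noteq> 0. f x * f x)"
      by (simp add: g_def power2_eq_square sum_distrib_right sum_distrib_left algebra_simps)
    finally show "ip g (?A i) \<le> real D * ip f f" by (simp add: ip_supp gf assms(3))
  qed simp
  finally show ?thesis by (simp add: power2_eq_square algebra_simps)
qed

lemma return_count_Suc_le:
  assumes "loc_fin G" "\<And>u. card (nbrs G u) \<le> D"
  shows "return_count G (Suc k) u \<le> (real D)\<^sup>2 * return_count G k u"
  unfolding return_count_def
  using adjacency_norm_bound_fin[OF assms, of "(adjacency_operator G ^^ k) (pt u)"]
    sym_operator_fin_pow[OF sym_operator_adjacency[OF assms(1)] fin_supp_pt] by simp

text \<open>A closed walk at \<open>x\<close> becomes one at \<open>u\<close> by going to
  \<open>x\<close> first and returning the same way, which adds \<open>2 * d\<close> steps.\<close>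

lemma return_count_shift:
  assumes "loc_fin G" "(u, x) \<in> adj G ^^ d"
  shows "return_count G j x \<le> return_count G (j + d) u"
proof -
  let ?A = "adjacency_operator G"
  have le: "pt x y \<le> (?A ^^ d) (pt u) y" for y
  proof (cases "y = x")
    case True
    have "(\<Sum>v\<in>{x}. pt x v) \<le> (?A ^^ d) (pt x) u"
      by (rule adjacency_pow_ge_sum[OF assms(1)]) (use assms(2) pt_nonneg in auto)
    then show ?thesis using adjacency_pow_sym[OF assms(1), of d u x] True by simp
  next
    case False
    then show ?thesis using adjacency_pow_nonneg[where f="pt u" and k=d and x=y, OF pt_nonneg] by (simp add: pt_def)
  qed
  have "(?A ^^ j) (pt x) y \<le> (?A ^^ (j + d)) (pt u) y" for y
    using adjacency_pow_mono[where f="pt x" and g="(?A ^^ d) (pt u)" and k=j and x=y, OF le] by (simp add: funpow_add)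
  then show ?thesis unfolding return_count_def
    by (intro ip_mono adjacency_pow_nonneg pt_nonneg sym_operator_fin_pow[OF sym_operator_adjacency[OF assms(1)]] fin_supp_pt)
qed

section \<open>Closed walks counted by powers of the adjacency operator\<close>

definition walk_lists :: "'v graph \<Rightarrow> nat \<Rightarrow> 'v \<Rightarrow> 'v \<Rightarrow> 'v list set" where
  "walk_lists G n u v = {xs. length xs = Suc n \<and> hd xs = u \<and> last xs = v \<and> set xs \<subseteq> verts G \<and>
     (\<forall>i<n. (xs ! i, xs ! Suc i) \<in> adj G)}"

lemma walk_lists_Suc:
  assumes "simple_graph G"
  shows "walk_lists G (Suc n) u v = (\<Union>w\<in>nbrs G u. (#) u ` walk_lists G n w v)"
proof (rule set_eqI)
  fix xs
  show "xs \<in> walk_lists G (Suc n) u v \<longleftrightarrow> xs \<in> (\<Union>w\<in>nbrs G u. (#) u ` walk_lists G n w v)"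
  proof
    assume "xs \<in> walk_lists G (Suc n) u v"
    then obtain ys where ys: "xs = u # ys" "length ys = Suc n" "last xs = v" "set xs \<subseteq> verts G"
      "\<forall>i<Suc n. (xs ! i, xs ! Suc i) \<in> adj G"
      unfolding walk_lists_def by (cases xs) auto
    have "ys \<noteq> []" using ys(2) by auto
    then have h: "hd ys = ys ! 0" by (simp add: hd_conv_nth)
    have "(u, hd ys) \<in> adj G" using ys(1,5) h by (metis nth_Cons_0 nth_Cons_Suc zero_less_Suc)
    moreover have "ys \<in> walk_lists G n (hd ys) v"
      unfolding walk_lists_def using ys \<open>ys \<noteq> []\<close> by auto
    ultimately show "xs \<in> (\<Union>w\<in>nbrs G u. (#) u ` walk_lists G n w v)" using ys(1) unfolding nbrs_def by blast
  next
    assume "xs \<in> (\<Union>w\<in>nbrs G u. (#) u ` walk_lists G n w v)"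
    then obtain w ys where w: "(u, w) \<in> adj G" "xs = u # ys" "ys \<in> walk_lists G n w v"
      unfolding nbrs_def by auto
    then have y: "length ys = Suc n" "hd ys = w" "last ys = v" "set ys \<subseteq> verts G" "ys \<noteq> []"
      "\<forall>i<n. (ys ! i, ys ! Suc i) \<in> adj G"
      unfolding walk_lists_def by auto
    have "(xs ! i, xs ! Suc i) \<in> adj G" if "i < Suc n" for i
      using that y w by (cases i) (auto simp: hd_conv_nth)
    then show "xs \<in> walk_lists G (Suc n) u v"
      unfolding walk_lists_def using w y simple_graph_adj_verts[OF assms w(1)] by auto
  qed
qed

lemma card_walk_lists:
  assumes "loc_fin G" "u \<in> verts G" "v \<in> verts G"
  shows "finite (walk_lists G n u v) \<and> real (card (walk_lists G n u v)) = (adjacency_operator G ^^ n) (pt v) u"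
  using assms(2)
proof (induction n arbitrary: u)
  case 0
  have "walk_lists G 0 u v = (if u = v then {[u]} else {})"
    unfolding walk_lists_def using 0 by (auto simp: length_Suc_conv)
  then show ?case by (simp add: pt_def)
next
  case (Suc n)
  have sg: "simple_graph G" using assms(1) unfolding loc_fin_def by simp
  have fin: "finite (nbrs G u)" using loc_fin_sym_nbrs[OF assms(1)] unfolding sym_nbrs_def by blast
  have nv: "w \<in> verts G" if "w \<in> nbrs G u" for w
    using that simple_graph_adj_verts[OF sg] unfolding nbrs_def by auto
  have disj: "(#) u ` walk_lists G n w v \<inter> (#) u ` walk_lists G n w' v = {}" if "w \<noteq> w'" for w w'
    using that unfolding walk_lists_def by auto
  have "card (walk_lists G (Suc n) u v) = (\<Sum>w\<in>nbrs G u. card ((#) u ` walk_lists G n w v))"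
    unfolding walk_lists_Suc[OF sg]
    by (rule card_UN_disjoint) (use fin Suc.IH nv disj in auto)
  also have "\<dots> = (\<Sum>w\<in>nbrs G u. card (walk_lists G n w v))"
    by (intro sum.cong refl card_image) (auto simp: inj_on_def)
  finally have "real (card (walk_lists G (Suc n) u v)) = (\<Sum>w\<in>nbrs G u. real (card (walk_lists G n w v)))" by simp
  also have "\<dots> = (\<Sum>w\<in>nbrs G u. (adjacency_operator G ^^ n) (pt v) w)"
    by (intro sum.cong refl) (use Suc.IH nv in auto)
  also have "\<dots> = (adjacency_operator G ^^ Suc n) (pt v) u"
    by (simp add: adjacency_operator_def[of G _ u])
  moreover have "finite (walk_lists G (Suc n) u v)"
    using fin Suc.IH nv unfolding walk_lists_Suc[OF sg] by auto
  ultimately show ?case by simp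
qed

lemma card_closed_walks:
  assumes "loc_fin G" "u \<in> verts G"
  shows "real (card (closed_walks (2 * k) (G, u))) = return_count G k u"
proof -
  have "closed_walks (2 * k) (G, u) = walk_lists G (2 * k) u u"
    unfolding closed_walks_def walk_lists_def by auto
  then show ?thesis using card_walk_lists[OF assms(1,2,2)] return_count_eq_pow[OF assms(1)] by simp
qed

section \<open>A lower bound for the Dirichlet energy\<close>

text \<open>On an upward edge from \<open>u\<close> to \<open>v\<close> the squared difference is at
  least e(1-e) f(u)^2 - e f(v)^2. A vertex with more edges up than down keeps a positive share of
  its square after summation, and \<open>closed\<close> ensures that the negative terms are charged
  to vertices of \<open>Y\<close> only.\<close>

lemma Dirichlet_energy_lower_bound:
  fixes E :: "'a \<Rightarrow> 'a set" and f :: "'a \<Rightarrow> real" and lv :: "'a \<Rightarrow> nat"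
  assumes E: "sym_nbrs E" and f: "fin_supp f" and B: "B > 0"
    and card: "\<And>u. u \<in> Y \<Longrightarrow> card (E u) \<le> B" and closed: "\<And>u. u \<in> Y \<Longrightarrow> E u \<subseteq> Y"
    and up: "\<And>u. u \<in> Y \<Longrightarrow> card {v\<in>E u. lv v < lv u} < card {v\<in>E u. lv u < lv v}"
  shows "(\<Sum>u | f u \<noteq> 0 \<and> u \<in> Y. (f u)\<^sup>2) / (4 * real B)
    \<le> ip f (\<lambda>u. real (card (E u)) * f u - nbr_sum E f u)"
proof -
  let ?S = "{u. f u \<noteq> 0}"
  have fS: "finite ?S" using f unfolding fin_supp_def .
  have Ef: "finite (E u)" for u using E unfolding sym_nbrs_def by blast
  have Es: "v \<in> E u \<longleftrightarrow> u \<in> E v" for u v using E unfolding sym_nbrs_def by blast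
  \<comment> \<open>The ordered edges that meet the support of \<open>f\<close>, a finite set. Each
    edge occurs in both directions, whence the factor in \<open>2 * ?Q\<close>.\<close>
  define P where "P = {(u, v). v \<in> E u \<and> (f u \<noteq> 0 \<or> f v \<noteq> 0)}"
  have Psub: "P \<subseteq> Sigma ?S E \<union> prod.swap ` Sigma ?S E"
    unfolding P_def using Es by (force simp: image_iff)
  have fP: "finite P" by (rule finite_subset[OF Psub]) (use fS Ef in auto)
  have swap: "(\<Sum>(u, v)\<in>P. F u v) = (\<Sum>(u, v)\<in>P. F v u)" for F :: "'a \<Rightarrow> 'a \<Rightarrow> real"
    by (rule sum.reindex_bij_witness[of _ prod.swap prod.swap]) (use Es in \<open>auto simp: P_def\<close>)
  let ?Q = "ip f (\<lambda>u. real (card (E u)) * f u - nbr_sum E f u)"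
  have "?Q = (\<Sum>u\<in>?S. \<Sum>v\<in>E u. f u * (f u - f v))"
    by (simp add: ip_supp[OF f] nbr_sum_def sum_subtractf sum_distrib_left algebra_simps)
  also have "\<dots> = (\<Sum>(u, v)\<in>Sigma ?S E. f u * (f u - f v))"
    by (rule sum.Sigma) (use fS Ef in auto)
  also have "\<dots> = (\<Sum>(u, v)\<in>P. f u * (f u - f v))"
    by (rule sum.mono_neutral_left) (use fP in \<open>auto simp: P_def\<close>)
  finally have Q1: "?Q = (\<Sum>(u, v)\<in>P. f u * (f u - f v))" .
  then have Q2: "?Q = (\<Sum>(u, v)\<in>P. f v * (f v - f u))" by (subst (asm) swap)
  have "2 * ?Q = (\<Sum>(u, v)\<in>P. f u * (f u - f v)) + (\<Sum>(u, v)\<in>P. f v * (f v - f u))"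
    using Q1 Q2 by linarith
  also have "\<dots> = (\<Sum>(u, v)\<in>P. (f u - f v)\<^sup>2)"
    unfolding sum.distrib[symmetric]
    by (intro sum.cong refl) (auto simp: power2_eq_square algebra_simps)
  finally have Q: "2 * ?Q = (\<Sum>(u, v)\<in>P. (f u - f v)\<^sup>2)" .
  define U where "U = {(u, v)\<in>P. lv u < lv v}"
  define W where "W = {(u, v)\<in>P. lv v < lv u}"
  have fUW: "finite U" "finite W" using fP unfolding U_def W_def by (auto intro: finite_subset)
  have UW: "(\<Sum>(u, v)\<in>U. (f u - f v)\<^sup>2) = (\<Sum>(u, v)\<in>W. (f u - f v)\<^sup>2)"
    by (rule sum.reindex_bij_witness[of _ prod.swap prod.swap])
      (use Es in \<open>auto simp: U_def W_def P_def power2_commute\<close>)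
  have "(\<Sum>(u, v)\<in>U. (f u - f v)\<^sup>2) + (\<Sum>(u, v)\<in>W. (f u - f v)\<^sup>2) = (\<Sum>(u, v)\<in>U \<union> W. (f u - f v)\<^sup>2)"
    by (rule sum.union_disjoint[symmetric]) (use fUW in \<open>auto simp: U_def W_def\<close>)
  also have "\<dots> \<le> (\<Sum>(u, v)\<in>P. (f u - f v)\<^sup>2)"
    by (rule sum_mono2[OF fP]) (auto simp: U_def W_def)
  finally have QU: "(\<Sum>(u, v)\<in>U. (f u - f v)\<^sup>2) \<le> ?Q" using Q UW by linarith
  \<comment> \<open>With this \<open>e\<close>, the product of \<open>e\<close> and an up-degree is
    at most 1/2, so a surplus of one upward edge leaves the net share e/2 = 1/(4B).\<close>
  define e where "e = 1 / (2 * real B)"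
  have e: "e > 0" "2 * (real B * e) = 1" using B unfolding e_def by auto
  have elem: "e * (1 - e) * x\<^sup>2 - e * y\<^sup>2 \<le> (x - y)\<^sup>2" for x y :: real
  proof -
    have "(1 + e) * ((x - y)\<^sup>2 - (e * (1 - e) * x\<^sup>2 - e * y\<^sup>2)) = ((1 + e) * y - x)\<^sup>2 + e ^ 3 * x\<^sup>2"
      by (simp add: power2_eq_square power3_eq_cube algebra_simps)
    also have "\<dots> \<ge> 0" using e by simp
    finally show ?thesis using e by (simp add: zero_le_mult_iff)
  qed
  define V where "V = {(u, v)\<in>U. u \<in> Y}"
  have fV: "finite V" using fUW unfolding V_def by (auto intro: finite_subset)
  let ?Up = "\<lambda>u. {v\<in>E u. lv u < lv v}" and ?Dn = "\<lambda>u. {v\<in>E u. lv v < lv u}"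
  have "(\<Sum>(u, v)\<in>V. e * (1 - e) * (f u)\<^sup>2 - e * (f v)\<^sup>2) \<le> (\<Sum>(u, v)\<in>V. (f u - f v)\<^sup>2)"
    by (intro sum_mono) (use elem in auto)
  also have "\<dots> \<le> (\<Sum>(u, v)\<in>U. (f u - f v)\<^sup>2)"
    by (rule sum_mono2[OF fUW(1)]) (auto simp: V_def)
  finally have "(\<Sum>(u, v)\<in>V. e * (1 - e) * (f u)\<^sup>2 - e * (f v)\<^sup>2) \<le> ?Q" using QU by linarith
  moreover have "(\<Sum>(u, v)\<in>V. e * (1 - e) * (f u)\<^sup>2 - e * (f v)\<^sup>2) =
    e * (1 - e) * (\<Sum>(u, v)\<in>V. (f u)\<^sup>2) - e * (\<Sum>(u, v)\<in>V. (f v)\<^sup>2)"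
    by (simp add: sum_subtractf sum_distrib_left split_def)
  moreover have "(\<Sum>(u, v)\<in>V. (f u)\<^sup>2) = (\<Sum>u\<in>?S \<inter> Y. real (card (?Up u)) * (f u)\<^sup>2)"
  proof -
    have "(\<Sum>(u, v)\<in>V. (f u)\<^sup>2) = (\<Sum>(u, v)\<in>Sigma (?S \<inter> Y) ?Up. (f u)\<^sup>2)"
      by (rule sum.mono_neutral_right) (use fV in \<open>auto simp: V_def U_def P_def\<close>)
    also have "\<dots> = (\<Sum>u\<in>?S \<inter> Y. \<Sum>v\<in>?Up u. (f u)\<^sup>2)"
      by (rule sum.Sigma[symmetric]) (use fS Ef in auto)
    finally show ?thesis by simp
  qed
  \<comment> \<open>Seen from its upper end, an edge of \<open>V\<close> goes down; closedness of
    \<open>Y\<close> makes the two descriptions agree.\<close>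
  moreover have "(\<Sum>(u, v)\<in>V. (f v)\<^sup>2) = (\<Sum>u\<in>?S \<inter> Y. real (card (?Dn u)) * (f u)\<^sup>2)"
  proof -
    have "(\<Sum>(u, v)\<in>V. (f v)\<^sup>2) = (\<Sum>(u, v)\<in>prod.swap ` V. (f u)\<^sup>2)"
      by (subst sum.reindex) (auto intro!: sum.cong)
    also have "\<dots> = (\<Sum>(u, v)\<in>Sigma (?S \<inter> Y) ?Dn. (f u)\<^sup>2)"
    proof (rule sum.mono_neutral_right)
      show "Sigma (?S \<inter> Y) ?Dn \<subseteq> prod.swap ` V"
      proof
        fix z assume "z \<in> Sigma (?S \<inter> Y) ?Dn"
        then obtain u v where z: "z = (u, v)" "f u \<noteq> 0" "u \<in> Y" "v \<in> E u" "lv v < lv u" by auto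
        then have "(v, u) \<in> V" using Es closed unfolding V_def U_def P_def by auto
        then show "z \<in> prod.swap ` V" using z by (force simp: image_iff)
      qed
      show "\<forall>z\<in>prod.swap ` V - Sigma (?S \<inter> Y) ?Dn. (case z of (u, v) \<Rightarrow> (f u)\<^sup>2) = 0"
      proof
        fix z assume z: "z \<in> prod.swap ` V - Sigma (?S \<inter> Y) ?Dn"
        then obtain u v where uv: "z = (v, u)" "(u, v) \<in> V" by auto
        then have "v \<in> E u" "u \<in> Y" "lv u < lv v" unfolding V_def U_def P_def by auto
        then have "v \<in> Y" "u \<in> ?Dn v" using closed Es by auto
        then show "(case z of (u, v) \<Rightarrow> (f u)\<^sup>2) = 0" using z uv by auto
      qed
    qed (use fV in auto)
    also have "\<dots> = (\<Sum>u\<in>?S \<inter> Y. \<Sum>v\<in>?Dn u. (f u)\<^sup>2)"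
      by (rule sum.Sigma[symmetric]) (use fS Ef in auto)
    finally show ?thesis by simp
  qed
  moreover have "(\<Sum>u\<in>?S \<inter> Y. (f u)\<^sup>2) / (4 * real B) \<le>
     e * (1 - e) * (\<Sum>u\<in>?S \<inter> Y. real (card (?Up u)) * (f u)\<^sup>2) - e * (\<Sum>u\<in>?S \<inter> Y. real (card (?Dn u)) * (f u)\<^sup>2)"
    unfolding sum_divide_distrib sum_distrib_left sum_subtractf[symmetric]
  proof (rule sum_mono)
    fix u assume u: "u \<in> ?S \<inter> Y"
    have "card (?Up u) \<le> card (E u)" by (rule card_mono) (use Ef in auto)
    then have a: "real (card (?Up u)) \<le> real B" using card[of u] u by simp
    have b: "real (card (?Dn u)) + 1 \<le> real (card (?Up u))" using up[of u] u by simp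
    have "e * real (card (?Up u)) \<le> e * real B" using a e(1) by (intro mult_left_mono) auto
    also have "\<dots> = 1 / 2" using e(2) by (simp add: mult.commute)
    finally have "e * real (card (?Up u)) \<le> 1 / 2" .
    then have "1 / 2 \<le> (1 - e) * real (card (?Up u)) - real (card (?Dn u))" using b by (simp add: algebra_simps)
    then have "e * (1 / 2) \<le> e * ((1 - e) * real (card (?Up u)) - real (card (?Dn u)))"
      using e(1) by (intro mult_left_mono) auto
    then have "e * (1 / 2) * (f u)\<^sup>2 \<le> e * ((1 - e) * real (card (?Up u)) - real (card (?Dn u))) * (f u)\<^sup>2"
      by (rule mult_right_mono) simp
    moreover have "(f u)\<^sup>2 / (4 * real B) = e * (1 / 2) * (f u)\<^sup>2" unfolding e_def by simp
    ultimately show "(f u)\<^sup>2 / (4 * real B) \<le>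
      e * (1 - e) * (real (card (?Up u)) * (f u)\<^sup>2) - e * (real (card (?Dn u)) * (f u)\<^sup>2)"
      by (simp add: algebra_simps)
  qed
  moreover have "{u. f u \<noteq> 0 \<and> u \<in> Y} = ?S \<inter> Y" by auto
  ultimately show ?thesis by simp
qed

section \<open>Loops around short cycles\<close>

definition near_cycle :: "'v graph \<Rightarrow> nat \<Rightarrow> nat \<Rightarrow> 'v \<Rightarrow> 'v list \<Rightarrow> bool" where
  "near_cycle G K R y xs \<longleftrightarrow> is_cycle G xs \<and> length xs \<le> K \<and> (\<exists>x\<in>set xs. \<exists>k\<le>R. (y, x) \<in> adj G ^^ k)"

text \<open>Vertex sets are compared, not lists, since rotations and reversals of one cycle must not
  count as a second cycle.\<close>

definition good_vertex :: "'v graph \<Rightarrow> nat \<Rightarrow> nat \<Rightarrow> 'v \<Rightarrow> bool" where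
  "good_vertex G K R y \<longleftrightarrow>
     (\<exists>xs ys. near_cycle G K R y xs \<and> near_cycle G K R y ys \<and> set xs \<noteq> set ys)"

text \<open>The window has \<open>K + 1\<close> successive indices, more than the length of the
  cycle, so it meets every vertex wherever it starts.\<close>

lemma cyclic_window:
  fixes s t K :: nat
  assumes "xs \<noteq> []" "length xs \<le> K"
  shows "(\<lambda>i. xs ! ((s + i) mod length xs)) ` {t..t + K} = set xs"
proof
  let ?c = "length xs"
  have c: "0 < ?c" using assms by simp
  show "(\<lambda>i. xs ! ((s + i) mod ?c)) ` {t..t + K} \<subseteq> set xs" using c by auto
  show "set xs \<subseteq> (\<lambda>i. xs ! ((s + i) mod ?c)) ` {t..t + K}"
  proof
    fix x assume "x \<in> set xs"
    then obtain j where j: "j < ?c" "x = xs ! j" by (auto simp: in_set_conv_nth)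
    define m where "m = (s + t) mod ?c"
    have m: "m < ?c" using c unfolding m_def by simp
    define d where "d = (j + (?c - m)) mod ?c"
    have d: "d < ?c" using c unfolding d_def by simp
    have "(s + (t + d)) mod ?c = ((s + t) mod ?c + d mod ?c) mod ?c"
      by (simp add: mod_add_eq add.assoc)
    also have "\<dots> = (m + (j + (?c - m))) mod ?c"
      unfolding m_def[symmetric] d_def by (simp add: mod_add_right_eq)
    also have "m + (j + (?c - m)) = j + ?c" using m by simp
    finally have "(s + (t + d)) mod ?c = j" using j by simp
    moreover have "t + d \<in> {t..t + K}" using d assms(2) by simp
    ultimately show "x \<in> (\<lambda>i. xs ! ((s + i) mod ?c)) ` {t..t + K}"
      using j(2) by (intro image_eqI[of _ _ "t + d"]) auto
  qed
qed

lemma cyclic_walk: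
  assumes "simple_graph G" "is_cycle G xs"
  shows "walk G (\<lambda>i. xs ! ((s + i) mod length xs)) k"
    and "reduced_walk (\<lambda>i. xs ! ((s + i) mod length xs)) k"
proof -
  let ?c = "length xs"
  have c: "3 \<le> ?c" "distinct xs" "(last xs, hd xs) \<in> adj G"
    "\<And>i. Suc i < ?c \<Longrightarrow> (xs ! i, xs ! Suc i) \<in> adj G"
    using assms(2) unfolding is_cycle_def by auto
  have ne: "xs \<noteq> []" using c(1) by auto
  have adj: "(xs ! (i mod ?c), xs ! (Suc i mod ?c)) \<in> adj G" for i
  proof (cases "Suc (i mod ?c) = ?c")
    case True
    then have "Suc i mod ?c = 0" by (simp add: mod_Suc)
    moreover have "i mod ?c = ?c - 1" using True by simp
    ultimately show ?thesis using c(3) ne by (simp add: last_conv_nth hd_conv_nth)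
  next
    case False
    then have "Suc i mod ?c = Suc (i mod ?c)" by (simp add: mod_Suc)
    moreover have "Suc (i mod ?c) < ?c" using False mod_less_divisor[of ?c i] c(1) by linarith
    ultimately show ?thesis using c(4) by simp
  qed
  show "walk G (\<lambda>i. xs ! ((s + i) mod ?c)) k"
    unfolding walk_def using adj simple_graph_adj_verts[OF assms(1) adj] by auto
  show "reduced_walk (\<lambda>i. xs ! ((s + i) mod ?c)) k"
    unfolding reduced_walk_def
  proof (intro allI impI notI)
    fix i assume "xs ! ((s + i) mod ?c) = xs ! ((s + (i + 2)) mod ?c)"
    then have "(s + i) mod ?c = (s + (i + 2)) mod ?c"
      using c(2) ne nth_eq_iff_index_eq[of xs "(s + i) mod ?c" "(s + (i + 2)) mod ?c"] by simp
    then have "(s + i + 2) mod ?c = (s + i) mod ?c" by (simp add: add.assoc)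
    then have "?c dvd s + i + 2 - (s + i)" by (subst (asm) mod_eq_dvd_iff_nat) auto
    then have "?c dvd 2" by simp
    then show False using c(1) by (auto dest: dvd_imp_le)
  qed
qed

text \<open>The loop goes to the cycle by a shortest path, winds around it an even number of times
  and goes back. Evenness provides a midpoint \<open>h\<close>. The many turns put the window
  \<open>{R..R + K}\<close>, read from either end, inside one half of the loop and onto the cycle;
  the window is the same for all cycles, which allows two of them to be compared.\<close>

lemma loop_around_cycle:
  assumes G: "simple_graph G" and y: "y \<in> verts G" and near: "near_cycle G K R y xs"
  shows "\<exists>W h. walk G W (2 * h) \<and> reduced_walk W (2 * h) \<and> W 0 = y \<and> W (2 * h) = y \<and> 0 < h \<and>
    R + K \<le> h \<and> 2 * h \<le> 2 * (R + (R + K) * K) \<and>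
    W ` {R..R + K} = set xs \<and> (\<lambda>i. W (2 * h - i)) ` {R..R + K} = set xs"
proof -
  have cyc: "is_cycle G xs" and cK: "length xs \<le> K" using near unfolding near_cycle_def by auto
  let ?c = "length xs"
  have c3: "3 \<le> ?c" using cyc unfolding is_cycle_def by simp
  then have ne: "xs \<noteq> []" by auto
  let ?near = "\<lambda>k. \<exists>x\<in>set xs. (y, x) \<in> adj G ^^ k"
  \<comment> \<open>Minimality of \<open>a\<close> keeps the path off the cycle before its end, so
    no backtracking arises where path and cycle meet.\<close>
  define a where "a = (LEAST k. ?near k)"
  obtain k0 where k0: "k0 \<le> R" "?near k0" using near unfolding near_cycle_def by blast
  have na: "?near a" unfolding a_def by (rule LeastI[of ?near, OF k0(2)])
  have aR: "a \<le> R" unfolding a_def by (rule order_trans[OF Least_le[of ?near, OF k0(2)] k0(1)])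
  have amin: "a \<le> k" if "?near k" for k unfolding a_def by (rule Least_le[of ?near, OF that])
  obtain x where x: "x \<in> set xs" "(y, x) \<in> adj G ^^ a" using na by blast
  obtain p where p: "walk G p a" "p 0 = y" "p a = x" using relpow_walk[OF x(2) y] by blast
  have pred: "reduced_walk p a"
    by (rule shortest_walk_reduced[OF G p(1)]) (use p x amin in auto)
  have pout: "p i \<notin> set xs" if "i < a" for i
    using walk_relpow[OF p(1), of 0 i] p(2) amin[of i] that by auto
  obtain s where s: "s < ?c" "xs ! s = x" using x(1) by (auto simp: in_set_conv_nth)
  define z where "z i = xs ! ((s + i) mod ?c)" for i
  have zin: "z i \<in> set xs" for i unfolding z_def using ne by simp
  have z0: "z (m * ?c) = x" for m unfolding z_def using s by simp
  \<comment> \<open>Half the number of turns: even a single step per turn would push the midpoint to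
    \<open>R + K\<close>.\<close>
  define n where "n = R + K"
  define N where "N = 2 * n * ?c"
  have nc: "n \<le> n * ?c" using c3 by (cases ?c) auto
  have big: "R + K \<le> N"
  proof -
    have "N = 2 * (n * ?c)" unfolding N_def by (simp add: mult.assoc)
    moreover have "R + K = n" unfolding n_def ..
    ultimately show ?thesis using nc by linarith
  qed
  let ?q = "join_walk z N (\<lambda>i. p (a - i))"
  let ?W = "join_walk p a ?q"
  have e2: "z N = p (a - 0)" using z0[of "2 * n"] p(3) unfolding N_def by simp
  have e1: "p a = ?q 0" using p(3) z0[of 0] by simp
  have zw: "walk G z N" "reduced_walk z N"
    using cyclic_walk[OF G cyc] unfolding z_def by auto
  have q: "walk G ?q (N + a)" by (rule walk_join[OF zw(1) walk_rev[OF G p(1)] e2])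
  have qr: "reduced_walk ?q (N + a)"
  proof (rule reduced_join[OF zw(2) reduced_rev[OF pred] e2])
    assume "0 < N" "0 < a"
    then show "z (N - 1) \<noteq> p (a - 1)" using zin pout[of "a - 1"] by (metis One_nat_def diff_Suc_less)
  qed
  have W: "walk G ?W (a + (N + a))" by (rule walk_join[OF p(1) q e1])
  have npos: "1 \<le> N" unfolding N_def n_def using c3 cK by auto
  have Wr: "reduced_walk ?W (a + (N + a))"
  proof (rule reduced_join[OF pred qr e1])
    assume "0 < a"
    have "?q 1 = z 1" using npos by simp
    then show "p (a - 1) \<noteq> ?q 1" using zin pout[of "a - 1"] \<open>0 < a\<close> by (metis One_nat_def diff_Suc_less)
  qed
  define h where "h = a + n * ?c"
  have h2: "2 * h = a + (N + a)" unfolding h_def N_def by simp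
  have Wmid: "?W i = z (i - a)" if "a \<le> i" "i \<le> a + N" for i
  proof -
    have "?W i = ?q (i - a)" by (rule join_walk_later[of p a ?q i, OF e1 that(1)])
    then show ?thesis using that by simp
  qed
  have win1: "?W ` {R..R + K} = set xs"
  proof -
    have "?W ` {R..R + K} = (\<lambda>i. z (i - a)) ` {R..R + K}"
      by (rule image_cong[OF refl], rule Wmid) (use aR big in auto)
    also have "\<dots> = z ` (\<lambda>i. i - a) ` {R..R + K}" by (simp add: image_image)
    also have "(\<lambda>i. i - a) ` {R..R + K} = {R - a..(R - a) + K}"
    proof
      show "(\<lambda>i. i - a) ` {R..R + K} \<subseteq> {R - a..(R - a) + K}" using aR by auto
      show "{R - a..(R - a) + K} \<subseteq> (\<lambda>i. i - a) ` {R..R + K}"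
      proof
        fix j assume "j \<in> {R - a..(R - a) + K}"
        then have "j + a \<in> {R..R + K}" "j = j + a - a" using aR by auto
        then show "j \<in> (\<lambda>i. i - a) ` {R..R + K}" by blast
      qed
    qed
    finally show ?thesis unfolding z_def using cyclic_window[OF ne cK] by simp
  qed
  have win2: "(\<lambda>i. ?W (2 * h - i)) ` {R..R + K} = set xs"
  proof -
    let ?t = "a + N - (R + K)"
    have "(\<lambda>i. ?W (2 * h - i)) ` {R..R + K} = (\<lambda>i. z (a + N - i)) ` {R..R + K}"
    proof (rule image_cong[OF refl])
      fix i assume i: "i \<in> {R..R + K}"
      have "?W (2 * h - i) = z (2 * h - i - a)" by (rule Wmid) (use i big aR h2 in auto)
      then show "?W (2 * h - i) = z (a + N - i)" using h2 by (simp add: algebra_simps)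
    qed
    also have "\<dots> = z ` (\<lambda>i. a + N - i) ` {R..R + K}" by (simp add: image_image)
    also have "(\<lambda>i. a + N - i) ` {R..R + K} = {?t..?t + K}"
    proof
      show "(\<lambda>i. a + N - i) ` {R..R + K} \<subseteq> {?t..?t + K}" using big by auto
      show "{?t..?t + K} \<subseteq> (\<lambda>i. a + N - i) ` {R..R + K}"
      proof
        fix j assume "j \<in> {?t..?t + K}"
        then have "a + N - j \<in> {R..R + K}" "j = a + N - (a + N - j)" using big by auto
        then show "j \<in> (\<lambda>i. a + N - i) ` {R..R + K}" by blast
      qed
    qed
    finally show ?thesis unfolding z_def using cyclic_window[OF ne cK] by simp
  qed
  have "?W (a + (N + a)) = ?q (N + a)" by (rule join_walk_simps(2)[of p a ?q, OF e1])
  also have "\<dots> = y" using join_walk_simps(2)[of z N "\<lambda>i. p (a - i)" a, OF e2] p(2) by simp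
  finally have We: "?W (2 * h) = y" using h2 by simp
  have "?W 0 = y" using p(2) by simp
  moreover have "R + K \<le> h" using nc unfolding h_def n_def by linarith
  moreover have "0 < h" using \<open>R + K \<le> h\<close> c3 cK by linarith
  moreover have "2 * h \<le> 2 * (R + (R + K) * K)"
    unfolding h_def n_def by (intro mult_le_mono2 add_mono aR cK order_refl)
  ultimately show ?thesis using W Wr We win1 win2 h2 by metis
qed

section \<open>Sizes of balls under a degree bound, and padding of walks\<close>

lemma ball_verts_0: "u \<in> verts G \<Longrightarrow> ball_verts 0 (G, u) = {u}"
  unfolding ball_verts_def by auto

lemma ball_verts_Suc_subset:
  "ball_verts (Suc r) (G, u) \<subseteq> ball_verts r (G, u) \<union> (\<Union>x\<in>ball_verts r (G, u). nbrs G x)"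
  if "simple_graph G" "u \<in> verts G"
proof
  fix v assume "v \<in> ball_verts (Suc r) (G, u)"
  then obtain k where k: "v \<in> verts G" "k \<le> Suc r" "(u, v) \<in> adj G ^^ k" unfolding ball_verts_def by auto
  show "v \<in> ball_verts r (G, u) \<union> (\<Union>x\<in>ball_verts r (G, u). nbrs G x)"
  proof (cases "k \<le> r")
    case True
    then show ?thesis using k unfolding ball_verts_def by auto
  next
    case False
    then have "k = Suc r" using k by simp
    then obtain x where x: "(u, x) \<in> adj G ^^ r" "(x, v) \<in> adj G" using k(3) by auto
    then have "x \<in> ball_verts r (G, u)"
      using simple_graph_adj_verts[OF that(1) x(2)] unfolding ball_verts_def by auto
    then show ?thesis using x(2) unfolding nbrs_def by auto
  qed
qed

lemma card_ball_verts:
  assumes "loc_fin G" "\<And>x. card (nbrs G x) \<le> D" "u \<in> verts G"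
  shows "finite (ball_verts r (G, u)) \<and> card (ball_verts r (G, u)) \<le> (D + 1) ^ r"
proof (induction r)
  case 0
  then show ?case using ball_verts_0[OF assms(3)] by simp
next
  case (Suc r)
  let ?B = "ball_verts r (G, u)"
  have sg: "simple_graph G" using assms(1) unfolding loc_fin_def by simp
  have fn: "finite (nbrs G x)" for x using loc_fin_sym_nbrs[OF assms(1)] unfolding sym_nbrs_def by blast
  have fin: "finite (?B \<union> (\<Union>x\<in>?B. nbrs G x))" using Suc fn by auto
  have "card (\<Union>x\<in>?B. nbrs G x) \<le> (\<Sum>x\<in>?B. card (nbrs G x))" by (rule card_UN_le) (use Suc in auto)
  also have "\<dots> \<le> card ?B * D" using sum_bounded_above[of ?B "\<lambda>x. card (nbrs G x)" D] assms(2) by simp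
  finally have "card (?B \<union> (\<Union>x\<in>?B. nbrs G x)) \<le> card ?B + card ?B * D"
    using card_Un_le[of ?B "\<Union>x\<in>?B. nbrs G x"] by linarith
  also have "\<dots> = card ?B * (D + 1)" by simp
  also have "\<dots> \<le> (D + 1) ^ r * (D + 1)" using Suc by (intro mult_le_mono1) auto
  finally have "card (?B \<union> (\<Union>x\<in>?B. nbrs G x)) \<le> (D + 1) ^ Suc r" by (simp add: mult.commute)
  then show ?case using ball_verts_Suc_subset[OF sg assms(3), of r] fin card_mono[OF fin] finite_subset
    by (metis order_trans)
qed

text \<open>The even surplus is spent going back and forth along the edge to
  \<open>w\<close>.\<close>

lemma relpow_pad:
  assumes "simple_graph G" "(u, w) \<in> adj G" "(u, v) \<in> adj G ^^ d" "d \<le> L" "even (L - d)"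
  shows "(u, v) \<in> adj G ^^ L"
proof -
  have "(u, v) \<in> adj G ^^ (2 * m + d)" for m
  proof (induction m)
    case 0
    then show ?case using assms(3) by simp
  next
    case (Suc m)
    have "(u, v) \<in> adj G ^^ Suc (Suc (2 * m + d))"
      by (rule relpow_Suc_I2[OF assms(2)], rule relpow_Suc_I2[OF simple_graph_adj_sym[OF assms(1,2)]]) (rule Suc)
    then show ?case by simp
  qed
  moreover obtain m where "L - d = 2 * m" using assms(5) by blast
  then have "L = 2 * m + d" using assms(4) by simp
  ultimately show ?thesis by simp
qed

lemma connected_graph_nbr:
  assumes "connected_graph G" "u \<in> verts G" "v \<in> verts G" "u \<noteq> v"
  shows "\<exists>w. (u, w) \<in> adj G"
proof -
  have "(u, v) \<in> (adj G)\<^sup>*" using assms unfolding connected_graph_def by blast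
  then show ?thesis using assms(4) by (auto elim: converse_rtranclE)
qed

section \<open>Moving along fibres of the covering\<close>

text \<open>The degree bound \<open>D\<close> is a parameter because one bound has to serve all
  graphs of the sequence.\<close>

locale finite_tree_cover = tree_cover T G \<pi>
  for T :: "'t graph" and G :: "'v graph" and \<pi> :: "'t \<Rightarrow> 'v" +
  fixes D :: nat
  assumes finite_G: "finite (verts G)" and connected_G: "connected_graph G"
    and degree: "\<And>u. card (nbrs T u) \<le> D"
begin

lemma loc_fin_G: "loc_fin G"
proof -
  have "finite (nbrs G v)" for v
    by (rule finite_subset[OF _ finite_G]) (use simple_graph_adj_verts[OF simple] in \<open>auto simp: nbrs_def\<close>)
  then show ?thesis unfolding loc_fin_def locally_finite_graph_def using simple by simp
qed

lemma loc_fin_T: "loc_fin T"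
proof -
  have "finite (nbrs T v)" if "v \<in> verts T" for v
    using proj_nbrs_bij[OF that] loc_fin_sym_nbrs[OF loc_fin_G] bij_betw_finite unfolding sym_nbrs_def by blast
  then show ?thesis unfolding loc_fin_def locally_finite_graph_def using simple_T by simp
qed

lemma degree_G: "card (nbrs G y) \<le> D"
proof (cases "y \<in> verts G")
  case True
  then obtain x where "x \<in> verts T" "\<pi> x = y" using proj_surj by blast
  then show ?thesis using proj_nbrs_bij[of x] degree[of x] bij_betw_same_card by metis
next
  case False
  then have "nbrs G y = {}" using simple_graph_adj_verts[OF simple] unfolding nbrs_def by auto
  then show ?thesis by simp
qed

text \<open>Even distances up to \<open>2 * l\<close> are those for which a walk of length exactly
  \<open>2 * l\<close> exists, and for which the connecting geodesic has a midpoint.\<close>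

definition fibre_nbrs :: "nat \<Rightarrow> 't \<Rightarrow> 't set" where
  "fibre_nbrs l u = {v. u \<in> verts T \<and> v \<in> verts T \<and> v \<noteq> u \<and> \<pi> v = \<pi> u \<and> (\<exists>j\<le>l. gdist T u v = 2 * j)}"

lemma fibre_nbrs_ball: "fibre_nbrs l u \<subseteq> ball_verts (2 * l) (T, u)"
proof
  fix v assume "v \<in> fibre_nbrs l u"
  then have "v \<in> verts T" "gdist T u v \<le> 2 * l" "(u, v) \<in> adj T ^^ gdist T u v"
    unfolding fibre_nbrs_def using gdist_relpow[OF connected_T] by auto
  then show "v \<in> ball_verts (2 * l) (T, u)" unfolding ball_verts_def by auto
qed

lemma card_fibre_nbrs: "finite (fibre_nbrs l u)" "card (fibre_nbrs l u) \<le> (D + 1) ^ (2 * l)"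
proof -
  have "finite (fibre_nbrs l u) \<and> card (fibre_nbrs l u) \<le> (D + 1) ^ (2 * l)"
  proof (cases "u \<in> verts T")
    case True
    show ?thesis
      using card_ball_verts[OF loc_fin_T degree True, of "2 * l"] fibre_nbrs_ball[of l u]
      by (meson card_mono finite_subset order_trans)
  next
    case False
    then have "fibre_nbrs l u = {}" unfolding fibre_nbrs_def by simp
    then show ?thesis by simp
  qed
  then show "finite (fibre_nbrs l u)" "card (fibre_nbrs l u) \<le> (D + 1) ^ (2 * l)" by auto
qed

lemma sym_fibre_nbrs: "sym_nbrs (fibre_nbrs l)"
proof -
  have "v \<in> fibre_nbrs l u \<longleftrightarrow> u \<in> fibre_nbrs l v" for u v
    unfolding fibre_nbrs_def using gdist_sym[OF simple_T, of u v] by auto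
  then show ?thesis unfolding sym_nbrs_def using card_fibre_nbrs by blast
qed

text \<open>\<open>inverse_point u (g u) = g\<inverse> u\<close> for every deck transformation \<open>g\<close>.\<close>

definition inverse_point :: "'t \<Rightarrow> 't \<Rightarrow> 't" where
  "inverse_point u v = (SOME h. deck h \<and> h v = u) u"

lemma inverse_pointE:
  assumes "v \<in> fibre_nbrs l u"
  obtains h where "deck h" "h v = u" "inverse_point u v = h u"
proof -
  have "\<exists>h. deck h \<and> h v = u"
    using assms deck_exists[of v u] unfolding fibre_nbrs_def by auto
  then have "deck (SOME h. deck h \<and> h v = u) \<and> (SOME h. deck h \<and> h v = u) v = u" by (rule someI_ex)
  then show thesis using that unfolding inverse_point_def by blast
qed

lemma fibre_nbrs_geodesic:
  assumes "v \<in> fibre_nbrs l u"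
  obtains w j where "walk T w (2 * j)" "reduced_walk w (2 * j)" "w 0 = u" "w (2 * j) = v" "j \<le> l"
proof -
  obtain j where j: "j \<le> l" "gdist T u v = 2 * j" and uv: "u \<in> verts T" "v \<in> verts T"
    using assms unfolding fibre_nbrs_def by auto
  then show thesis using geodesic_walk[OF connected_T uv] that by metis
qed

lemma fibre_nbrsI:
  assumes "walk T w (2 * j)" "reduced_walk w (2 * j)" "\<pi> (w 0) = \<pi> (w (2 * j))" "0 < j" "j \<le> l"
  shows "w (2 * j) \<in> fibre_nbrs l (w 0)"
  unfolding fibre_nbrs_def
  using walk_verts[OF simple_T assms(1), of 0] walk_verts[OF simple_T assms(1), of "2 * j"] assms
    tree_reduced_gdist[OF tree assms(1,2)] tree_reduced_neq[OF tree assms(1,2), of 0 "2 * j"] by auto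

lemma inverse_walk:
  assumes "walk T w (2 * j)" "reduced_walk w (2 * j)" "w 0 = u" "w (2 * j) = v" "deck h" "h v = u"
  shows "walk T (\<lambda>i. h (w (2 * j - i))) (2 * j)" "reduced_walk (\<lambda>i. h (w (2 * j - i))) (2 * j)"
  using deck_walk[OF assms(5) walk_rev[OF simple_T assms(1)]]
    deck_reduced[OF assms(5) walk_rev[OF simple_T assms(1)] reduced_rev[OF assms(2)]] by auto

text \<open>The transformation \<open>h\<close> carries the reversed geodesic from \<open>v\<close>
  to \<open>u\<close> to one from \<open>u\<close> to \<open>h u\<close>, of the same even
  length.\<close>

lemma inverse_point_fibre_nbrs:
  assumes "v \<in> fibre_nbrs l u"
  shows "inverse_point u v \<in> fibre_nbrs l u"
proof -
  obtain h where h: "deck h" "h v = u" "inverse_point u v = h u" using inverse_pointE[OF assms] by blast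
  obtain w j where w: "walk T w (2 * j)" "reduced_walk w (2 * j)" "w 0 = u" "w (2 * j) = v" "j \<le> l"
    using fibre_nbrs_geodesic[OF assms] by blast
  have uv: "u \<in> verts T" "v \<noteq> u" using assms unfolding fibre_nbrs_def by auto
  have "0 < j" using w uv by (cases j) auto
  then show ?thesis
    using fibre_nbrsI[OF inverse_walk[OF w(1-4) h(1,2)]] w h deck_proj[OF h(1) uv(1)] by simp
qed

text \<open>Inversion in the deck group is an involution; freeness of the action identifies the
  transformation chosen for \<open>h u\<close> with the inverse of \<open>h\<close>.\<close>

lemma inverse_point_involutive:
  assumes "v \<in> fibre_nbrs l u"
  shows "inverse_point u (inverse_point u v) = v"
proof -
  obtain h where h: "deck h" "h v = u" "inverse_point u v = h u" using inverse_pointE[OF assms] by blast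
  obtain h' where h': "deck h'" "h' (h u) = u" "inverse_point u (h u) = h' u"
    using inverse_pointE[OF inverse_point_fibre_nbrs[OF assms]] h by metis
  obtain g where g: "deck g" "\<And>x. x \<in> verts T \<Longrightarrow> g (h x) = x" using deck_inverse[OF h(1)] by metis
  have uv: "u \<in> verts T" "v \<in> verts T" using assms unfolding fibre_nbrs_def by auto
  have "h' u = g u"
    by (rule deck_unique[OF h'(1) g(1) deck_verts[OF h(1) uv(1)]]) (use g h' uv in auto)
  also have "\<dots> = v" using g(2)[OF uv(2)] h(2) by simp
  finally show ?thesis using h h' by simp
qed

text \<open>If neither \<open>g\<close> nor \<open>g\<inverse>\<close> moved \<open>u\<close> away from the root \<open>r\<close>, the geodesics from \<open>u\<close> to \<open>g u\<close> and to
  \<open>g\<inverse> u\<close> would share their midpoint, which \<open>g\<close> would then fix.\<close>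

lemma inverse_point_farther:
  assumes r: "r \<in> verts T" and v: "v \<in> fibre_nbrs l u" and le: "gdist T r v \<le> gdist T r u"
  shows "gdist T r u < gdist T r (inverse_point u v)"
proof (rule ccontr)
  assume "\<not> ?thesis"
  then have le': "gdist T r (inverse_point u v) \<le> gdist T r u" by simp
  obtain h where h: "deck h" "h v = u" "inverse_point u v = h u" using inverse_pointE[OF v] by blast
  obtain w j where w: "walk T w (2 * j)" "reduced_walk w (2 * j)" "w 0 = u" "w (2 * j) = v" "j \<le> l"
    using fibre_nbrs_geodesic[OF v] by blast
  have uv: "u \<in> verts T" "v \<in> verts T" "v \<noteq> u" using v unfolding fibre_nbrs_def by auto
  obtain q where q: "walk T q (gdist T u r)" "q 0 = u" "q (gdist T u r) = r" "reduced_walk q (gdist T u r)"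
    using geodesic_walk[OF connected_T uv(1) r] by blast
  have "q j = w j"
    using tree_geodesic_half_common[OF tree w(1,2) q(1,4)] w q le by auto
  moreover have "q j = h (w (2 * j - j))"
    using tree_geodesic_half_common[OF tree inverse_walk[OF w(1-4) h(1,2)] q(1,4)] w q h le' by auto
  ultimately have "h (w j) = w j" by simp
  then have "h v = v"
    using deck_unique[OF h(1) deck_id, of "w j" v] walk_verts[OF simple_T w(1), of j] uv by auto
  then show False using h(2) uv(3) by simp
qed

text \<open>Inversion injects the fibre neighbours below \<open>u\<close> into those above. If there
  is no surplus above, the injection is onto: every point above is the inverse of one below, and a
  point at the level of \<open>u\<close> cannot exist, since its inverse would lie above and come
  from a point below.\<close>

lemma card_down_le_card_up:
  assumes r: "r \<in> verts T"
  shows "card {v\<in>fibre_nbrs l u. gdist T r v < gdist T r u} < card {v\<in>fibre_nbrs l u. gdist T r u < gdist T r v} \<or>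
    (\<forall>v\<in>fibre_nbrs l u. gdist T r v < gdist T r u \<or> gdist T r (inverse_point u v) < gdist T r u)"
proof (cases "card {v\<in>fibre_nbrs l u. gdist T r v < gdist T r u} < card {v\<in>fibre_nbrs l u. gdist T r u < gdist T r v}")
  case False
  let ?E = "fibre_nbrs l u"
  let ?D = "{v\<in>?E. gdist T r v < gdist T r u}" and ?U = "{v\<in>?E. gdist T r u < gdist T r v}"
  have fin: "finite ?D" "finite ?U" using card_fibre_nbrs by auto
  have inj: "inj_on (inverse_point u) ?E"
    by (rule inj_on_inverseI[of _ "inverse_point u"]) (rule inverse_point_involutive)
  have sub: "inverse_point u ` ?D \<subseteq> ?U"
    using inverse_point_farther[OF r] inverse_point_fibre_nbrs by fastforce
  have "card (inverse_point u ` ?D) = card ?D" by (rule card_image) (use inj in \<open>auto intro: inj_on_subset\<close>)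
  then have eq: "inverse_point u ` ?D = ?U" using card_subset_eq[OF fin(2) sub] card_mono[OF fin(2) sub] False by linarith
  have "gdist T r v < gdist T r u \<or> gdist T r (inverse_point u v) < gdist T r u" if v: "v \<in> ?E" for v
  proof (cases "gdist T r u < gdist T r v")
    case True
    then have "v \<in> inverse_point u ` ?D" using eq v by auto
    then obtain d where "d \<in> ?D" "v = inverse_point u d" by blast
    then show ?thesis using inverse_point_involutive by auto
  next
    case le: False
    then have "inverse_point u v \<in> inverse_point u ` ?D"
      using inverse_point_farther[OF r v] inverse_point_fibre_nbrs[OF v] eq by auto
    then obtain d where "d \<in> ?D" "inverse_point u v = inverse_point u d" by blast
    then have "v = d" using inj v by (auto dest: inj_onD)
    then show ?thesis using \<open>d \<in> ?D\<close> by simp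
  qed
  then show ?thesis by blast
qed simp

text \<open>A cycle close to \<open>\<pi> u\<close> yields an element \<open>g\<close> of the deck group that translates far along a lift of
  the cycle. If \<open>g\<close> or its inverse moves \<open>u\<close> towards the root, the geodesic to the root follows the lift
  for so long that a fixed window of it projects onto the whole cycle.\<close>

lemma geodesic_window:
  assumes r: "r \<in> verts T" and u: "u \<in> verts T" and near: "near_cycle G K R (\<pi> u) xs"
    and l: "l = R + (R + K) * K"
    and split: "\<forall>v\<in>fibre_nbrs l u. gdist T r v < gdist T r u \<or> gdist T r (inverse_point u v) < gdist T r u"
    and q: "walk T q (gdist T u r)" "q 0 = u" "q (gdist T u r) = r" "reduced_walk q (gdist T u r)"
  shows "(\<lambda>i. \<pi> (q i)) ` {R..R + K} = set xs"
proof -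
  obtain W h where W: "walk G W (2 * h)" "reduced_walk W (2 * h)" "W 0 = \<pi> u" "W (2 * h) = \<pi> u" "0 < h"
    "R + K \<le> h" "2 * h \<le> 2 * (R + (R + K) * K)"
    "W ` {R..R + K} = set xs" "(\<lambda>i. W (2 * h - i)) ` {R..R + K} = set xs"
    using loop_around_cycle[OF simple proj_verts[OF u] near] by blast
  obtain w where w: "walk T w (2 * h)" "w 0 = u" "\<forall>i\<le>2 * h. \<pi> (w i) = W i"
    using lift_exists[OF W(1) u] W(3) by auto
  have wr: "reduced_walk w (2 * h)" by (rule lift_reduced[OF W(2) w(3)])
  define v where "v = w (2 * h)"
  have v: "v \<in> fibre_nbrs l u"
    unfolding v_def using fibre_nbrsI[OF w(1) wr] w W l by auto
  obtain g where g: "deck g" "g v = u" "inverse_point u v = g u" using inverse_pointE[OF v] by blast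
  from split v consider "gdist T r v \<le> gdist T r u" | "gdist T r (inverse_point u v) \<le> gdist T r u"
    by (auto intro: less_imp_le)
  then show ?thesis
  proof cases
    case 1
    have "\<forall>i\<le>h. q i = w i"
      using tree_geodesic_half_common[OF tree w(1) wr q(1,4)] w q 1 unfolding v_def by auto
    then have "\<pi> (q i) = W i" if "i \<in> {R..R + K}" for i using that w W by auto
    then show ?thesis using W(8) by (simp cong: image_cong_simp)
  next
    case 2
    have "\<forall>i\<le>h. q i = g (w (2 * h - i))"
      using tree_geodesic_half_common[OF tree inverse_walk[OF w(1) wr w(2) v_def[symmetric] g(1,2)] q(1,4)]
        w q 2 g v_def by auto
    moreover have "\<pi> (g (w (2 * h - i))) = W (2 * h - i)" for i
      using deck_proj[OF g(1)] walk_verts[OF simple_T w(1), of "2 * h - i"] w(3) by auto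
    ultimately have "\<pi> (q i) = W (2 * h - i)" if "i \<in> {R..R + K}" for i using that W by auto
    then show ?thesis using W(9) by (simp cong: image_cong_simp)
  qed
qed

text \<open>Without a surplus above, one and the same window of the geodesic from \<open>u\<close>
  to \<open>r\<close> would project onto both cycles, whose vertex sets differ.\<close>

lemma good_vertex_up:
  assumes r: "r \<in> verts T" and u: "u \<in> verts T" and good: "good_vertex G K R (\<pi> u)"
    and l: "l = R + (R + K) * K"
  shows "card {v\<in>fibre_nbrs l u. gdist T r v < gdist T r u} < card {v\<in>fibre_nbrs l u. gdist T r u < gdist T r v}"
proof (rule ccontr)
  assume "\<not> ?thesis"
  then have split: "\<forall>v\<in>fibre_nbrs l u. gdist T r v < gdist T r u \<or> gdist T r (inverse_point u v) < gdist T r u"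
    using card_down_le_card_up[OF r] by blast
  obtain xs ys where xy: "near_cycle G K R (\<pi> u) xs" "near_cycle G K R (\<pi> u) ys" "set xs \<noteq> set ys"
    using good unfolding good_vertex_def by blast
  obtain q where q: "walk T q (gdist T u r)" "q 0 = u" "q (gdist T u r) = r" "reduced_walk q (gdist T u r)"
    using geodesic_walk[OF connected_T u r] by blast
  show False
    using geodesic_window[OF r u xy(1) l split q] geodesic_window[OF r u xy(2) l split q] xy(3) by simp
qed

end

section \<open>Linearity of the pairing, and adjointness with one finitely supported
  argument\<close>

lemma ip_add_left: "fin_supp f \<Longrightarrow> fin_supp g \<Longrightarrow> ip (\<lambda>x. f x + g x) h = ip f h + ip g h"
proof -
  assume f: "fin_supp f" "fin_supp g"
  let ?B = "{x. f x \<noteq> 0} \<union> {x. g x \<noteq> 0}"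
  have B: "finite ?B" using f unfolding fin_supp_def by simp
  have "ip (\<lambda>x. f x + g x) h = (\<Sum>x\<in>?B. (f x + g x) * h x)" "ip f h = (\<Sum>x\<in>?B. f x * h x)"
    "ip g h = (\<Sum>x\<in>?B. g x * h x)" by (rule ip_eq_sum[OF B], auto)+
  then show ?thesis by (simp add: sum.distrib algebra_simps)
qed

lemma ip_diff: "fin_supp f \<Longrightarrow> ip f (\<lambda>x. g x - h x) = ip f g - ip f h"
  by (simp add: ip_supp algebra_simps sum_subtractf)

lemma ip_diff_left: "fin_supp f \<Longrightarrow> fin_supp g \<Longrightarrow> ip (\<lambda>x. f x - g x) h = ip f h - ip g h"
proof -
  assume f: "fin_supp f" "fin_supp g"
  let ?B = "{x. f x \<noteq> 0} \<union> {x. g x \<noteq> 0}"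
  have B: "finite ?B" using f unfolding fin_supp_def by simp
  have "ip (\<lambda>x. f x - g x) h = (\<Sum>x\<in>?B. (f x - g x) * h x)" "ip f h = (\<Sum>x\<in>?B. f x * h x)"
    "ip g h = (\<Sum>x\<in>?B. g x * h x)" by (rule ip_eq_sum[OF B], auto)+
  then show ?thesis by (simp add: sum_subtractf algebra_simps)
qed

lemma fin_supp_add: "fin_supp f \<Longrightarrow> fin_supp g \<Longrightarrow> fin_supp (\<lambda>x. f x + g x)"
  unfolding fin_supp_def by (rule finite_subset[of _ "{x. f x \<noteq> 0} \<union> {x. g x \<noteq> 0}"]) auto

lemma fin_supp_diff: "fin_supp f \<Longrightarrow> fin_supp g \<Longrightarrow> fin_supp (\<lambda>x. f x - g x)"
  unfolding fin_supp_def by (rule finite_subset[of _ "{x. f x \<noteq> 0} \<union> {x. g x \<noteq> 0}"]) auto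

lemma fin_supp_mult: "fin_supp f \<Longrightarrow> fin_supp (\<lambda>x. a x * f x)"
  unfolding fin_supp_def by (rule finite_subset[of _ "{x. f x \<noteq> 0}"]) auto

lemma sym_operator_add:
  "sym_operator A \<Longrightarrow> sym_operator B \<Longrightarrow> sym_operator (\<lambda>f x. A f x + B f x)"
  unfolding sym_operator_def by (simp add: fin_supp_add ip_add ip_add_left)

lemma sym_operator_diff:
  "sym_operator A \<Longrightarrow> sym_operator B \<Longrightarrow> sym_operator (\<lambda>f x. A f x - B f x)"
  unfolding sym_operator_def by (simp add: fin_supp_diff ip_diff ip_diff_left)

lemma ip_mult_left: "ip (\<lambda>x. a x * f x) g = ip f (\<lambda>x. a x * g x)"
  unfolding ip_def by (intro sum.cong) (auto simp: algebra_simps)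

lemma sym_operator_mult: "sym_operator (\<lambda>f x. a x * f x)"
  unfolding sym_operator_def by (simp add: fin_supp_mult ip_mult_left)

text \<open>Here \<open>g\<close> may have infinite support, as the indicator of a fibre can; only
  its values near the support of \<open>f\<close> enter, so it may be truncated.\<close>

lemma nbr_sum_adjoint_left:
  assumes N: "sym_nbrs N" and f: "fin_supp f"
  shows "ip (nbr_sum N f) g = ip f (nbr_sum N g)"
proof -
  let ?B = "{x. nbr_sum N f x \<noteq> 0} \<union> (\<Union>v\<in>{x. f x \<noteq> 0}. N v)"
  have B: "finite ?B"
    using fin_supp_nbr_sum[OF N f] f N unfolding fin_supp_def sym_nbrs_def by auto
  define g' where "g' x = (if x \<in> ?B then g x else 0)" for x
  have g': "fin_supp g'" unfolding fin_supp_def g'_def by (rule finite_subset[OF _ B]) auto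
  have "ip (nbr_sum N f) g = ip (nbr_sum N f) g'"
    unfolding ip_supp[OF fin_supp_nbr_sum[OF N f]] by (intro sum.cong) (auto simp: g'_def)
  also have "\<dots> = ip f (nbr_sum N g')" by (rule nbr_sum_adjoint[OF N f g'])
  also have "\<dots> = ip f (nbr_sum N g)"
    unfolding ip_supp[OF f] nbr_sum_def
    by (intro sum.cong refl arg_cong2[of _ _ _ _ "(*)"]) (auto simp: g'_def)
  finally show ?thesis .
qed

lemma sum_squares_le_square_sum:
  fixes h :: "'a \<Rightarrow> real"
  assumes "finite S" "\<And>x. x \<in> S \<Longrightarrow> 0 \<le> h x"
  shows "(\<Sum>x\<in>S. (h x)\<^sup>2) \<le> (\<Sum>x\<in>S. h x)\<^sup>2"
  using assms
proof (induction S rule: finite_induct)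
  case (insert a S)
  have "0 \<le> h a * (\<Sum>x\<in>S. h x)" using insert by (intro mult_nonneg_nonneg sum_nonneg) auto
  then show ?case using insert by (simp add: power2_sum)
qed simp

context finite_tree_cover
begin

section \<open>Moving the short loops to the diagonal\<close>

text \<open>In \<open>boosted l\<close> every step of length \<open>2 * l\<close> on \<open>T\<close> that ends in the same fibre as it started,
  but elsewhere, is turned into staying put (once for each such endpoint). On \<open>G\<close> both versions of the
  step are the same, so nothing changes after projecting; on \<open>T\<close> the quadratic form
  grows by the Dirichlet energy along the fibres.\<close>

definition boosted :: "nat \<Rightarrow> ('t \<Rightarrow> real) \<Rightarrow> 't \<Rightarrow> real" where
  "boosted l h u = (adjacency_operator T ^^ (2 * l)) h u +
     (real (card (fibre_nbrs l u)) * h u - nbr_sum (fibre_nbrs l) h u)"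

lemma sym_operator_boosted: "sym_operator (boosted l)"
proof -
  have "sym_operator (\<lambda>h u. (adjacency_operator T ^^ (2 * l)) h u +
     (real (card (fibre_nbrs l u)) * h u - nbr_sum (fibre_nbrs l) h u))"
    by (intro sym_operator_add sym_operator_diff sym_operator_pow sym_operator_adjacency loc_fin_T
      sym_operator_mult sym_operator_nbr_sum sym_fibre_nbrs)
  moreover have "boosted l = (\<lambda>h u. (adjacency_operator T ^^ (2 * l)) h u +
     (real (card (fibre_nbrs l u)) * h u - nbr_sum (fibre_nbrs l) h u))"
    by (intro ext) (simp add: boosted_def)
  ultimately show ?thesis by simp
qed

text \<open>The subtracted sum takes away one walk of length \<open>2 * l\<close> to each fibre
  neighbour, and such a walk exists by padding the geodesic.\<close>

lemma boosted_nonneg: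
  assumes "\<And>x. 0 \<le> h x"
  shows "0 \<le> boosted l h u"
proof -
  have "(u, v) \<in> adj T ^^ (2 * l)" if "v \<in> fibre_nbrs l u" for v
  proof -
    have uv: "u \<in> verts T" "v \<in> verts T" "v \<noteq> u" using that unfolding fibre_nbrs_def by auto
    have "\<exists>j\<le>l. gdist T u v = 2 * j" using that unfolding fibre_nbrs_def by simp
    then obtain j where j: "j \<le> l" "gdist T u v = 2 * j" by blast
    obtain w where "(u, w) \<in> adj T" using connected_graph_nbr[OF connected_T uv(1,2)] uv(3) by auto
    then show ?thesis
      using relpow_pad[OF simple_T _ gdist_relpow[OF connected_T uv(1,2)], of w "2 * l"] j by auto
  qed
  then have "nbr_sum (fibre_nbrs l) h u \<le> (adjacency_operator T ^^ (2 * l)) h u"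
    unfolding nbr_sum_def by (intro adjacency_pow_ge_sum[OF loc_fin_T] assms card_fibre_nbrs(1))
  moreover have "0 \<le> real (card (fibre_nbrs l u)) * h u" using assms by simp
  ultimately show ?thesis unfolding boosted_def by linarith
qed

lemma boosted_supp:
  assumes "\<And>x. x \<notin> verts T \<Longrightarrow> h x = 0" "x \<notin> verts T"
  shows "boosted l h x = 0"
proof -
  have "fibre_nbrs l x = {}" using assms(2) unfolding fibre_nbrs_def by simp
  then show ?thesis using adjacency_pow_supp[OF simple_T assms] unfolding boosted_def nbr_sum_def by simp
qed

text \<open>The sum of \<open>h\<close> over the fibre of \<open>y\<close>, written as a pairing so
  that operators can be moved to the indicator of the fibre.\<close>

definition push :: "('t \<Rightarrow> real) \<Rightarrow> 'v \<Rightarrow> real" where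
  "push h y = ip h (\<lambda>x. if \<pi> x = y then 1 else 0)"

text \<open>By adjointness it suffices to apply the operator to the indicator of a fibre, and a
  vertex of \<open>T\<close> has exactly one neighbour above each neighbour of its image.\<close>

lemma push_adjacency:
  assumes "fin_supp h" "\<And>x. x \<notin> verts T \<Longrightarrow> h x = 0"
  shows "push (adjacency_operator T h) = adjacency_operator G (push h)"
proof
  fix y
  have fG: "finite (nbrs G y)" using loc_fin_sym_nbrs[OF loc_fin_G] unfolding sym_nbrs_def by blast
  let ?e = "\<lambda>y x. if \<pi> x = y then 1 else 0 :: real"
  have "push (adjacency_operator T h) y = ip h (nbr_sum (nbrs T) (?e y))"
    unfolding push_def adjacency_operator_nbr_sum
    by (rule nbr_sum_adjoint_left[OF loc_fin_sym_nbrs[OF loc_fin_T] assms(1)])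
  also have "\<dots> = (\<Sum>x | h x \<noteq> 0. h x * (\<Sum>z\<in>nbrs G y. ?e z x))"
    unfolding ip_supp[OF assms(1)]
  proof (intro sum.cong refl arg_cong2[of _ _ _ _ "(*)"])
    fix x assume "x \<in> {x. h x \<noteq> 0}"
    then have x: "x \<in> verts T" using assms(2) by auto
    have fT: "finite (nbrs T x)" using loc_fin_sym_nbrs[OF loc_fin_T] unfolding sym_nbrs_def by blast
    have "nbr_sum (nbrs T) (?e y) x = (\<Sum>z\<in>\<pi> ` nbrs T x. if z = y then 1 else 0)"
      unfolding nbr_sum_def
      by (subst sum.reindex) (use proj_nbrs_bij[OF x] in \<open>auto simp: bij_betw_def\<close>)
    also have "\<dots> = (if y \<in> nbrs G (\<pi> x) then 1 else 0)"
      using proj_nbrs_bij[OF x] finite_imageI[OF fT, of \<pi>] by (simp add: bij_betw_def)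
    also have "\<dots> = (if \<pi> x \<in> nbrs G y then 1 else 0)"
      using simple_graph_adj_sym[OF simple] unfolding nbrs_def by auto
    also have "\<dots> = (\<Sum>z\<in>nbrs G y. ?e z x)" using fG by simp
    finally show "nbr_sum (nbrs T) (?e y) x = (\<Sum>z\<in>nbrs G y. ?e z x)" .
  qed
  also have "\<dots> = (\<Sum>x | h x \<noteq> 0. \<Sum>z\<in>nbrs G y. h x * ?e z x)" by (simp add: sum_distrib_left)
  also have "\<dots> = (\<Sum>z\<in>nbrs G y. \<Sum>x | h x \<noteq> 0. h x * ?e z x)" by (rule sum.swap)
  also have "\<dots> = adjacency_operator G (push h) y"
    unfolding adjacency_operator_def push_def ip_supp[OF assms(1)] ..
  finally show "push (adjacency_operator T h) y = adjacency_operator G (push h) y" .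
qed

lemma push_adjacency_pow:
  assumes "fin_supp h" "\<And>x. x \<notin> verts T \<Longrightarrow> h x = 0"
  shows "push ((adjacency_operator T ^^ k) h) = (adjacency_operator G ^^ k) (push h)"
proof (induction k)
  case (Suc k)
  have "push (adjacency_operator T ((adjacency_operator T ^^ k) h)) =
    adjacency_operator G (push ((adjacency_operator T ^^ k) h))"
    by (rule push_adjacency[OF sym_operator_fin_pow[OF sym_operator_adjacency[OF loc_fin_T] assms(1)]
      adjacency_pow_supp[OF simple_T assms(2)]])
  then show ?case using Suc by simp
qed simp

text \<open>The indicator of a fibre is constant along the fibre graph, so the Laplacian of that
  graph annihilates it and the correction term vanishes.\<close>

lemma push_boosted:
  assumes "fin_supp h" "\<And>x. x \<notin> verts T \<Longrightarrow> h x = 0"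
  shows "push (boosted l h) = (adjacency_operator G ^^ (2 * l)) (push h)"
proof
  fix y
  let ?e = "\<lambda>x. if \<pi> x = y then 1 else 0 :: real"
  let ?E = "fibre_nbrs l"
  have f1: "fin_supp ((adjacency_operator T ^^ (2 * l)) h)"
    by (rule sym_operator_fin_pow[OF sym_operator_adjacency[OF loc_fin_T] assms(1)])
  have f2: "fin_supp (\<lambda>x. real (card (?E x)) * h x)" by (rule fin_supp_mult[OF assms(1)])
  have f3: "fin_supp (nbr_sum ?E h)" by (rule fin_supp_nbr_sum[OF sym_fibre_nbrs assms(1)])
  have "ip (nbr_sum ?E h) ?e = ip h (nbr_sum ?E ?e)"
    by (rule nbr_sum_adjoint_left[OF sym_fibre_nbrs assms(1)])
  also have "nbr_sum ?E ?e = (\<lambda>x. real (card (?E x)) * ?e x)"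
  proof
    fix x
    have "nbr_sum ?E ?e x = (\<Sum>v\<in>?E x. ?e x)"
      unfolding nbr_sum_def by (intro sum.cong) (auto simp: fibre_nbrs_def)
    then show "nbr_sum ?E ?e x = real (card (?E x)) * ?e x" by simp
  qed
  also have "ip h \<dots> = ip (\<lambda>x. real (card (?E x)) * h x) ?e" by (rule ip_mult_left[symmetric])
  finally have eq: "ip (nbr_sum ?E h) ?e = ip (\<lambda>x. real (card (?E x)) * h x) ?e" .
  have "push (boosted l h) y = ip ((adjacency_operator T ^^ (2 * l)) h) ?e +
    (ip (\<lambda>x. real (card (?E x)) * h x) ?e - ip (nbr_sum ?E h) ?e)"
    unfolding push_def boosted_def
    by (simp add: ip_add_left[OF f1 fin_supp_diff[OF f2 f3]] ip_diff_left[OF f2 f3])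
  also have "\<dots> = push ((adjacency_operator T ^^ (2 * l)) h) y" using eq unfolding push_def by simp
  also have "\<dots> = (adjacency_operator G ^^ (2 * l)) (push h) y" using push_adjacency_pow[OF assms] by simp
  finally show "push (boosted l h) y = (adjacency_operator G ^^ (2 * l)) (push h) y" .
qed

lemma push_pt: "push (pt u) = pt (\<pi> u)"
  unfolding push_def ip_pt by (auto simp: pt_def)

text \<open>Nonnegative values cannot cancel within a fibre, where the sum of squares is at most the
  square of the sum.\<close>

lemma ip_le_push:
  assumes "fin_supp h" "\<And>x. x \<notin> verts T \<Longrightarrow> h x = 0" "\<And>x. 0 \<le> h x"
  shows "ip h h \<le> ip (push h) (push h)"
proof -
  let ?S = "{x. h x \<noteq> 0}"
  have S: "finite ?S" using assms(1) unfolding fin_supp_def .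
  have p: "push h y = (\<Sum>x\<in>{x\<in>?S. \<pi> x = y}. h x)" for y
  proof -
    have "push h y = (\<Sum>x\<in>?S. if \<pi> x = y then h x else 0)"
      unfolding push_def ip_supp[OF assms(1)] by (intro sum.cong) auto
    then show ?thesis using sum.inter_filter[OF S, of h "\<lambda>x. \<pi> x = y"] by simp
  qed
  have out: "push h y = 0" if "y \<notin> verts G" for y
  proof -
    have "{x\<in>?S. \<pi> x = y} = {}" using assms(2) proj_verts that by auto
    then show ?thesis using p[of y] by (metis sum.empty)
  qed
  have "ip h h = (\<Sum>x\<in>?S. (h x)\<^sup>2)" by (simp add: ip_supp[OF assms(1)] power2_eq_square)
  also have "\<dots> = (\<Sum>y\<in>verts G. \<Sum>x\<in>{x\<in>?S. \<pi> x = y}. (h x)\<^sup>2)"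
    by (rule sum.group[symmetric]) (use S finite_G assms(2) proj_verts in auto)
  also have "\<dots> \<le> (\<Sum>y\<in>verts G. (push h y)\<^sup>2)"
    unfolding p by (intro sum_mono sum_squares_le_square_sum) (use S assms(3) in auto)
  also have "\<dots> = ip (push h) (push h)"
    unfolding power2_eq_square by (rule ip_eq_sum[OF finite_G, symmetric]) (use out in auto)
  finally show ?thesis .
qed

text \<open>The boosted iterates still project to adjacency powers of the point mass at
  \<open>\<pi> u\<close>, so whatever they gain in norm on the tree bounds closed walks on the
  finite graph.\<close>

lemma boosted_le_return_count:
  fixes k :: nat
  assumes u: "u \<in> verts T"
  defines "f \<equiv> (adjacency_operator T ^^ k) (pt u)"
  shows "ip ((boosted l ^^ m) f) ((boosted l ^^ m) f) \<le> return_count G (k + 2 * l * m) (\<pi> u)"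
proof -
  have pu: "pt u x = 0" if "x \<notin> verts T" for x using u that unfolding pt_def by auto
  have f: "fin_supp f" unfolding f_def
    by (rule sym_operator_fin_pow[OF sym_operator_adjacency[OF loc_fin_T] fin_supp_pt])
  have f0: "f x = 0" if "x \<notin> verts T" for x
    unfolding f_def by (rule adjacency_pow_supp[OF simple_T pu that])
  have fn: "0 \<le> f x" for x unfolding f_def by (rule adjacency_pow_nonneg[OF pt_nonneg])
  have fin: "fin_supp ((boosted l ^^ m) f)" for m by (rule sym_operator_fin_pow[OF sym_operator_boosted f])
  have supp: "(boosted l ^^ m) f x = 0" if "x \<notin> verts T" for m x
    using that by (induction m arbitrary: x) (use f0 boosted_supp in auto)
  have nonneg: "0 \<le> (boosted l ^^ m) f x" for m x
    by (induction m arbitrary: x) (use fn boosted_nonneg in auto)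
  have push: "push ((boosted l ^^ m) f) = (adjacency_operator G ^^ (k + 2 * l * m)) (pt (\<pi> u))" for m
  proof (induction m)
    case 0
    show ?case using push_adjacency_pow[OF fin_supp_pt pu] push_pt unfolding f_def by simp
  next
    case (Suc m)
    have "push ((boosted l ^^ Suc m) f) = (adjacency_operator G ^^ (2 * l)) (push ((boosted l ^^ m) f))"
      using push_boosted[OF fin supp] by simp
    also have "\<dots> = (adjacency_operator G ^^ (2 * l + (k + 2 * l * m))) (pt (\<pi> u))"
      by (subst funpow_add) (simp add: Suc)
    also have "2 * l + (k + 2 * l * m) = k + 2 * l * Suc m" by simp
    finally show ?case .
  qed
  show ?thesis unfolding return_count_def push[symmetric] by (rule ip_le_push[OF fin supp nonneg])
qed

section \<open>Mass transport\<close>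

lemma adjacency_pow_pt_supp:
  assumes "a \<in> verts T" "(adjacency_operator T ^^ k) (pt a) x \<noteq> 0"
  shows "x \<in> verts T"
proof (rule ccontr)
  assume "x \<notin> verts T"
  moreover have "pt a z = 0" if "z \<notin> verts T" for z using that assms(1) unfolding pt_def by auto
  ultimately show False using adjacency_pow_supp[OF simple_T] assms(2) by metis
qed

lemma deck_adjacency_pow:
  assumes "deck g" "a \<in> verts T" "b \<in> verts T"
  shows "(adjacency_operator T ^^ k) (pt (g a)) (g b) = (adjacency_operator T ^^ k) (pt a) b"
  using assms(3)
proof (induction k arbitrary: b)
  case 0
  then show ?case using deck_inj[OF assms(1)] assms(2) unfolding pt_def by (auto dest: inj_onD)
next
  case (Suc k)
  have sub: "nbrs T b \<subseteq> verts T" using simple_graph_adj_verts[OF simple_T] unfolding nbrs_def by auto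
  have im: "nbrs T (g b) = g ` nbrs T b"
  proof
    show "g ` nbrs T b \<subseteq> nbrs T (g b)" using deck_adj[OF assms(1)] unfolding nbrs_def by auto
    show "nbrs T (g b) \<subseteq> g ` nbrs T b"
    proof
      fix z assume z: "z \<in> nbrs T (g b)"
      obtain h where h: "deck h" "\<And>x. x \<in> verts T \<Longrightarrow> h (g x) = x" "\<And>x. x \<in> verts T \<Longrightarrow> g (h x) = x"
        using deck_inverse[OF assms(1)] by blast
      have zv: "z \<in> verts T" using z simple_graph_adj_verts[OF simple_T] unfolding nbrs_def by auto
      have "(h (g b), h z) \<in> adj T" using deck_adj[OF h(1)] z unfolding nbrs_def by auto
      then have "h z \<in> nbrs T b" using h(2)[OF Suc.prems] unfolding nbrs_def by simp
      then show "z \<in> g ` nbrs T b" using h(3)[OF zv] by (metis imageI)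
    qed
  qed
  have "(adjacency_operator T ^^ Suc k) (pt (g a)) (g b) =
    (\<Sum>v\<in>g ` nbrs T b. (adjacency_operator T ^^ k) (pt (g a)) v)"
    by (simp add: adjacency_operator_def[of T _ "g b"] im)
  also have "\<dots> = (\<Sum>v\<in>nbrs T b. (adjacency_operator T ^^ k) (pt (g a)) (g v))"
    by (subst sum.reindex) (use deck_inj[OF assms(1)] sub in \<open>auto intro: inj_on_subset\<close>)
  also have "\<dots> = (\<Sum>v\<in>nbrs T b. (adjacency_operator T ^^ k) (pt a) v)"
    by (intro sum.cong refl Suc.IH) (use sub in auto)
  finally show ?case by (simp add: adjacency_operator_def[of T _ b])
qed

lemma return_count_fibre:
  assumes "u \<in> verts T" "v \<in> verts T" "\<pi> u = \<pi> v"
  shows "return_count T k u = return_count T k v"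
proof -
  obtain g where "deck g" "g u = v" using deck_exists[OF assms] by blast
  then show ?thesis using deck_adjacency_pow[of g u u "2 * k"] assms(1)
    by (simp add: return_count_eq_pow[OF loc_fin_T])
qed

definition fibre_mass :: "nat \<Rightarrow> 't \<Rightarrow> 'v \<Rightarrow> real" where
  "fibre_mass k a y = (\<Sum>u | (adjacency_operator T ^^ k) (pt a) u \<noteq> 0 \<and> u \<in> verts T \<and> \<pi> u = y.
     ((adjacency_operator T ^^ k) (pt a) u)\<^sup>2)"

text \<open>Mass transport. If the deck transformation g takes \<open>u\<close> to \<open>b\<close>,
  the value at \<open>u\<close> of the function started at \<open>a\<close> equals the value at g a
  of the one started at \<open>b\<close>. Sending \<open>u\<close> to g a is a bijection from the
  fibre of \<open>b\<close> to the fibre of \<open>a\<close>, inverted by the same construction with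
  \<open>a\<close> and \<open>b\<close> exchanged.\<close>

lemma fibre_mass_sym:
  assumes "a \<in> verts T" "b \<in> verts T"
  shows "fibre_mass k a (\<pi> b) = fibre_mass k b (\<pi> a)"
proof -
  let ?f = "\<lambda>a. (adjacency_operator T ^^ k) (pt a)"
  define m where "m u b = (SOME h. deck h \<and> h u = b)" for u b
  have m: "deck (m u b) \<and> m u b u = b" if "u \<in> verts T" "b \<in> verts T" "\<pi> u = \<pi> b" for u b
    unfolding m_def by (rule someI_ex[of "\<lambda>h. deck h \<and> h u = b"]) (rule deck_exists[OF that])
  have val: "?f b (m u b a) = ?f a u" if "a \<in> verts T" "b \<in> verts T" "u \<in> verts T" "\<pi> u = \<pi> b" for a b u
  proof -
    have "?f a u = ?f (m u b a) (m u b u)" using deck_adjacency_pow[of "m u b" a u] m[of u b] that by simp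
    also have "\<dots> = ?f b (m u b a)" using m[of u b] that adjacency_pow_sym[OF loc_fin_T] by simp
    finally show ?thesis by simp
  qed
  have inv: "m (m u b a) a b = u" if "a \<in> verts T" "b \<in> verts T" "u \<in> verts T" "\<pi> u = \<pi> b" for a b u
  proof -
    have mu: "deck (m u b)" using m[of u b] that by simp
    obtain h where h: "deck h" "\<And>x. x \<in> verts T \<Longrightarrow> h (m u b x) = x"
      using deck_inverse[OF mu] by metis
    let ?u = "m u b a"
    have u': "?u \<in> verts T" "\<pi> ?u = \<pi> a" using m[of u b] deck_verts deck_proj that by auto
    have "m ?u a b = h b"
      by (rule deck_unique[of _ _ ?u]) (use m[of ?u a] u' h that in auto)
    also have "\<dots> = u" using h(2)[of u] m[of u b] that by auto
    finally show ?thesis .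
  qed
  have mem: "m u b a \<in> verts T \<and> \<pi> (m u b a) = \<pi> a" if "a \<in> verts T" "b \<in> verts T" "u \<in> verts T" "\<pi> u = \<pi> b" for a b u
    using m[of u b] deck_verts deck_proj that by auto
  show ?thesis unfolding fibre_mass_def
    by (rule sum.reindex_bij_witness[of _ "\<lambda>u. m u a b" "\<lambda>u. m u b a"])
      (use assms val inv mem in auto)
qed

lemma sum_fibre_mass:
  assumes "a \<in> verts T"
  shows "(\<Sum>y\<in>verts G. fibre_mass k a y) = return_count T k a"
proof -
  let ?f = "(adjacency_operator T ^^ k) (pt a)"
  let ?S = "{u. ?f u \<noteq> 0}"
  have f: "fin_supp ?f" by (rule sym_operator_fin_pow[OF sym_operator_adjacency[OF loc_fin_T] fin_supp_pt])
  then have S: "finite ?S" unfolding fin_supp_def .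
  have sub: "?S \<subseteq> verts T"
    using adjacency_pow_pt_supp[OF assms] by auto
  have "return_count T k a = (\<Sum>u\<in>?S. (?f u)\<^sup>2)"
    unfolding return_count_def by (simp add: ip_supp[OF f] power2_eq_square)
  also have "\<dots> = (\<Sum>y\<in>verts G. \<Sum>u\<in>{u\<in>?S. \<pi> u = y}. (?f u)\<^sup>2)"
    by (rule sum.group[symmetric]) (use S finite_G sub proj_verts in auto)
  also have "\<dots> = (\<Sum>y\<in>verts G. fibre_mass k a y)"
    unfolding fibre_mass_def by (intro sum.cong refl) (use sub in auto)
  finally show ?thesis by simp
qed

section \<open>Exponential growth of the number of closed walks\<close>

text \<open>Let \<open>q m\<close> be the total squared norm of the \<open>m\<close>-th boosted
  iterates of the test functions. The energy bound and mass transport raise the first ratio of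
  \<open>q\<close> to at least the square of \<open>x\<close>; log-convexity preserves this, and
  projection compares \<open>q m\<close> with closed walks of \<open>G\<close>.\<close>

lemma return_count_growth:
  assumes l: "l = R + (R + K) * K"
    and \<alpha>: "\<And>u. u \<in> verts T \<Longrightarrow> \<alpha> * return_count T k u \<le> return_count T (k + l) u"
    and c: "0 < c" "\<And>u v. u \<in> verts T \<Longrightarrow> v \<in> verts T \<Longrightarrow> return_count T k u \<le> c * return_count T k v"
    and one: "\<And>u. u \<in> verts T \<Longrightarrow> 1 \<le> return_count T k u"
    and \<delta>: "\<delta> * real (card (verts G)) \<le> real (card {y\<in>verts G. good_vertex G K R y})"
    and x: "x = \<alpha> + \<delta> / (4 * real ((D + 1) ^ (2 * l)) * c)" "0 < x"
  shows "real (card (verts G)) * (x\<^sup>2) ^ m \<le> (\<Sum>y\<in>verts G. return_count G (k + 2 * l * m) y)"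
proof -
  let ?V = "verts G" and ?A = "adjacency_operator T"
  let ?B = "(D + 1) ^ (2 * l)"
  let ?Y = "{y\<in>?V. good_vertex G K R y}"
  obtain s where s: "\<And>y. y \<in> ?V \<Longrightarrow> s y \<in> verts T \<and> \<pi> (s y) = y" using proj_surj by metis
  define f where "f y = (?A ^^ k) (pt (s y))" for y
  have f: "fin_supp (f y)" for y
    unfolding f_def by (rule sym_operator_fin_pow[OF sym_operator_adjacency[OF loc_fin_T] fin_supp_pt])
  have fv: "u \<in> verts T" if "y \<in> ?V" "f y u \<noteq> 0" for y u
    using adjacency_pow_pt_supp s[OF that(1)] that(2) unfolding f_def by blast
  define q where "q m = (\<Sum>y\<in>?V. ip ((boosted l ^^ m) (f y)) ((boosted l ^^ m) (f y)))" for m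
  have Vne: "?V \<noteq> {}" using connected_G unfolding connected_graph_def by simp
  obtain r where r: "r \<in> verts T" using tree unfolding tree_def connected_graph_def by auto
  have q0: "q 0 = (\<Sum>y\<in>?V. return_count T k (s y))" unfolding q_def f_def return_count_def by simp
  have q0ge: "real (card ?V) \<le> q 0"
    unfolding q0 using sum_mono[of ?V "\<lambda>_. 1" "\<lambda>y. return_count T k (s y)"] one s by simp
  then have q0pos: "q 0 > 0" using Vne finite_G by (metis card_gt_0_iff less_le_trans of_nat_0_less_iff)
  have energy: "(\<Sum>z\<in>?Y. fibre_mass k (s y) z) / (4 * real ?B) \<le>
     ip (f y) (\<lambda>u. real (card (fibre_nbrs l u)) * f y u - nbr_sum (fibre_nbrs l) (f y) u)" if y: "y \<in> ?V" for y
  proof -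
    let ?Z = "{u\<in>verts T. good_vertex G K R (\<pi> u)}"
    have "(\<Sum>u | f y u \<noteq> 0 \<and> u \<in> ?Z. (f y u)\<^sup>2) / (4 * real ?B) \<le>
     ip (f y) (\<lambda>u. real (card (fibre_nbrs l u)) * f y u - nbr_sum (fibre_nbrs l) (f y) u)"
    proof (rule Dirichlet_energy_lower_bound[OF sym_fibre_nbrs f, where lv = "gdist T r"])
      show "fibre_nbrs l u \<subseteq> ?Z" if "u \<in> ?Z" for u using that unfolding fibre_nbrs_def by auto
    qed (use card_fibre_nbrs(2) good_vertex_up[OF r _ _ l] in auto)
    moreover have "(\<Sum>u | f y u \<noteq> 0 \<and> u \<in> ?Z. (f y u)\<^sup>2) = (\<Sum>z\<in>?Y. fibre_mass k (s y) z)"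
    proof -
      have "(\<Sum>u | f y u \<noteq> 0 \<and> u \<in> ?Z. (f y u)\<^sup>2) =
        (\<Sum>z\<in>?Y. \<Sum>u\<in>{u\<in>{u. f y u \<noteq> 0 \<and> u \<in> ?Z}. \<pi> u = z}. (f y u)\<^sup>2)"
        by (rule sum.group[symmetric])
          (use f[of y] finite_G proj_verts in \<open>auto simp: fin_supp_def\<close>)
      also have "\<dots> = (\<Sum>z\<in>?Y. fibre_mass k (s y) z)"
        unfolding fibre_mass_def f_def[symmetric] by (intro sum.cong refl) auto
      finally show ?thesis .
    qed
    ultimately show ?thesis by simp
  qed
  \<comment> \<open>By symmetry, the mass that all functions put on good fibres is the mass sent out
    by the functions started above good vertices, which is their full return count; comparability
    turns the density \<delta> into the proportion \<open>\<delta> / c\<close>.\<close>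
  have mass: "\<delta> / c * q 0 \<le> (\<Sum>y\<in>?V. \<Sum>z\<in>?Y. fibre_mass k (s y) z)"
  proof -
    have "(\<Sum>y\<in>?V. \<Sum>z\<in>?Y. fibre_mass k (s y) z) = (\<Sum>z\<in>?Y. \<Sum>y\<in>?V. fibre_mass k (s z) y)"
    proof (subst sum.swap, intro sum.cong refl)
      fix z y assume "z \<in> ?Y" "y \<in> ?V"
      then show "fibre_mass k (s y) z = fibre_mass k (s z) y"
        using fibre_mass_sym[of "s y" "s z" k] s by auto
    qed
    also have "\<dots> = (\<Sum>z\<in>?Y. return_count T k (s z))"
      by (intro sum.cong refl sum_fibre_mass) (use s in auto)
    finally have eq: "(\<Sum>y\<in>?V. \<Sum>z\<in>?Y. fibre_mass k (s y) z) = (\<Sum>z\<in>?Y. return_count T k (s z))" .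
    have "q 0 \<le> real (card ?V) * (c * return_count T k (s z))" if "z \<in> ?Y" for z
      unfolding q0 using sum_bounded_above[of ?V "\<lambda>y. return_count T k (s y)" "c * return_count T k (s z)"]
        c(2) s that by auto
    then have "(\<Sum>z\<in>?Y. q 0) \<le> (\<Sum>z\<in>?Y. real (card ?V) * (c * return_count T k (s z)))"
      by (intro sum_mono)
    then have "real (card ?Y) * q 0 \<le> real (card ?V) * (c * (\<Sum>z\<in>?Y. return_count T k (s z)))"
      by (simp add: sum_distrib_left)
    moreover have "\<delta> * real (card ?V) * q 0 \<le> real (card ?Y) * q 0"
      using \<delta> q0pos by (intro mult_right_mono) auto
    ultimately have "real (card ?V) * (\<delta> * q 0) \<le> real (card ?V) * (c * (\<Sum>z\<in>?Y. return_count T k (s z)))"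
      by (simp add: algebra_simps)
    then have "\<delta> * q 0 \<le> c * (\<Sum>z\<in>?Y. return_count T k (s z))"
      using Vne finite_G by (simp add: card_gt_0_iff)
    then show ?thesis unfolding eq using c(1) by (simp add: pos_divide_le_eq mult.commute)
  qed
  \<comment> \<open>The quadratic form lies between the two norms: Cauchy-Schwarz gives
    \<open>s1\<^sup>2 \<le> q 0 * q 1\<close>, so a lower bound for \<open>s1\<close> yields one for
    the first ratio.\<close>
  define s1 where "s1 = (\<Sum>y\<in>?V. ip (f y) (boosted l (f y)))"
  have "ip (f y) (boosted l (f y)) \<ge> \<alpha> * return_count T k (s y) + (\<Sum>z\<in>?Y. fibre_mass k (s y) z) / (4 * real ?B)"
    if y: "y \<in> ?V" for y
  proof -
    have "ip (f y) (boosted l (f y)) = ip (f y) ((?A ^^ (2 * l)) (f y)) +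
      ip (f y) (\<lambda>u. real (card (fibre_nbrs l u)) * f y u - nbr_sum (fibre_nbrs l) (f y) u)"
      using ip_add[OF f[of y]] unfolding boosted_def by simp
    moreover have "ip (f y) ((?A ^^ (2 * l)) (f y)) = return_count T (k + l) (s y)"
    proof -
      have "(?A ^^ (2 * l)) (f y) = (?A ^^ (l + (k + l))) (pt (s y))"
        using funpow_add[of "2 * l" k ?A] unfolding f_def by (simp add: mult_2 add.assoc add.commute[of k])
      then show ?thesis
        using ip_pow_shift[OF sym_operator_adjacency[OF loc_fin_T] fin_supp_pt, of k "s y" l "k + l"]
        unfolding f_def return_count_def by simp
    qed
    ultimately show ?thesis using energy[OF y] \<alpha>[of "s y"] s[OF y] by simp
  qed
  then have "s1 \<ge> (\<Sum>y\<in>?V. \<alpha> * return_count T k (s y) + (\<Sum>z\<in>?Y. fibre_mass k (s y) z) / (4 * real ?B))"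
    unfolding s1_def by (rule sum_mono)
  also have "(\<Sum>y\<in>?V. \<alpha> * return_count T k (s y) + (\<Sum>z\<in>?Y. fibre_mass k (s y) z) / (4 * real ?B)) =
     \<alpha> * q 0 + (\<Sum>y\<in>?V. \<Sum>z\<in>?Y. fibre_mass k (s y) z) / (4 * real ?B)"
    unfolding q0 by (simp add: sum.distrib sum_distrib_left sum_divide_distrib)
  finally have s1a: "\<alpha> * q 0 + (\<Sum>y\<in>?V. \<Sum>z\<in>?Y. fibre_mass k (s y) z) / (4 * real ?B) \<le> s1" .
  have "x * q 0 = \<alpha> * q 0 + (\<delta> / c * q 0) / (4 * real ?B)" unfolding x(1) by (simp add: distrib_right)
  also have "\<dots> \<le> \<alpha> * q 0 + (\<Sum>y\<in>?V. \<Sum>z\<in>?Y. fibre_mass k (s y) z) / (4 * real ?B)"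
    using mass by (intro add_left_mono divide_right_mono) auto
  finally have s1: "x * q 0 \<le> s1" using s1a by linarith
  have s1q: "s1\<^sup>2 \<le> q 0 * q 1"
    unfolding s1_def q_def
  proof (rule sum_log_convex)
    fix y
    have "fin_supp (boosted l (f y))" using f sym_operator_boosted unfolding sym_operator_def by blast
    then show "(ip (f y) (boosted l (f y)))\<^sup>2 \<le>
      ip ((boosted l ^^ 0) (f y)) ((boosted l ^^ 0) (f y)) * ip ((boosted l ^^ 1) (f y)) ((boosted l ^^ 1) (f y))"
      using ip_Cauchy_Schwarz[OF f] by simp
  qed (rule ip_self_nonneg)+
  have "(x * q 0)\<^sup>2 \<le> s1\<^sup>2" using s1 x(2) q0pos by (intro power_mono) auto
  then have "x\<^sup>2 * q 0 * q 0 \<le> q 1 * q 0" using s1q by (simp add: power2_eq_square algebra_simps)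
  then have q1: "x\<^sup>2 * q 0 \<le> q (Suc 0)" using q0pos by simp
  have "q 0 * (x\<^sup>2) ^ m \<le> q (0 + m)"
  proof (rule log_convex_growth[OF _ q0pos _ q1])
    show "(q (Suc j))\<^sup>2 \<le> q j * q (Suc (Suc j))" for j
      unfolding q_def
      by (rule sum_log_convex) (rule ip_self_nonneg, rule ip_self_nonneg,
        rule sym_operator_log_convex[OF sym_operator_boosted f])
  qed (use x in simp)
  moreover have "q m \<le> (\<Sum>y\<in>?V. return_count G (k + 2 * l * m) y)"
    unfolding q_def f_def using boosted_le_return_count s by (intro sum_mono) metis
  moreover have "real (card ?V) * (x\<^sup>2) ^ m \<le> q 0 * (x\<^sup>2) ^ m" using q0ge by (intro mult_right_mono) auto
  ultimately show ?thesis by simp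
qed

end

section \<open>The growth rate of the tree\<close>

lemma power_ratio_unbounded:
  fixes a b :: real
  assumes "0 < b" "b < a"
  shows "\<exists>m. C * b ^ m < a ^ m"
proof -
  have "1 < a / b" using assms by simp
  then obtain m where "C < (a / b) ^ m" using real_arch_pow by blast
  then have "C * b ^ m < a ^ m" using assms by (simp add: power_divide pos_less_divide_eq)
  then show ?thesis by blast
qed

lemma adjacency_pow_expand:
  assumes "loc_fin G" "fin_supp f"
  shows "(adjacency_operator G ^^ m) f x = (\<Sum>v | f v \<noteq> 0. f v * (adjacency_operator G ^^ m) (pt v) x)"
proof -
  have "(adjacency_operator G ^^ m) f x = ip (pt x) ((adjacency_operator G ^^ m) f)" by (simp add: ip_pt)
  also have "\<dots> = ip ((adjacency_operator G ^^ m) (pt x)) f"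
    using sym_operator_pow[OF sym_operator_adjacency[OF assms(1)], of m] assms(2) unfolding sym_operator_def by simp
  also have "\<dots> = ip f ((adjacency_operator G ^^ m) (pt x))" by (rule ip_commute)
  finally show ?thesis using adjacency_pow_sym[OF assms(1), of m x] by (simp add: ip_supp[OF assms(2)])
qed

text \<open>If one step stretched the squared norm of \<open>f\<close> by more than \<Lambda>,
  log-convexity would propagate that rate. Expanding \<open>f\<close> in point masses bounds the
  squared norm after \<open>m\<close> steps by that of \<open>f\<close> times the size of the
  support times \<Lambda>^m.\<close>

lemma adjacency_fin_bound:
  assumes G: "loc_fin G" and \<Lambda>: "1 \<le> \<Lambda>" "\<And>k u. u \<in> verts G \<Longrightarrow> return_count G k u \<le> \<Lambda> ^ k"
    and f: "fin_supp f" "\<And>x. x \<notin> verts G \<Longrightarrow> f x = 0"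
  shows "ip (adjacency_operator G f) (adjacency_operator G f) \<le> \<Lambda> * ip f f"
proof (rule ccontr)
  let ?A = "adjacency_operator G"
  define q where "q m = ip ((?A ^^ m) f) ((?A ^^ m) f)" for m
  assume "\<not> ?thesis"
  then have q1: "\<Lambda> * q 0 < q 1" unfolding q_def by simp
  have lc: "(q (Suc j))\<^sup>2 \<le> q j * q (Suc (Suc j))" for j
    unfolding q_def by (rule sym_operator_log_convex[OF sym_operator_adjacency[OF G] f(1)])
  have q0: "q 0 > 0"
  proof (rule ccontr)
    assume "\<not> q 0 > 0"
    then have "q 0 = 0" unfolding q_def using ip_self_nonneg[of f] by simp
    then show False using lc[of 0] q1 by simp
  qed
  define x where "x = q 1 / q 0"
  have x: "\<Lambda> < x" using q0 q1 unfolding x_def by (simp add: pos_less_divide_eq)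
  have lower: "q 0 * x ^ m \<le> q m" for m
    using log_convex_growth[of q, OF lc q0, of x m] x \<Lambda>(1) q0 unfolding x_def by simp
  let ?S = "{v. f v \<noteq> 0}"
  have S: "finite ?S" using f(1) unfolding fin_supp_def .
  have upper: "q m \<le> q 0 * (real (card ?S) * \<Lambda> ^ m)" for m
  proof -
    let ?B = "{x. (?A ^^ m) f x \<noteq> 0}"
    have fm: "fin_supp ((?A ^^ m) h)" if "fin_supp h" for h
      by (rule sym_operator_fin_pow[OF sym_operator_adjacency[OF G] that])
    have B: "finite ?B" using fm[OF f(1)] unfolding fin_supp_def .
    have q0': "q 0 = (\<Sum>v\<in>?S. (f v)\<^sup>2)" unfolding q_def by (simp add: ip_supp[OF f(1)] power2_eq_square)
    have "q m = (\<Sum>x\<in>?B. ((?A ^^ m) f x)\<^sup>2)"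
      unfolding q_def by (simp add: ip_supp[OF fm[OF f(1)]] power2_eq_square)
    also have "\<dots> \<le> (\<Sum>x\<in>?B. q 0 * (\<Sum>v\<in>?S. ((?A ^^ m) (pt v) x)\<^sup>2))"
      unfolding q0' adjacency_pow_expand[OF G f(1)] by (intro sum_mono Cauchy_Schwarz_ineq_sum)
    also have "\<dots> = q 0 * (\<Sum>v\<in>?S. \<Sum>x\<in>?B. ((?A ^^ m) (pt v) x)\<^sup>2)"
      by (subst sum.swap) (simp add: sum_distrib_left)
    also have "\<dots> \<le> q 0 * (\<Sum>v\<in>?S. \<Lambda> ^ m)"
    proof (intro mult_left_mono sum_mono)
      fix v assume "v \<in> ?S"
      then have v: "v \<in> verts G" using f(2) by auto
      let ?h = "(?A ^^ m) (pt v)"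
      have h: "finite {x. ?h x \<noteq> 0}" using fm[OF fin_supp_pt] unfolding fin_supp_def .
      have "(\<Sum>x\<in>?B. (?h x)\<^sup>2) \<le> (\<Sum>x\<in>?B \<union> {x. ?h x \<noteq> 0}. (?h x)\<^sup>2)"
        by (rule sum_mono2) (use B h in auto)
      also have "\<dots> = (\<Sum>x | ?h x \<noteq> 0. (?h x)\<^sup>2)" by (rule sum.mono_neutral_right) (use B h in auto)
      also have "\<dots> = return_count G m v"
        unfolding return_count_def by (simp add: ip_supp[OF fm[OF fin_supp_pt]] power2_eq_square)
      also have "\<dots> \<le> \<Lambda> ^ m" by (rule \<Lambda>(2)[OF v])
      finally show "(\<Sum>x\<in>?B. (?h x)\<^sup>2) \<le> \<Lambda> ^ m" .
    qed (use q0 in simp)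
    finally show ?thesis by simp
  qed
  obtain m where "real (card ?S) * \<Lambda> ^ m < x ^ m" using power_ratio_unbounded[of \<Lambda> x] \<Lambda>(1) x by auto
  then have "q 0 * (real (card ?S) * \<Lambda> ^ m) < q 0 * x ^ m" using q0 by simp
  then show False using lower[of m] upper[of m] by linarith
qed

text \<open>Finitely many values of the image depend on finitely many values of \<open>f\<close>, so
  the bound for finite supports controls all finite partial sums.\<close>

lemma adjacency_norm_le:
  assumes G: "loc_fin G" and \<Lambda>: "1 \<le> \<Lambda>" "\<And>k u. u \<in> verts G \<Longrightarrow> return_count G k u \<le> \<Lambda> ^ k"
  shows "adjacency_norm G \<le> sqrt \<Lambda>"
  unfolding adjacency_norm_def
proof (rule cSUP_least)
  have "(\<lambda>_. 0) \<in> {f \<in> ell2 (verts G). ell2_norm (verts G) f \<le> 1}"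
    unfolding ell2_def ell2_norm_def by simp
  then show "{f \<in> ell2 (verts G). ell2_norm (verts G) f \<le> 1} \<noteq> {}" by blast
  fix f assume "f \<in> {f \<in> ell2 (verts G). ell2_norm (verts G) f \<le> 1}"
  then have sm: "(\<lambda>v. (f v)\<^sup>2) summable_on verts G" and n: "(\<Sum>\<^sub>\<infinity>v\<in>verts G. (f v)\<^sup>2) \<le> 1"
    unfolding ell2_def ell2_norm_def by auto
  let ?A = "adjacency_operator G"
  have sg: "simple_graph G" using G unfolding loc_fin_def by simp
  have bound: "(\<Sum>v\<in>F. (?A f v)\<^sup>2) \<le> \<Lambda>" if F: "finite F" "F \<subseteq> verts G" for F
  proof -
    define B where "B = (\<Union>v\<in>F. nbrs G v)"
    have B: "finite B" using F loc_fin_sym_nbrs[OF G] unfolding B_def sym_nbrs_def by auto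
    have Bv: "B \<subseteq> verts G" unfolding B_def nbrs_def using simple_graph_adj_verts[OF sg] by auto
    define g where "g x = (if x \<in> B then f x else 0)" for x
    have g: "fin_supp g" unfolding fin_supp_def g_def by (rule finite_subset[OF _ B]) auto
    have g0: "g x = 0" if "x \<notin> verts G" for x using Bv that unfolding g_def by auto
    have Ag: "fin_supp (?A g)" using sym_operator_adjacency[OF G] g unfolding sym_operator_def by blast
    have fAg: "finite {x. ?A g x \<noteq> 0}" using Ag unfolding fin_supp_def .
    have "(\<Sum>v\<in>F. (?A f v)\<^sup>2) = (\<Sum>v\<in>F. (?A g v)\<^sup>2)"
      unfolding adjacency_operator_def
      by (intro sum.cong refl arg_cong[of _ _ "\<lambda>x. x\<^sup>2"]) (auto simp: g_def B_def)
    also have "\<dots> \<le> (\<Sum>v\<in>F \<union> {x. ?A g x \<noteq> 0}. (?A g v)\<^sup>2)"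
      by (rule sum_mono2) (use F fAg in auto)
    also have "\<dots> = ip (?A g) (?A g)"
      unfolding power2_eq_square by (rule ip_eq_sum[symmetric]) (use F fAg in auto)
    also have "\<dots> \<le> \<Lambda> * ip g g" by (rule adjacency_fin_bound[OF G \<Lambda> g g0])
    also have "ip g g = (\<Sum>v\<in>B. (f v)\<^sup>2)"
      using ip_eq_sum[OF B, of g g] by (simp add: g_def power2_eq_square)
    also have "\<dots> \<le> (\<Sum>\<^sub>\<infinity>v\<in>verts G. (f v)\<^sup>2)"
      by (rule finite_sum_le_infsum[OF sm B Bv]) simp
    also have "\<dots> \<le> 1" by (rule n)
    finally show ?thesis using \<Lambda>(1) by (simp add: mult_left_mono)
  qed
  have "(\<lambda>v. (?A f v)\<^sup>2) summable_on verts G"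
    by (rule nonneg_bdd_above_summable_on) (use bound in \<open>auto intro!: bdd_aboveI[of _ \<Lambda>]\<close>)
  then have "(\<Sum>\<^sub>\<infinity>v\<in>verts G. (?A f v)\<^sup>2) \<le> \<Lambda>"
    by (rule infsum_le_finite_sums) (use bound in auto)
  then show "ell2_norm (verts G) (?A f) \<le> sqrt \<Lambda>" unfolding ell2_norm_def by simp
qed

section \<open>Growth of return counts, uniformly over the vertices of the tree\<close>

context finite_tree_cover
begin

text \<open>Return counts are constant on fibres, every fibre comes within the diameter of
  \<open>G\<close> of any vertex of \<open>T\<close>, and each step of displacement costs a bounded
  factor. The constant precedes \<open>k\<close> in the quantifiers, so that the gain can be fixed
  before \<open>k\<close>.\<close>

lemma return_count_comparable:
  "\<exists>c>0. \<forall>k. \<forall>u\<in>verts T. \<forall>v\<in>verts T. return_count T k u \<le> c * return_count T k v"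
proof -
  \<comment> \<open>The maximum with 1 makes powers monotone in the exponent, so the varying
    distance can be replaced by \<open>d0\<close>, the sum of all distances, a crude bound for
    each.\<close>
  define b where "b = max 1 ((real D)\<^sup>2)"
  define d0 where "d0 = (\<Sum>(y, z)\<in>verts G \<times> verts G. gdist G y z)"
  have b: "1 \<le> b" "(real D)\<^sup>2 \<le> b" unfolding b_def by auto
  have "return_count T k u \<le> b ^ d0 * return_count T k v" if uv: "u \<in> verts T" "v \<in> verts T" for k u v
  proof -
    have p: "\<pi> u \<in> verts G" "\<pi> v \<in> verts G" using uv proj_verts by auto
    define d where "d = gdist G (\<pi> v) (\<pi> u)"
    have dd: "d \<le> d0"
      unfolding d_def d0_def
      using member_le_sum[of "(\<pi> v, \<pi> u)" "verts G \<times> verts G" "\<lambda>(y, z). gdist G y z"] p finite_G by auto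
    obtain w where w: "walk G w d" "w 0 = \<pi> v" "w d = \<pi> u"
      using geodesic_walk[OF connected_G p(2,1)] unfolding d_def by metis
    obtain w' where w': "walk T w' d" "w' 0 = v" "\<forall>i\<le>d. \<pi> (w' i) = w i"
      using lift_exists[OF w(1) uv(2)] w(2) by auto
    have vd: "(v, w' d) \<in> adj T ^^ d" using walk_relpow[OF w'(1), of 0 d] w'(2) by simp
    have step: "return_count T (k + j) v \<le> b ^ j * return_count T k v" for j
    proof (induction j)
      case (Suc j)
      have "return_count T (k + Suc j) v \<le> (real D)\<^sup>2 * return_count T (k + j) v"
        using return_count_Suc_le[OF loc_fin_T degree] by simp
      also have "\<dots> \<le> b * (b ^ j * return_count T k v)"
        by (intro mult_mono b Suc) (use b return_count_nonneg in auto)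
      finally show ?case by simp
    qed simp
    have "return_count T k u = return_count T k (w' d)"
      by (rule return_count_fibre) (use uv w w' walk_verts[OF simple_T w'(1), of d] in auto)
    also have "\<dots> \<le> return_count T (k + d) v" by (rule return_count_shift[OF loc_fin_T vd])
    also have "\<dots> \<le> b ^ d * return_count T k v" by (rule step)
    also have "\<dots> \<le> b ^ d0 * return_count T k v"
      by (intro mult_right_mono power_increasing dd b return_count_nonneg)
    finally show ?thesis .
  qed
  moreover have "0 < b ^ d0" using b by simp
  ultimately show ?thesis by blast
qed

text \<open>The first ratio is at least 1 because of the neighbour, and ratios do not
  decrease.\<close>

lemma return_count_ge_1:
  assumes "\<And>u. u \<in> verts T \<Longrightarrow> \<exists>w. (u, w) \<in> adj T" "u \<in> verts T"
  shows "1 \<le> return_count T k u"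
proof -
  obtain w where "(u, w) \<in> adj T" using assms by blast
  then have "return_count T 0 w \<le> return_count T (0 + 1) u"
    by (intro return_count_shift[OF loc_fin_T]) simp
  then have "1 * return_count T 0 u \<le> return_count T (Suc 0) u" by (simp add: return_count_0)
  then have "return_count T 0 u * 1 ^ k \<le> return_count T (0 + k) u"
    by (intro log_convex_growth return_count_log_convex[OF loc_fin_T]) (auto simp: return_count_0)
  then show ?thesis by (simp add: return_count_0)
qed

text \<open>\<Lambda> is the supremum of the ratios of successive return counts. A ratio near it at
  one vertex forces growth at every vertex by comparability, hence eventually a large ratio there
  too; finitely many fibres give one common \<open>k\<close>. Only \<open>T\<close> is mentioned, so
  the constants serve every graph that \<open>T\<close> covers.\<close>

lemma growth_rate:
  assumes nb: "\<And>u. u \<in> verts T \<Longrightarrow> \<exists>w. (u, w) \<in> adj T"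
  shows "\<exists>\<Lambda>\<ge>1. (\<forall>u\<in>verts T. \<forall>k. return_count T k u \<le> \<Lambda> ^ k) \<and>
    (\<forall>\<theta>. 0 < \<theta> \<longrightarrow> \<theta> < \<Lambda> \<longrightarrow> (\<exists>k. \<forall>u\<in>verts T. \<forall>m. \<theta> ^ m * return_count T k u \<le> return_count T (k + m) u))"
proof -
  let ?r = "\<lambda>k u. return_count T k u"
  have r1: "1 \<le> ?r k u" if "u \<in> verts T" for k u by (rule return_count_ge_1[OF nb that])
  define X where "X = {?r (Suc k) u / ?r k u | k u. u \<in> verts T}"
  have Xb: "x \<le> (real D)\<^sup>2" if xX: "x \<in> X" for x
  proof -
    obtain k u where ku: "x = ?r (Suc k) u / ?r k u" "u \<in> verts T" using xX unfolding X_def by blast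
    then show ?thesis using return_count_Suc_le[OF loc_fin_T degree, of k u] r1[OF ku(2), of k]
      by (simp add: pos_divide_le_eq)
  qed
  obtain u0 where u0: "u0 \<in> verts T" using tree unfolding tree_def connected_graph_def by auto
  define \<Lambda> where "\<Lambda> = Sup X"
  have bX: "bdd_above X" using Xb by (intro bdd_aboveI)
  have le: "?r (Suc k) u \<le> \<Lambda> * ?r k u" if "u \<in> verts T" for k u
  proof -
    have "?r (Suc k) u / ?r k u \<le> \<Lambda>" unfolding \<Lambda>_def by (rule cSup_upper[OF _ bX]) (use that X_def in blast)
    then show ?thesis using r1[OF that, of k] by (simp add: pos_divide_le_eq)
  qed
  have \<Lambda>1: "1 \<le> \<Lambda>" using le[OF u0, of 0] r1[OF u0, of 1] by (simp add: return_count_0)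
  have upper: "?r k u \<le> \<Lambda> ^ k" if "u \<in> verts T" for k u
  proof (induction k)
    case (Suc k)
    have "?r (Suc k) u \<le> \<Lambda> * ?r k u" by (rule le[OF that])
    also have "\<dots> \<le> \<Lambda> * \<Lambda> ^ k" using Suc \<Lambda>1 by (intro mult_left_mono) auto
    finally show ?case by simp
  qed (simp add: return_count_0)
  obtain c where c: "0 < c" "\<And>k u v. u \<in> verts T \<Longrightarrow> v \<in> verts T \<Longrightarrow> ?r k u \<le> c * ?r k v"
    using return_count_comparable by blast
  have lower: "\<exists>k. \<forall>u\<in>verts T. \<forall>m. \<theta> ^ m * ?r k u \<le> ?r (k + m) u" if \<theta>: "0 < \<theta>" "\<theta> < \<Lambda>" for \<theta>
  proof -
    \<comment> \<open>The room between \<theta> and \<eta> absorbs the comparison constant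
      \<open>c\<close> after sufficiently many steps.\<close>
    obtain \<eta> where \<eta>: "\<theta> < \<eta>" "\<eta> < \<Lambda>" using dense[OF \<theta>(2)] by blast
    have "\<exists>x\<in>X. \<eta> < x" using \<eta>(2) unfolding \<Lambda>_def
      by (subst (asm) less_cSup_iff[OF _ bX]) (use u0 X_def in blast)+
    then obtain k1 u1 where u1: "u1 \<in> verts T" "\<eta> * ?r k1 u1 \<le> ?r (Suc k1) u1"
    proof -
      assume "\<exists>x\<in>X. \<eta> < x" and *: "\<And>u1 k1. u1 \<in> verts T \<Longrightarrow> \<eta> * ?r k1 u1 \<le> ?r (Suc k1) u1 \<Longrightarrow> thesis"
      then obtain k u where ku: "u \<in> verts T" "\<eta> < ?r (Suc k) u / ?r k u" unfolding X_def by auto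
      then have "\<eta> * ?r k u \<le> ?r (Suc k) u" using r1[OF ku(1), of k] by (simp add: pos_less_divide_eq)
      then show thesis using * ku by blast
    qed
    have g1: "\<eta> ^ m \<le> ?r (k1 + m) u1" for m
    proof -
      have "\<eta> ^ m \<le> ?r k1 u1 * \<eta> ^ m" using r1[OF u1(1), of k1] \<eta> \<theta> by simp
      also have "\<dots> \<le> ?r (k1 + m) u1"
        by (rule log_convex_growth[of "\<lambda>n. ?r n u1", OF return_count_log_convex[OF loc_fin_T]])
          (use u1 \<eta> \<theta> r1[OF u1(1), of k1] in auto)
      finally show ?thesis .
    qed
    have ex: "\<exists>k. \<theta> * ?r k u \<le> ?r (Suc k) u" if u: "u \<in> verts T" for u
    proof (rule ccontr)
      assume "\<not> ?thesis"
      then have lt: "?r (Suc k) u \<le> \<theta> * ?r k u" for k by (meson not_le less_imp_le)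
      have up: "?r k u \<le> \<theta> ^ k" for k
      proof (induction k)
        case (Suc k)
        have "?r (Suc k) u \<le> \<theta> * ?r k u" by (rule lt)
        also have "\<dots> \<le> \<theta> * \<theta> ^ k" using Suc \<theta> by (intro mult_left_mono) auto
        finally show ?case by simp
      qed (simp add: return_count_0)
      obtain m where m: "c * \<theta> ^ k1 * \<theta> ^ m < \<eta> ^ m" using power_ratio_unbounded[OF \<theta>(1) \<eta>(1)] by blast
      have "\<eta> ^ m \<le> c * ?r (k1 + m) u" using g1[of m] c(2)[OF u1(1) u, of "k1 + m"] by linarith
      also have "\<dots> \<le> c * \<theta> ^ (k1 + m)" using up c(1) by (intro mult_left_mono) auto
      finally show False using m by (simp add: power_add mult.assoc)
    qed
    have mono: "\<theta> ^ m * ?r j u \<le> ?r (j + m) u" if u: "u \<in> verts T" and k: "\<theta> * ?r k u \<le> ?r (Suc k) u" "k \<le> j" for u k j m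
    proof -
      have "\<theta> * ?r (k + i) u \<le> ?r (Suc (k + i)) u" for i
      proof (induction i)
        case (Suc i)
        have pos: "0 < ?r n u" for n using r1[OF u, of n] by simp
        have "(\<theta> * ?r (k + i) u) * ?r (Suc (k + i)) u \<le> (?r (Suc (k + i)) u)\<^sup>2"
          using Suc pos[of "Suc (k + i)"] by (simp add: power2_eq_square mult_right_mono)
        also have "\<dots> \<le> ?r (k + i) u * ?r (Suc (Suc (k + i))) u" by (rule return_count_log_convex[OF loc_fin_T])
        finally show ?case using pos[of "k + i"] by (simp add: algebra_simps)
      qed (use k in simp)
      from this[of "j - k"] have "\<theta> * ?r j u \<le> ?r (Suc j) u" using k(2) by simp
      then have "?r j u * \<theta> ^ m \<le> ?r (j + m) u"
        by (intro log_convex_growth return_count_log_convex[OF loc_fin_T])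
          (use \<theta> r1[OF u, of j] in auto)
      then show ?thesis by (simp add: mult.commute)
    qed
    obtain s where s: "\<And>y. y \<in> verts G \<Longrightarrow> s y \<in> verts T \<and> \<pi> (s y) = y" using proj_surj by metis
    obtain kf where kf: "\<And>u. u \<in> verts T \<Longrightarrow> \<theta> * ?r (kf u) u \<le> ?r (Suc (kf u)) u" using ex by metis
    \<comment> \<open>A sum in place of a maximum: as ratios do not decrease, any common upper bound
      works.\<close>
    define k where "k = (\<Sum>y\<in>verts G. kf (s y))"
    have "\<theta> ^ m * ?r k u \<le> ?r (k + m) u" if u: "u \<in> verts T" for u m
    proof -
      have y: "\<pi> u \<in> verts G" using proj_verts[OF u] .
      have eq: "?r n u = ?r n (s (\<pi> u))" for n by (rule return_count_fibre) (use u s[OF y] in auto)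
      have "kf (s (\<pi> u)) \<le> k"
        unfolding k_def using member_le_sum[of "\<pi> u" "verts G" "\<lambda>y. kf (s y)"] y finite_G by simp
      then show ?thesis using mono[of "s (\<pi> u)" "kf (s (\<pi> u))" k m] kf[of "s (\<pi> u)"] s[OF y] eq by simp
    qed
    then show ?thesis by blast
  qed
  show ?thesis using \<Lambda>1 upper lower by blast
qed

end

section \<open>Density of vertices close to two short cycles\<close>

lemma ball_vertsI: "v \<in> verts G \<Longrightarrow> k \<le> r \<Longrightarrow> (p, v) \<in> adj G ^^ k \<Longrightarrow> v \<in> ball_verts r (G, p)"
  unfolding ball_verts_def by auto

lemma ball_vertsE:
  assumes "v \<in> ball_verts r (G, p)"
  obtains k where "v \<in> verts G" "k \<le> r" "(p, v) \<in> adj G ^^ k"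
  using assms unfolding ball_verts_def by auto

text \<open>Either a geodesic from \<open>u\<close> reaches distance \<open>r\<close> and
  contributes \<open>r + 1\<close> points, or the ball is the whole graph.\<close>

lemma card_ball_verts_ge:
  assumes G: "connected_graph G" and u: "u \<in> verts G" and fin: "finite (ball_verts r (G, u))"
    and big: "finite (verts G) \<Longrightarrow> r + 1 \<le> card (verts G)"
  shows "r + 1 \<le> card (ball_verts r (G, u))"
proof (cases "\<exists>x\<in>verts G. r \<le> gdist G u x")
  case True
  then obtain x where x: "x \<in> verts G" "r \<le> gdist G u x" by blast
  obtain w where w: "walk G w (gdist G u x)" "w 0 = u" "w (gdist G u x) = x"
    using geodesic_walk[OF G u x(1)] by blast
  have sg: "simple_graph G" using G connected_graph_simple by blast
  have "w i \<noteq> w j" if ij: "i < j" "j \<le> r" for i j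
  proof
    assume eq: "w i = w j"
    have "(u, w i) \<in> adj G ^^ i" using walk_relpow[OF w(1), of 0 i] w(2) x(2) ij by simp
    moreover have "(w i, x) \<in> adj G ^^ (gdist G u x - j)"
      using walk_relpow[OF w(1), of j "gdist G u x"] w(3) x(2) ij eq by simp
    ultimately have "(u, x) \<in> adj G ^^ (i + (gdist G u x - j))" by (subst relpow_add) blast
    then show False using gdist_le[of u x "i + (gdist G u x - j)" G] x(2) ij by linarith
  qed
  then have "inj_on w {..r}" by (intro linorder_inj_onI) auto
  then have "card (w ` {..r}) = r + 1" by (simp add: card_image)
  moreover have "w ` {..r} \<subseteq> ball_verts r (G, u)"
  proof
    fix z assume "z \<in> w ` {..r}"
    then obtain i where i: "i \<le> r" "z = w i" by auto
    then have "(u, z) \<in> adj G ^^ i" using walk_relpow[OF w(1), of 0 i] w(2) x(2) by simp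
    moreover have "z \<in> verts G" using walk_verts[OF sg w(1), of i] i x(2) by simp
    ultimately show "z \<in> ball_verts r (G, u)" using i unfolding ball_verts_def by auto
  qed
  ultimately show ?thesis using card_mono[OF fin] by metis
next
  case False
  have "verts G \<subseteq> ball_verts r (G, u)"
  proof
    fix x assume x: "x \<in> verts G"
    then have "gdist G u x \<le> r" using False by (metis nat_le_linear)
    then show "x \<in> ball_verts r (G, u)"
      using gdist_relpow[OF G u x] x unfolding ball_verts_def by auto
  qed
  then have "finite (verts G)" "card (verts G) \<le> card (ball_verts r (G, u))"
    using fin by (auto intro: finite_subset card_mono)
  then show ?thesis using big by linarith
qed

lemma is_cycle_rooted_ball:
  assumes "is_cycle (fst (rooted_ball r (G, v))) xs"
  shows "is_cycle G xs" "set xs \<subseteq> ball_verts r (G, v)"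
proof -
  let ?B = "ball_verts r (G, v)"
  have a: "adj (fst (rooted_ball r (G, v))) = adj G \<inter> (?B \<times> ?B)" unfolding rooted_ball_def by simp
  show "is_cycle G xs" using assms unfolding is_cycle_def a by auto
  have len: "3 \<le> length xs" and *: "\<And>i. Suc i < length xs \<Longrightarrow> (xs ! i, xs ! Suc i) \<in> adj G \<inter> (?B \<times> ?B)"
    "(last xs, hd xs) \<in> adj G \<inter> (?B \<times> ?B)"
    using assms unfolding is_cycle_def a by auto
  show "set xs \<subseteq> ?B"
  proof
    fix x assume "x \<in> set xs"
    then obtain i where i: "i < length xs" "x = xs ! i" by (auto simp: in_set_conv_nth)
    show "x \<in> ?B"
    proof (cases "Suc i < length xs")
      case True
      then show ?thesis using *(1)[OF True] i by auto
    next
      case False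
      then have "i = length xs - 1" using i by simp
      then have "x = last xs" using i len by (metis last_conv_nth list.size(3) not_numeral_le_zero)
      then show ?thesis using *(2) by auto
    qed
  qed
qed

lemma ball_verts_sym:
  assumes "simple_graph G" "v \<in> verts G" "z \<in> ball_verts r (G, v)"
  shows "v \<in> ball_verts r (G, z)"
  using assms relpow_sym[OF assms(1)] unfolding ball_verts_def by auto

text \<open>Vertices whose ball contains a cycle are near \<open>Z\<close>, the vertices on short
  cycles. Around a point of \<open>Z\<close> that is not good, all short cycles within distance
  \<open>2 * R\<close> have the same vertex set, so an \<open>R\<close>-ball contains at most
  \<open>K\<close> such points. As every \<open>R\<close>-ball has at least \<open>R + 1\<close>
  vertices, double counting makes them rare and leaves half of the guaranteed density.\<close>

lemma good_vertex_density:
  fixes G :: "'v graph"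
  assumes lf: "loc_fin G" and conn: "connected_graph G" and fin: "finite (verts G)"
    and deg: "\<And>x. card (nbrs G x) \<le> D"
    and K: "K = (D + 1) ^ r0"
    and X: "\<delta> * real (card (verts G)) \<le>
      real (card {v\<in>verts G. \<exists>xs. is_cycle (fst (rooted_ball r0 (G, v))) xs})"
    and \<delta>: "0 < \<delta>" and R: "R + 1 \<le> card (verts G)" "2 * (real K)\<^sup>2 \<le> \<delta> * real (R + 1)"
  shows "\<delta> / (2 * real K) * real (card (verts G)) \<le> real (card {y\<in>verts G. good_vertex G K (2 * R) y})"
proof -
  let ?V = "verts G" and ?b = "\<lambda>r v. ball_verts r (G, v)"
  have sg: "simple_graph G" using conn connected_graph_simple by blast
  have Kpos: "0 < K" unfolding K by simp
  have ballf: "finite (?b r v)" for r v using fin unfolding ball_verts_def by simp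
  have vb: "v \<in> ?b r v" if "v \<in> ?V" for r v using that unfolding ball_verts_def by auto
  define Z where "Z = {z\<in>?V. \<exists>xs. is_cycle G xs \<and> length xs \<le> K \<and> z \<in> set xs}"
  have Zf: "finite Z" using fin unfolding Z_def by simp
  let ?X = "{v\<in>?V. \<exists>xs. is_cycle (fst (rooted_ball r0 (G, v))) xs}"
  have "?X \<subseteq> (\<Union>z\<in>Z. ?b r0 z)"
  proof
    fix v assume "v \<in> ?X"
    then obtain xs where v: "v \<in> ?V" and xs: "is_cycle (fst (rooted_ball r0 (G, v))) xs" by auto
    have cyc: "is_cycle G xs" and sub: "set xs \<subseteq> ?b r0 v" using is_cycle_rooted_ball[OF xs] by auto
    have "distinct xs" "xs \<noteq> []" using cyc unfolding is_cycle_def by auto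
    \<comment> \<open>A cycle inside the ball has at most as many vertices as the ball; this
      dictates \<open>K\<close>.\<close>
    then have "length xs = card (set xs)" by (simp add: distinct_card)
    also have "\<dots> \<le> card (?b r0 v)" by (rule card_mono[OF ballf sub])
    also have "\<dots> \<le> K" using card_ball_verts[OF lf deg v] unfolding K by blast
    finally have "length xs \<le> K" .
    moreover have h: "hd xs \<in> set xs" using \<open>xs \<noteq> []\<close> by simp
    moreover have hb: "hd xs \<in> ?b r0 v" using h sub by blast
    ultimately have "hd xs \<in> Z" using cyc unfolding Z_def ball_verts_def by auto
    moreover have "v \<in> ?b r0 (hd xs)" by (rule ball_verts_sym[OF sg v hb])
    ultimately show "v \<in> (\<Union>z\<in>Z. ?b r0 z)" by blast
  qed
  then have "card ?X \<le> card (\<Union>z\<in>Z. ?b r0 z)" by (rule card_mono[rotated]) (use Zf ballf in auto)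
  also have "\<dots> \<le> (\<Sum>z\<in>Z. card (?b r0 z))" by (rule card_UN_le[OF Zf])
  also have "\<dots> \<le> card Z * K"
    using sum_bounded_above[of Z "\<lambda>z. card (?b r0 z)" K] card_ball_verts[OF lf deg] unfolding K Z_def by auto
  finally have "real (card ?X) \<le> real (card Z) * real K" by (metis of_nat_le_iff of_nat_mult)
  then have ZK: "\<delta> * real (card ?V) \<le> real (card Z) * real K" using X by linarith
  define Zb where "Zb = {z\<in>Z. \<not> good_vertex G K (2 * R) z}"
  have Zbf: "finite Zb" "Zb \<subseteq> ?V" using finite_subset[OF _ Zf, of Zb] unfolding Zb_def Z_def by auto
  have few: "card (?b R v \<inter> Zb) \<le> K" if v: "v \<in> ?V" for v
  proof (cases "?b R v \<inter> Zb = {}")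
    case False
    then obtain z where z: "z \<in> ?b R v" "z \<in> Zb" by blast
    then obtain xs where xs: "is_cycle G xs" "length xs \<le> K" "z \<in> set xs" unfolding Zb_def Z_def by auto
    have nx: "near_cycle G K (2 * R) z xs"
      unfolding near_cycle_def using xs by (intro conjI bexI[of _ z] exI[of _ 0]) auto
    have "?b R v \<inter> Zb \<subseteq> set xs"
    proof
      fix z' assume z': "z' \<in> ?b R v \<inter> Zb"
      then obtain ys where ys: "is_cycle G ys" "length ys \<le> K" "z' \<in> set ys" unfolding Zb_def Z_def by auto
      obtain i where i: "i \<le> R" "(v, z) \<in> adj G ^^ i" using z unfolding ball_verts_def by auto
      obtain j where j: "j \<le> R" "(v, z') \<in> adj G ^^ j" using z' unfolding ball_verts_def by auto
      have "(z, z') \<in> adj G ^^ (i + j)" using relpow_sym[OF sg i(2)] j(2) by (subst relpow_add) blast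
      then have "near_cycle G K (2 * R) z ys"
        unfolding near_cycle_def using ys i j by (intro conjI bexI[of _ z'] exI[of _ "i + j"]) auto
      then have "set xs = set ys" using nx z(2) unfolding Zb_def good_vertex_def by blast
      then show "z' \<in> set xs" using ys by simp
    qed
    then have "card (?b R v \<inter> Zb) \<le> card (set xs)" by (intro card_mono) auto
    also have "\<dots> \<le> length xs" by (rule card_length)
    finally show ?thesis using xs(2) by linarith
  qed simp
  \<comment> \<open>Counts the pairs of a point of \<open>Zb\<close> and a vertex within distance
    \<open>R\<close> of it, from both sides.\<close>
  have "card Zb * (R + 1) \<le> (\<Sum>z\<in>Zb. card (?b R z))"
    using sum_bounded_below[of Zb "R + 1" "\<lambda>z. card (?b R z)"]
      card_ball_verts_ge[OF conn _ ballf, of _ R] R(1) Zbf by auto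
  also have "\<dots> = (\<Sum>z\<in>Zb. \<Sum>v\<in>?V. if v \<in> ?b R z then 1 else 0)"
  proof (intro sum.cong refl)
    fix z
    have "?b R z = {v\<in>?V. v \<in> ?b R z}" unfolding ball_verts_def by auto
    then show "card (?b R z) = (\<Sum>v\<in>?V. if v \<in> ?b R z then 1 else 0)"
      using fin by (simp add: sum.If_cases Int_def)
  qed
  also have "\<dots> = (\<Sum>v\<in>?V. \<Sum>z\<in>Zb. if v \<in> ?b R z then 1 else 0)" by (rule sum.swap)
  also have "\<dots> = (\<Sum>v\<in>?V. card (?b R v \<inter> Zb))"
  proof (intro sum.cong refl)
    fix v assume v: "v \<in> ?V"
    have "{z\<in>Zb. v \<in> ?b R z} = ?b R v \<inter> Zb" using ball_verts_sym[OF sg] v Zbf by auto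
    then show "(\<Sum>z\<in>Zb. if v \<in> ?b R z then 1 else 0) = card (?b R v \<inter> Zb)"
      using Zbf by (simp add: sum.If_cases Int_def)
  qed
  also have "\<dots> \<le> card ?V * K" using sum_bounded_above[of ?V "\<lambda>v. card (?b R v \<inter> Zb)" K] few by simp
  finally have "real (card Zb) * real (R + 1) \<le> real (card ?V) * real K"
    by (metis of_nat_le_iff of_nat_mult)
  moreover have "real (card Zb) * (2 * (real K)\<^sup>2) \<le> real (card Zb) * (\<delta> * real (R + 1))"
    by (intro mult_left_mono R(2)) simp
  moreover have "\<delta> * (real (card Zb) * real (R + 1)) \<le> \<delta> * (real (card ?V) * real K)"
    using calculation(1) \<delta> by (intro mult_left_mono) auto
  ultimately have "real K * (2 * real K * real (card Zb)) \<le> real K * (\<delta> * real (card ?V))"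
    by (simp add: power2_eq_square algebra_simps)
  then have bad: "2 * real K * real (card Zb) \<le> \<delta> * real (card ?V)" using Kpos by simp
  let ?Y = "{y\<in>?V. good_vertex G K (2 * R) y}"
  have "Z \<subseteq> Zb \<union> ?Y" unfolding Zb_def Z_def by auto
  then have "card Z \<le> card (Zb \<union> ?Y)" by (rule card_mono[rotated]) (use Zbf fin in auto)
  also have "\<dots> \<le> card Zb + card ?Y" by (rule card_Un_le)
  finally have "real (card Z) \<le> real (card Zb) + real (card ?Y)" by linarith
  then have "2 * (real (card Z) * real K) \<le> 2 * ((real (card Zb) + real (card ?Y)) * real K)"
    by (intro mult_left_mono mult_right_mono) auto
  then have "\<delta> * real (card ?V) \<le> 2 * real K * real (card ?Y)"
    using bad ZK by (simp add: algebra_simps)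
  then show ?thesis using Kpos by (simp add: field_simps)
qed

section \<open>Isomorphisms of rooted balls\<close>

lemma graph_isomorphism_inverse:
  assumes "graph_isomorphism f G H"
  shows "graph_isomorphism (inv_into (verts G) f) H G"
proof -
  let ?h = "inv_into (verts G) f"
  have b: "bij_betw f (verts G) (verts H)" using assms unfolding graph_isomorphism_def by simp
  have hb: "bij_betw ?h (verts H) (verts G)" by (rule bij_betw_inv_into[OF b])
  show ?thesis unfolding graph_isomorphism_def
  proof (intro conjI ballI)
    fix x y assume xy: "x \<in> verts H" "y \<in> verts H"
    have "?h x \<in> verts G" "?h y \<in> verts G" using hb xy unfolding bij_betw_def by auto
    then have "(?h x, ?h y) \<in> adj G \<longleftrightarrow> (f (?h x), f (?h y)) \<in> adj H"
      using assms unfolding graph_isomorphism_def by blast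
    then show "(x, y) \<in> adj H \<longleftrightarrow> (?h x, ?h y) \<in> adj G" using b xy by (simp add: bij_betw_inv_into_right)
  qed (rule hb)
qed

lemma graph_isomorphism_comp:
  assumes "graph_isomorphism f G H" "graph_isomorphism g H J"
  shows "graph_isomorphism (g \<circ> f) G J"
  unfolding graph_isomorphism_def
proof (intro conjI ballI)
  show "bij_betw (g \<circ> f) (verts G) (verts J)"
    using assms unfolding graph_isomorphism_def by (auto intro: bij_betw_trans)
  fix u v assume "u \<in> verts G" "v \<in> verts G"
  moreover have "f x \<in> verts H" if "x \<in> verts G" for x
    using assms(1) that unfolding graph_isomorphism_def bij_betw_def by auto
  ultimately show "(u, v) \<in> adj G \<longleftrightarrow> ((g \<circ> f) u, (g \<circ> f) v) \<in> adj J"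
    using assms unfolding graph_isomorphism_def by simp
qed

lemma rooted_isomorphic_sym:
  assumes "rooted_isomorphic X Y" "snd X \<in> verts (fst X)"
  shows "rooted_isomorphic Y X"
proof -
  obtain f where f: "graph_isomorphism f (fst X) (fst Y)" "f (snd X) = snd Y"
    using assms(1) unfolding rooted_isomorphic_def by blast
  have "inv_into (verts (fst X)) f (snd Y) = snd X"
    using f assms(2) unfolding graph_isomorphism_def by (metis bij_betw_inv_into_left)
  then show ?thesis using graph_isomorphism_inverse[OF f(1)] unfolding rooted_isomorphic_def by blast
qed

lemma rooted_isomorphic_trans:
  assumes "rooted_isomorphic X Y" "rooted_isomorphic Y Z"
  shows "rooted_isomorphic X Z"
  using assms graph_isomorphism_comp unfolding rooted_isomorphic_def by (metis comp_apply)

lemma graph_isomorphism_verts: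
  "graph_isomorphism f G H \<Longrightarrow> x \<in> verts G \<Longrightarrow> f x \<in> verts H"
  unfolding graph_isomorphism_def bij_betw_def by auto

lemma graph_isomorphism_adj:
  "graph_isomorphism f G H \<Longrightarrow> simple_graph G \<Longrightarrow> (x, y) \<in> adj G \<Longrightarrow> (f x, f y) \<in> adj H"
  unfolding graph_isomorphism_def using simple_graph_adj_verts by metis

lemma graph_isomorphism_relpow:
  assumes "graph_isomorphism f G H" "simple_graph G" "(x, y) \<in> adj G ^^ k"
  shows "(f x, f y) \<in> adj H ^^ k"
proof -
  obtain w where w: "w 0 = x" "w k = y" "\<forall>i<k. (w i, w (Suc i)) \<in> adj G"
    using assms(3) unfolding relpow_fun_conv by blast
  then show ?thesis unfolding relpow_fun_conv
    by (intro exI[of _ "\<lambda>i. f (w i)"]) (use graph_isomorphism_adj[OF assms(1,2)] in auto)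
qed

lemma graph_isomorphism_ball_verts:
  assumes "graph_isomorphism f G H" "simple_graph G" "simple_graph H" "p \<in> verts G"
  shows "f ` ball_verts r (G, p) = ball_verts r (H, f p)"
proof
  show "f ` ball_verts r (G, p) \<subseteq> ball_verts r (H, f p)"
    using graph_isomorphism_relpow[OF assms(1,2)] graph_isomorphism_verts[OF assms(1)]
    unfolding ball_verts_def by fastforce
  show "ball_verts r (H, f p) \<subseteq> f ` ball_verts r (G, p)"
  proof
    fix y assume y: "y \<in> ball_verts r (H, f p)"
    let ?h = "inv_into (verts G) f"
    have b: "bij_betw f (verts G) (verts H)" using assms unfolding graph_isomorphism_def by simp
    have yv: "y \<in> verts H" using y unfolding ball_verts_def by simp
    obtain k where k: "k \<le> r" "(f p, y) \<in> adj H ^^ k" using y unfolding ball_verts_def by auto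
    have "(?h (f p), ?h y) \<in> adj G ^^ k"
      by (rule graph_isomorphism_relpow[OF graph_isomorphism_inverse[OF assms(1)] assms(3) k(2)])
    moreover have "?h (f p) = p" using b assms(4) by (simp add: bij_betw_inv_into_left)
    moreover have "?h y \<in> verts G" "f (?h y) = y"
      using b yv by (auto simp: bij_betw_inv_into_right bij_betw_def inv_into_into)
    ultimately show "y \<in> f ` ball_verts r (G, p)" using k unfolding ball_verts_def by (auto intro!: image_eqI[of _ _ "?h y"])
  qed
qed

lemma graph_isomorphism_cycle:
  assumes "graph_isomorphism f G H" "simple_graph G" "is_cycle G xs"
  shows "is_cycle H (map f xs)"
proof -
  have c: "3 \<le> length xs" "distinct xs" "(last xs, hd xs) \<in> adj G"
    "\<And>i. Suc i < length xs \<Longrightarrow> (xs ! i, xs ! Suc i) \<in> adj G"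
    using assms(3) unfolding is_cycle_def by auto
  have ne: "xs \<noteq> []" using c by auto
  have sub: "set xs \<subseteq> verts G"
  proof
    fix x assume "x \<in> set xs"
    then obtain i where i: "i < length xs" "x = xs ! i" by (auto simp: in_set_conv_nth)
    show "x \<in> verts G"
    proof (cases "Suc i < length xs")
      case True
      then show ?thesis using simple_graph_adj_verts[OF assms(2) c(4)[OF True]] i by simp
    next
      case False
      then have "x = last xs" using i ne by (metis Suc_lessI diff_Suc_1 last_conv_nth)
      then show ?thesis using simple_graph_adj_verts[OF assms(2) c(3)] by simp
    qed
  qed
  have "inj_on f (set xs)"
    using assms(1) sub unfolding graph_isomorphism_def bij_betw_def by (auto intro: inj_on_subset)
  then show ?thesis
    unfolding is_cycle_def using c ne graph_isomorphism_adj[OF assms(1,2)]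
    by (auto simp: distinct_map last_map hd_map)
qed

lemma rooted_ball_simps [simp]:
  "verts (fst (rooted_ball r X)) = ball_verts r X" "snd (rooted_ball r X) = snd X"
  "adj (fst (rooted_ball r X)) = adj (fst X) \<inter> (ball_verts r X \<times> ball_verts r X)"
  unfolding rooted_ball_def by auto

lemma simple_rooted_ball: "simple_graph (fst X) \<Longrightarrow> simple_graph (fst (rooted_ball r X))"
  unfolding simple_graph_def by (auto simp: irrefl_def sym_def)

lemma root_in_ball: "p \<in> verts G \<Longrightarrow> p \<in> ball_verts r (G, p)"
  unfolding ball_verts_def by auto

lemma ball_verts_mono: "s \<le> r \<Longrightarrow> ball_verts s X \<subseteq> ball_verts r X"
  unfolding ball_verts_def by (auto intro: order_trans)

lemma ball_verts_rooted_ball: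
  assumes "simple_graph G" "p \<in> verts G" "s \<le> r"
  shows "ball_verts s (rooted_ball r (G, p)) = ball_verts s (G, p)"
proof
  show "ball_verts s (rooted_ball r (G, p)) \<subseteq> ball_verts s (G, p)"
  proof
    fix v assume v: "v \<in> ball_verts s (rooted_ball r (G, p))"
    then obtain k where k: "k \<le> s" "(p, v) \<in> adj (fst (rooted_ball r (G, p))) ^^ k"
      and vb: "v \<in> ball_verts r (G, p)" unfolding ball_verts_def[of s] by auto
    have "(p, v) \<in> adj G ^^ k" using k(2) unfolding relpow_fun_conv by auto
    then show "v \<in> ball_verts s (G, p)" using k vb unfolding ball_verts_def by auto
  qed
  show "ball_verts s (G, p) \<subseteq> ball_verts s (rooted_ball r (G, p))"
  proof
    fix v assume v: "v \<in> ball_verts s (G, p)"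
    then obtain k where k: "k \<le> s" "(p, v) \<in> adj G ^^ k" unfolding ball_verts_def by auto
    obtain w where w: "walk G w k" "w 0 = p" "w k = v" using relpow_walk[OF k(2) assms(2)] by blast
    have wb: "w i \<in> ball_verts r (G, p)" if "i \<le> k" for i
      by (rule ball_vertsI[of _ _ i])
        (use walk_relpow[OF w(1), of 0 i] w(2) walk_verts[OF assms(1) w(1) that] that k assms(3) in auto)
    have "(p, v) \<in> adj (fst (rooted_ball r (G, p))) ^^ k"
      unfolding relpow_fun_conv by (intro exI[of _ w]) (use w wb in \<open>auto simp: walk_def\<close>)
    then show "v \<in> ball_verts s (rooted_ball r (G, p))"
      using k wb[of k] w(3) unfolding ball_verts_def[of s] by auto
  qed
qed

lemma connected_from_root:
  assumes "simple_graph H" "p \<in> verts H" "ball_verts r (H, p) = verts H"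
  shows "connected_graph H"
  unfolding connected_graph_def
proof (intro conjI ballI)
  show "simple_graph H" "verts H \<noteq> {}" using assms by auto
  fix u v assume "u \<in> verts H" "v \<in> verts H"
  then obtain i j where "(p, u) \<in> adj H ^^ i" "(p, v) \<in> adj H ^^ j"
    using assms(3) by (metis ball_vertsE)
  then show "(u, v) \<in> (adj H)\<^sup>*"
    using relpow_sym[OF assms(1)] relpow_imp_rtrancl rtrancl_trans by metis
qed

text \<open>Test graphs live on \<open>nat\<close>. Using an initial segment as vertex set leaves
  only finitely many copies once the sizes of balls are bounded.\<close>

lemma rooted_ball_nat_copy:
  assumes "simple_graph G" "p \<in> verts G" "finite (ball_verts r (G, p))"
  shows "\<exists>H :: nat rooted_graph. H \<in> finite_rooted_graphs r \<and>
    verts (fst H) \<subseteq> {..<card (ball_verts r (G, p))} \<and> rooted_isomorphic (rooted_ball r (G, p)) H"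
proof -
  let ?B = "ball_verts r (G, p)" and ?R = "fst (rooted_ball r (G, p))"
  obtain f where f: "bij_betw f ?B {0..<card ?B}" using ex_bij_betw_finite_nat[OF assms(3)] by blast
  define H where "H = \<lparr>verts = {0..<card ?B}, adj = map_prod f f ` adj ?R\<rparr>"
  have inj: "inj_on f ?B" using f unfolding bij_betw_def by simp
  have iso: "graph_isomorphism f ?R H"
    unfolding graph_isomorphism_def
  proof (intro conjI ballI)
    show "bij_betw f (verts ?R) (verts H)" using f unfolding H_def by simp
    fix u v assume uv: "u \<in> verts ?R" "v \<in> verts ?R"
    show "(u, v) \<in> adj ?R \<longleftrightarrow> (f u, f v) \<in> adj H"
    proof
      assume "(u, v) \<in> adj ?R"
      then show "(f u, f v) \<in> adj H" unfolding H_def by (force simp: image_iff)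
    next
      assume "(f u, f v) \<in> adj H"
      then obtain a b where "(a, b) \<in> adj ?R" "f u = f a" "f v = f b" unfolding H_def by auto
      then show "(u, v) \<in> adj ?R" using inj uv by (auto dest: inj_onD)
    qed
  qed
  have sR: "simple_graph ?R" using simple_rooted_ball[of "(G, p)"] assms(1) by simp
  have pR: "p \<in> verts ?R" using root_in_ball[OF assms(2)] by simp
  have sH: "simple_graph H"
    unfolding simple_graph_def
  proof (intro conjI)
    show "adj H \<subseteq> verts H \<times> verts H" using f unfolding H_def bij_betw_def by auto
    show "sym (adj H)"
      unfolding sym_def
    proof (intro allI impI)
      fix x y assume "(x, y) \<in> adj H"
      then obtain a b where "(a, b) \<in> adj ?R" "x = f a" "y = f b" unfolding H_def by auto
      then show "(y, x) \<in> adj H" using simple_graph_adj_sym[OF sR] unfolding H_def by (force simp: image_iff)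
    qed
    show "irrefl (adj H)"
      unfolding irrefl_def
    proof (intro allI notI)
      fix x assume "(x, x) \<in> adj H"
      then obtain a b where ab: "(a, b) \<in> adj ?R" "f a = f b" unfolding H_def by auto
      then have "a = b" using inj by (auto dest: inj_onD)
      then show False using ab simple_graph_adj_neq[OF sR] by blast
    qed
  qed
  have "ball_verts r (H, f p) = f ` ball_verts r (?R, p)"
    by (rule graph_isomorphism_ball_verts[OF iso sR sH pR, symmetric])
  also have "(?R, p) = rooted_ball r (G, p)" by (simp add: rooted_ball_def)
  also have "f ` ball_verts r (rooted_ball r (G, p)) = verts H"
    using ball_verts_rooted_ball[OF assms(1,2), of r r] f unfolding H_def bij_betw_def by simp
  finally have bH: "ball_verts r (H, f p) = verts H" .
  have fp: "f p \<in> verts H" using graph_isomorphism_verts[OF iso pR] .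
  have "(H, f p) \<in> finite_rooted_graphs r"
    unfolding finite_rooted_graphs_def using connected_from_root[OF sH fp bH] fp bH by (auto simp: H_def)
  moreover have "rooted_isomorphic (rooted_ball r (G, p)) (H, f p)"
    unfolding rooted_isomorphic_def using iso by auto
  ultimately show ?thesis by (intro exI[of _ "(H, f p)"]) (auto simp: H_def)
qed

lemma closed_walks_isomorphic:
  assumes iso: "rooted_isomorphic X Y" and s: "simple_graph (fst X)" "simple_graph (fst Y)"
    and r: "snd X \<in> verts (fst X)"
  shows "card (closed_walks n X) = card (closed_walks n Y)"
proof -
  obtain f where f: "graph_isomorphism f (fst X) (fst Y)" "f (snd X) = snd Y"
    using iso unfolding rooted_isomorphic_def by blast
  have b: "bij_betw f (verts (fst X)) (verts (fst Y))" using f unfolding graph_isomorphism_def by simp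
  let ?h = "inv_into (verts (fst X)) f"
  have h: "graph_isomorphism ?h (fst Y) (fst X)" by (rule graph_isomorphism_inverse[OF f(1)])
  have hs: "?h (snd Y) = snd X" using f(2) b r by (metis bij_betw_inv_into_left)
  have fwd: "map g xs \<in> closed_walks n B"
    if "graph_isomorphism g (fst A) (fst B)" "g (snd A) = snd B" "simple_graph (fst A)" "xs \<in> closed_walks n A"
    for g :: "'c \<Rightarrow> 'd" and A B xs
  proof -
    have "xs \<noteq> []" using that(4) unfolding closed_walks_def by auto
    then show ?thesis
      using that graph_isomorphism_adj[OF that(1,3)] graph_isomorphism_verts[OF that(1)]
      unfolding closed_walks_def by (auto simp: hd_map last_map)
  qed
  have "bij_betw (map f) (closed_walks n X) (closed_walks n Y)"
  proof (rule bij_betw_byWitness[where f' = "map ?h"])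
    show "\<forall>xs\<in>closed_walks n X. map ?h (map f xs) = xs"
      using b by (auto simp: closed_walks_def bij_betw_inv_into_left subset_iff intro!: map_idI)
    show "\<forall>xs\<in>closed_walks n Y. map f (map ?h xs) = xs"
      using b by (auto simp: closed_walks_def bij_betw_inv_into_right subset_iff intro!: map_idI)
    show "map f ` closed_walks n X \<subseteq> closed_walks n Y" using fwd[OF f s(1)] by auto
    show "map ?h ` closed_walks n Y \<subseteq> closed_walks n X" using fwd[OF h hs s(2)] by auto
  qed
  then show ?thesis by (rule bij_betw_same_card)
qed

text \<open>After \<open>i\<close> steps a walk is within distance \<open>i\<close> of the root, so
  the number of closed walks is determined by the isomorphism type of a ball.\<close>

lemma closed_walks_rooted_ball:
  assumes "simple_graph G"
  shows "closed_walks n (rooted_ball n (G, p)) = closed_walks n (G, p)"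
proof
  show "closed_walks n (rooted_ball n (G, p)) \<subseteq> closed_walks n (G, p)"
  proof
    fix xs assume xs: "xs \<in> closed_walks n (rooted_ball n (G, p))"
    then have "set xs \<subseteq> ball_verts n (G, p)" unfolding closed_walks_def by simp
    then have "set xs \<subseteq> verts G" unfolding ball_verts_def by auto
    then show "xs \<in> closed_walks n (G, p)" using xs unfolding closed_walks_def by simp
  qed
  show "closed_walks n (G, p) \<subseteq> closed_walks n (rooted_ball n (G, p))"
  proof
    fix xs assume xs: "xs \<in> closed_walks n (G, p)"
    then have x: "length xs = Suc n" "hd xs = p" "last xs = p" "set xs \<subseteq> verts G"
      "\<forall>i<n. (xs ! i, xs ! Suc i) \<in> adj G" unfolding closed_walks_def by auto
    have "xs \<noteq> []" using x by auto
    then have x0: "xs ! 0 = p" using x by (simp add: hd_conv_nth)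
    have "xs ! i \<in> ball_verts n (G, p)" if "i \<le> n" for i
    proof -
      have "(p, xs ! i) \<in> adj G ^^ i"
        unfolding relpow_fun_conv by (intro exI[of _ "\<lambda>i. xs ! i"]) (use x x0 that in auto)
      then show ?thesis using x(1,4) that unfolding ball_verts_def by (auto simp: subset_iff)
    qed
    then show "xs \<in> closed_walks n (rooted_ball n (G, p))"
      using x unfolding closed_walks_def by (auto simp: in_set_conv_nth)
  qed
qed

section \<open>Local limits\<close>

lemma finite_ball_verts:
  assumes "loc_fin A" "p \<in> verts A"
  shows "finite (ball_verts r (A, p))"
proof (induction r)
  case 0
  then show ?case using ball_verts_0[OF assms(2)] by simp
next
  case (Suc r)
  have "finite (\<Union>x\<in>ball_verts r (A, p). nbrs A x)"
    using Suc loc_fin_sym_nbrs[OF assms(1)] unfolding sym_nbrs_def by blast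
  then show ?case
    using Suc finite_subset[OF ball_verts_Suc_subset[of A p r]] assms unfolding loc_fin_def by blast
qed

locale local_limit = prob_space M for M :: "'w measure" +
  fixes G :: "'w \<Rightarrow> 'v rooted_graph" and Gs :: "nat \<Rightarrow> 'u graph" and B :: "nat \<Rightarrow> nat"
  assumes measurable_G: "G \<in> measurable M rooted_graph_space"
    and connected_Gs: "\<And>n. connected_graph (Gs n)"
    and finite_Gs: "\<And>n. finite (verts (Gs n))"
    and ball_bound: "\<And>n v r. v \<in> verts (Gs n) \<Longrightarrow> card (ball_verts r (Gs n, v)) \<le> B r"
    and limit: "converges_locally Gs M G"
begin

definition ball_prob :: "nat \<Rightarrow> nat rooted_graph \<Rightarrow> real" where
  "ball_prob r H = \<P>(\<omega> in M. rooted_isomorphic (rooted_ball r (G \<omega>)) H)"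

definition ball_freq :: "nat \<Rightarrow> nat rooted_graph \<Rightarrow> nat \<Rightarrow> real" where
  "ball_freq r H n = real (card {v \<in> verts (Gs n). rooted_isomorphic (rooted_ball r (Gs n, v)) H})
     / real (card (verts (Gs n)))"

lemma ball_freq_tendsto: "H \<in> finite_rooted_graphs r \<Longrightarrow> ball_freq r H \<longlonglongrightarrow> ball_prob r H"
  using limit unfolding converges_locally_def ball_freq_def ball_prob_def by blast

lemma simple_Gs: "simple_graph (Gs n)"
  using connected_Gs connected_graph_simple by blast

lemma G_rooted_graphs:
  assumes "\<omega> \<in> space M"
  shows "G \<omega> \<in> rooted_graphs"
proof -
  have "space (rooted_graph_space :: 'v rooted_graph measure) = rooted_graphs"
    unfolding rooted_graph_space_def by (rule space_measure_of) auto
  then show ?thesis using measurable_space[OF measurable_G assms] by simp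
qed

lemma G_rooted_graph:
  assumes "\<omega> \<in> space M"
  shows "connected_graph (fst (G \<omega>))" "locally_finite_graph (fst (G \<omega>))" "snd (G \<omega>) \<in> verts (fst (G \<omega>))"
  using G_rooted_graphs[OF assms] unfolding rooted_graphs_def by auto

lemma ball_event:
  fixes H :: "nat rooted_graph"
  assumes "H \<in> finite_rooted_graphs r"
  shows "{\<omega> \<in> space M. rooted_isomorphic (rooted_ball r (G \<omega>)) H} \<in> sets M"
proof -
  let ?S = "{X \<in> (rooted_graphs :: 'v rooted_graph set). rooted_isomorphic (rooted_ball r X) H}"
  have "?S \<in> sets (rooted_graph_space :: 'v rooted_graph measure)"
    unfolding rooted_graph_space_def
  proof (subst sets_measure_of)
    show "?S \<in> sigma_sets rooted_graphs {{G \<in> rooted_graphs. rooted_isomorphic (rooted_ball r G) H} | r (H :: nat rooted_graph).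
        H \<in> finite_rooted_graphs r}"
      by (intro sigma_sets.Basic CollectI exI[of _ r] exI[of _ H] conjI refl assms)
  qed auto
  then have "G -` ?S \<inter> space M \<in> sets M" by (rule measurable_sets[OF measurable_G])
  moreover have "G -` ?S \<inter> space M = {\<omega> \<in> space M. rooted_isomorphic (rooted_ball r (G \<omega>)) H}"
    using G_rooted_graphs by auto
  ultimately show ?thesis by simp
qed

lemma G_ball_root: "\<omega> \<in> space M \<Longrightarrow> snd (rooted_ball r (G \<omega>)) \<in> verts (fst (rooted_ball r (G \<omega>)))"
  using G_rooted_graph(3) root_in_ball[of "snd (G \<omega>)" "fst (G \<omega>)" r] by simp

lemma Gs_ball_root: "v \<in> verts (Gs n) \<Longrightarrow> snd (rooted_ball r (Gs n, v)) \<in> verts (fst (rooted_ball r (Gs n, v)))"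
  using root_in_ball[of v "Gs n" r] by simp

lemma finite_bounded_rooted_graphs:
  "finite {H :: nat rooted_graph. H \<in> finite_rooted_graphs r \<and> verts (fst H) \<subseteq> {..<b}}"
proof (rule finite_subset)
  let ?f = "\<lambda>(V, E, p). (\<lparr>verts = V, adj = E\<rparr>, p)"
  show "{H :: nat rooted_graph. H \<in> finite_rooted_graphs r \<and> verts (fst H) \<subseteq> {..<b}} \<subseteq>
    ?f ` (Pow {..<b} \<times> Pow ({..<b} \<times> {..<b}) \<times> {..<b})"
  proof
    fix X :: "nat rooted_graph"
    assume "X \<in> {H. H \<in> finite_rooted_graphs r \<and> verts (fst H) \<subseteq> {..<b}}"
    then have X: "connected_graph (fst X)" "snd X \<in> verts (fst X)" "verts (fst X) \<subseteq> {..<b}"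
      unfolding finite_rooted_graphs_def by auto
    then have "adj (fst X) \<subseteq> {..<b} \<times> {..<b}"
      unfolding connected_graph_def simple_graph_def by blast
    moreover have "X = ?f (verts (fst X), adj (fst X), snd X)" by (cases X) simp
    ultimately show "X \<in> ?f ` (Pow {..<b} \<times> Pow ({..<b} \<times> {..<b}) \<times> {..<b})" using X by blast
  qed
qed simp

lemma countable_finite_rooted_graphs: "countable (finite_rooted_graphs r :: nat rooted_graph set)"
proof (rule countable_subset)
  let ?f = "\<lambda>(V, E, p). (\<lparr>verts = V, adj = E\<rparr>, p)"
  show "(finite_rooted_graphs r :: nat rooted_graph set) \<subseteq> ?f ` ({V. finite V} \<times> {E. finite E} \<times> UNIV)"
  proof
    fix X :: "nat rooted_graph"
    assume "X \<in> finite_rooted_graphs r"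
    then have X: "connected_graph (fst X)" "finite (verts (fst X))"
      unfolding finite_rooted_graphs_def by auto
    then have "adj (fst X) \<subseteq> verts (fst X) \<times> verts (fst X)"
      unfolding connected_graph_def simple_graph_def by blast
    then have "finite (adj (fst X))" using X(2) by (auto intro: finite_subset)
    moreover have "X = ?f (verts (fst X), adj (fst X), snd X)" by (cases X) simp
    ultimately show "X \<in> ?f ` ({V. finite V} \<times> {E. finite E} \<times> UNIV)" using X by blast
  qed
  show "countable (?f ` ({V :: nat set. finite V} \<times> {E :: (nat \<times> nat) set. finite E} \<times> (UNIV :: nat set)))"
    by (intro countable_image countable_SIGMA countable_Collect_finite) auto
qed

lemma finite_rooted_graphs_root: "H \<in> finite_rooted_graphs r \<Longrightarrow> snd H \<in> verts (fst H)"
  unfolding finite_rooted_graphs_def by auto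

text \<open>One representative per isomorphism class: isomorphic graphs satisfy the same predicate
  in the definition of \<open>rep\<close>, so the choice operator returns the same graph for
  both.\<close>

lemma ball_types:
  "\<exists>Hs :: nat rooted_graph set. finite Hs \<and> Hs \<subseteq> finite_rooted_graphs r \<and>
    (\<forall>H\<in>Hs. \<forall>H'\<in>Hs. rooted_isomorphic H H' \<longrightarrow> H = H') \<and>
    (\<forall>n. \<forall>v\<in>verts (Gs n). \<exists>H\<in>Hs. rooted_isomorphic (rooted_ball r (Gs n, v)) H)"
proof -
  define A where "A = {H :: nat rooted_graph. H \<in> finite_rooted_graphs r \<and> verts (fst H) \<subseteq> {..<B r}}"
  define rep where "rep H = (SOME H'. H' \<in> A \<and> rooted_isomorphic H H')" for H :: "nat rooted_graph"
  have refl: "rooted_isomorphic H H" for H :: "nat rooted_graph"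
    unfolding rooted_isomorphic_def graph_isomorphism_def by (intro exI[of _ id]) auto
  have rep: "rep H \<in> A \<and> rooted_isomorphic H (rep H)" if "H \<in> A" for H
    unfolding rep_def by (rule someI_ex) (use that refl in blast)
  have sym: "rooted_isomorphic H' H" if "rooted_isomorphic H H'" "H \<in> A" for H H' :: "nat rooted_graph"
    by (rule rooted_isomorphic_sym[OF that(1)]) (rule finite_rooted_graphs_root[of _ r], use that(2) in \<open>simp add: A_def\<close>)
  have uniq: "rep H = rep H'" if H: "H \<in> A" "H' \<in> A" "rooted_isomorphic (rep H) (rep H')" for H H'
  proof -
    have 1: "rooted_isomorphic H H'"
      using rooted_isomorphic_trans[OF rooted_isomorphic_trans[OF conjunct2[OF rep[OF H(1)]] H(3)]
        sym[OF conjunct2[OF rep[OF H(2)]] H(2)]] .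
    then have 2: "rooted_isomorphic H' H" using sym H(1) by blast
    have "rooted_isomorphic H X \<longleftrightarrow> rooted_isomorphic H' X" for X :: "nat rooted_graph"
      using rooted_isomorphic_trans[OF 1, of X] rooted_isomorphic_trans[OF 2, of X] by blast
    then show ?thesis unfolding rep_def by simp
  qed
  have cover: "\<exists>H\<in>rep ` A. rooted_isomorphic (rooted_ball r (Gs n, v)) H" if v: "v \<in> verts (Gs n)" for n v
  proof -
    have "finite (ball_verts r (Gs n, v))" using finite_Gs[of n] unfolding ball_verts_def by simp
    then obtain H :: "nat rooted_graph" where H: "H \<in> finite_rooted_graphs r"
      "verts (fst H) \<subseteq> {..<card (ball_verts r (Gs n, v))}" "rooted_isomorphic (rooted_ball r (Gs n, v)) H"
      using rooted_ball_nat_copy[OF simple_Gs v] by blast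
    then have "H \<in> A" using ball_bound[OF v, of r] unfolding A_def by auto
    then show ?thesis using rep[of H] rooted_isomorphic_trans[OF H(3)] by blast
  qed
  have "finite (rep ` A)" using finite_bounded_rooted_graphs[of r "B r"] unfolding A_def by simp
  moreover have "rep ` A \<subseteq> finite_rooted_graphs r" using rep unfolding A_def by auto
  moreover have "\<forall>H\<in>rep ` A. \<forall>H'\<in>rep ` A. rooted_isomorphic H H' \<longrightarrow> H = H'" using uniq by blast
  moreover have "\<forall>n. \<forall>v\<in>verts (Gs n). \<exists>H\<in>rep ` A. rooted_isomorphic (rooted_ball r (Gs n, v)) H"
    by (intro allI ballI cover)
  ultimately show ?thesis by (intro exI[of _ "rep ` A"] conjI)
qed

text \<open>Only finitely many types of \<open>r\<close>-balls occur in the sequence, so no mass is lost in the limit.\<close>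

lemma ball_types_limit:
  obtains Hs :: "nat rooted_graph set" where "finite Hs" "Hs \<subseteq> finite_rooted_graphs r"
    "\<And>n v. v \<in> verts (Gs n) \<Longrightarrow> \<exists>!H. H \<in> Hs \<and> rooted_isomorphic (rooted_ball r (Gs n, v)) H"
    "\<And>\<omega> H H'. \<omega> \<in> space M \<Longrightarrow> H \<in> Hs \<Longrightarrow> H' \<in> Hs \<Longrightarrow> rooted_isomorphic (rooted_ball r (G \<omega>)) H \<Longrightarrow>
       rooted_isomorphic (rooted_ball r (G \<omega>)) H' \<Longrightarrow> H = H'"
    "AE \<omega> in M. \<exists>H\<in>Hs. rooted_isomorphic (rooted_ball r (G \<omega>)) H \<and> ball_prob r H > 0"
proof -
  obtain Hs :: "nat rooted_graph set" where Hs': "finite Hs \<and> Hs \<subseteq> finite_rooted_graphs r \<and>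
    (\<forall>H\<in>Hs. \<forall>H'\<in>Hs. rooted_isomorphic H H' \<longrightarrow> H = H') \<and>
    (\<forall>n. \<forall>v\<in>verts (Gs n). \<exists>H\<in>Hs. rooted_isomorphic (rooted_ball r (Gs n, v)) H)"
    using ball_types[of r] by (elim exE)
  have Hs: "finite Hs" "Hs \<subseteq> finite_rooted_graphs r"
    "\<And>H H'. H \<in> Hs \<Longrightarrow> H' \<in> Hs \<Longrightarrow> rooted_isomorphic H H' \<Longrightarrow> H = H'"
    "\<And>n v. v \<in> verts (Gs n) \<Longrightarrow> \<exists>H\<in>Hs. rooted_isomorphic (rooted_ball r (Gs n, v)) H"
    using Hs' by simp_all
  have uG: "H = H'" if "\<omega> \<in> space M" "H \<in> Hs" "H' \<in> Hs" "rooted_isomorphic (rooted_ball r (G \<omega>)) H"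
    "rooted_isomorphic (rooted_ball r (G \<omega>)) H'" for \<omega> H H'
    using Hs(3)[OF that(2,3)] rooted_isomorphic_trans[OF rooted_isomorphic_sym[OF that(4) G_ball_root[OF that(1)]] that(5)] by blast
  have uGs: "H = H'" if "v \<in> verts (Gs n)" "H \<in> Hs" "H' \<in> Hs" "rooted_isomorphic (rooted_ball r (Gs n, v)) H"
    "rooted_isomorphic (rooted_ball r (Gs n, v)) H'" for n v H H'
    using Hs(3)[OF that(2,3)] rooted_isomorphic_trans[OF rooted_isomorphic_sym[OF that(4) Gs_ball_root[OF that(1)]] that(5)] by blast
  let ?ev = "\<lambda>H. {\<omega> \<in> space M. rooted_isomorphic (rooted_ball r (G \<omega>)) H}"
  have ev: "?ev H \<in> events" if "H \<in> Hs" for H using ball_event that Hs(2) by blast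
  have one: "(\<Sum>H\<in>Hs. ball_freq r H n) = 1" for n
  proof -
    let ?V = "verts (Gs n)"
    have ne: "card ?V > 0" using connected_Gs[of n] finite_Gs[of n] unfolding connected_graph_def by (simp add: card_gt_0_iff)
    have "card ?V = card (\<Union>H\<in>Hs. {v\<in>?V. rooted_isomorphic (rooted_ball r (Gs n, v)) H})"
      by (rule arg_cong[of _ _ card]) (use Hs(4) in blast)
    also have "\<dots> = (\<Sum>H\<in>Hs. card {v\<in>?V. rooted_isomorphic (rooted_ball r (Gs n, v)) H})"
      by (rule card_UN_disjoint[OF Hs(1)]) (use finite_Gs uGs in auto)
    finally have "real (card ?V) = (\<Sum>H\<in>Hs. real (card {v\<in>?V. rooted_isomorphic (rooted_ball r (Gs n, v)) H}))"
      by (simp only: of_nat_sum)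
    then show ?thesis unfolding ball_freq_def using ne by (simp add: sum_divide_distrib[symmetric])
  qed
  have "(\<lambda>n. \<Sum>H\<in>Hs. ball_freq r H n) \<longlonglongrightarrow> (\<Sum>H\<in>Hs. ball_prob r H)"
    by (intro tendsto_sum ball_freq_tendsto) (use Hs(2) in blast)
  then have sum1: "(\<Sum>H\<in>Hs. ball_prob r H) = 1" unfolding one by (simp add: LIMSEQ_const_iff)
  have "prob (\<Union>H\<in>Hs. ?ev H) = (\<Sum>H\<in>Hs. prob (?ev H))"
    by (rule finite_measure_finite_Union[OF Hs(1)]) (use ev uG in \<open>auto simp: disjoint_family_on_def\<close>)
  also have "\<dots> = 1" using sum1 unfolding ball_prob_def .
  finally have "AE \<omega> in M. \<omega> \<in> (\<Union>H\<in>Hs. ?ev H)"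
    by (subst AE_in_set_eq_1) (use Hs(1) ev in auto)
  moreover have "AE \<omega> in M. \<forall>H\<in>Hs. ball_prob r H = 0 \<longrightarrow> \<not> rooted_isomorphic (rooted_ball r (G \<omega>)) H"
  proof (rule AE_finite_allI[OF Hs(1)])
    fix H assume H: "H \<in> Hs"
    show "AE \<omega> in M. ball_prob r H = 0 \<longrightarrow> \<not> rooted_isomorphic (rooted_ball r (G \<omega>)) H"
    proof (cases "ball_prob r H = 0")
      case True
      then have "AE \<omega> in M. \<omega> \<notin> ?ev H"
        using prob_eq_0[OF ev[OF H]] unfolding ball_prob_def by simp
      then show ?thesis using AE_space by eventually_elim auto
    qed simp
  qed
  ultimately have AE: "AE \<omega> in M. \<exists>H\<in>Hs. rooted_isomorphic (rooted_ball r (G \<omega>)) H \<and> ball_prob r H > 0"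
  proof eventually_elim
    case (elim \<omega>)
    then obtain H where H: "H \<in> Hs" "rooted_isomorphic (rooted_ball r (G \<omega>)) H" by auto
    then have "ball_prob r H \<noteq> 0" using elim(2) by blast
    moreover have "0 \<le> ball_prob r H" unfolding ball_prob_def by simp
    ultimately show ?case using H by force
  qed
  show thesis
  proof (rule that[OF Hs(1,2) _ uG AE])
    fix n v assume v: "v \<in> verts (Gs n)"
    then obtain H where "H \<in> Hs" "rooted_isomorphic (rooted_ball r (Gs n, v)) H" using Hs(4) by blast
    then show "\<exists>!H. H \<in> Hs \<and> rooted_isomorphic (rooted_ball r (Gs n, v)) H" using uGs[OF v] by blast
  qed
qed

lemma AE_ball_positive:
  "AE \<omega> in M. \<exists>H\<in>finite_rooted_graphs r. rooted_isomorphic (rooted_ball r (G \<omega>)) H \<and> ball_prob r H > 0"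
proof (rule ball_types_limit[of r])
  fix Hs :: "nat rooted_graph set"
  assume sub: "Hs \<subseteq> finite_rooted_graphs r"
    and AE: "AE \<omega> in M. \<exists>H\<in>Hs. rooted_isomorphic (rooted_ball r (G \<omega>)) H \<and> ball_prob r H > 0"
  from AE show ?thesis by eventually_elim (use sub in blast)
qed

lemma ball_positive_occurs:
  assumes "H \<in> finite_rooted_graphs r" "ball_prob r H > 0"
  shows "\<forall>\<^sub>F n in sequentially. ball_prob r H / 2 < ball_freq r H n"
  using order_tendstoD(1)[OF ball_freq_tendsto[OF assms(1)], of "ball_prob r H / 2"] assms(2) by simp

lemma ball_freq_pos_ex:
  assumes "0 < ball_freq r H n"
  shows "\<exists>v\<in>verts (Gs n). rooted_isomorphic (rooted_ball r (Gs n, v)) H"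
proof (rule ccontr)
  assume "\<not> ?thesis"
  then have e: "{v \<in> verts (Gs n). rooted_isomorphic (rooted_ball r (Gs n, v)) H} = {}" by auto
  show False using assms unfolding ball_freq_def e by simp
qed

lemma AE_ball_occurs:
  "AE \<omega> in M. \<exists>n. \<exists>v\<in>verts (Gs n). rooted_isomorphic (rooted_ball r (G \<omega>)) (rooted_ball r (Gs n, v))"
  using AE_ball_positive[of r]
proof eventually_elim
  case (elim \<omega>)
  then obtain H where H: "H \<in> finite_rooted_graphs r" "rooted_isomorphic (rooted_ball r (G \<omega>)) H" "ball_prob r H > 0" by blast
  obtain n where "ball_prob r H / 2 < ball_freq r H n"
    using ball_positive_occurs[OF H(1,3)] by (auto simp: eventually_sequentially)
  then have "0 < ball_freq r H n" using H(3) by linarith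
  then obtain v where v: "v \<in> verts (Gs n)" "rooted_isomorphic (rooted_ball r (Gs n, v)) H"
    using ball_freq_pos_ex by blast
  then show ?case
    using rooted_isomorphic_trans[OF H(2) rooted_isomorphic_sym[OF v(2) Gs_ball_root[OF v(1)]]] by blast
qed

lemma closed_walks_ball_type:
  assumes "simple_graph (fst X)" "snd X \<in> verts (fst X)" "H \<in> finite_rooted_graphs n"
    "rooted_isomorphic (rooted_ball n X) (H :: nat rooted_graph)"
  shows "card (closed_walks n X) = card (closed_walks n H)"
proof -
  have "card (closed_walks n (rooted_ball n X)) = card (closed_walks n H)"
    by (rule closed_walks_isomorphic[OF assms(4) simple_rooted_ball[OF assms(1)]])
      (use assms root_in_ball[of "snd X" "fst X" n] connected_graph_simple in \<open>auto simp: finite_rooted_graphs_def\<close>)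
  then show ?thesis using closed_walks_rooted_ball[OF assms(1), of n "snd X"] by simp
qed

text \<open>The count is constant on each ball event, and there are countably many test graphs, so
  preimages are countable unions of events.\<close>

lemma measurable_closed_walks: "(\<lambda>\<omega>. real (card (closed_walks n (G \<omega>)))) \<in> borel_measurable M"
proof (rule measurableI)
  fix A :: "real set" assume "A \<in> sets borel"
  let ?F = "\<lambda>\<omega>. real (card (closed_walks n (G \<omega>)))"
  let ?C = "{H :: nat rooted_graph. H \<in> finite_rooted_graphs n \<and> real (card (closed_walks n H)) \<in> A}"
  have "?F -` A \<inter> space M = (\<Union>H\<in>?C. {\<omega> \<in> space M. rooted_isomorphic (rooted_ball n (G \<omega>)) H})"
  proof (intro set_eqI iffI)
    fix \<omega> assume w: "\<omega> \<in> ?F -` A \<inter> space M"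
    have g: "connected_graph (fst (G \<omega>))" "locally_finite_graph (fst (G \<omega>))" "snd (G \<omega>) \<in> verts (fst (G \<omega>))"
      using G_rooted_graph w by auto
    have sg: "simple_graph (fst (G \<omega>))" using g(1) connected_graph_simple by blast
    have "finite (ball_verts n (fst (G \<omega>), snd (G \<omega>)))"
      using finite_ball_verts[OF _ g(3)] sg g(2) unfolding loc_fin_def by blast
    then obtain H :: "nat rooted_graph" where H: "H \<in> finite_rooted_graphs n" "rooted_isomorphic (rooted_ball n (G \<omega>)) H"
      using rooted_ball_nat_copy[OF sg g(3), of n] by auto
    then have "H \<in> ?C" using closed_walks_ball_type[OF sg g(3) H] w by auto
    then show "\<omega> \<in> (\<Union>H\<in>?C. {\<omega> \<in> space M. rooted_isomorphic (rooted_ball n (G \<omega>)) H})" using H w by blast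
  next
    fix \<omega> assume "\<omega> \<in> (\<Union>H\<in>?C. {\<omega> \<in> space M. rooted_isomorphic (rooted_ball n (G \<omega>)) H})"
    then obtain H where H: "H \<in> ?C" "\<omega> \<in> space M" "rooted_isomorphic (rooted_ball n (G \<omega>)) H" by blast
    have "card (closed_walks n (G \<omega>)) = card (closed_walks n H)"
      by (rule closed_walks_ball_type[OF connected_graph_simple])
        (use H(1,3) G_rooted_graph[OF H(2)] in simp_all)
    then show "\<omega> \<in> ?F -` A \<inter> space M" using H(1,2) by simp
  qed
  also have "\<dots> \<in> sets M"
    by (rule sets.countable_UN'') (use countable_subset[OF _ countable_finite_rooted_graphs[of n]] ball_event in auto)
  finally show "?F -` A \<inter> space M \<in> sets M" .
qed simp

text \<open>With one value per ball type, the averages and the expectation are the same finite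
  linear combination, of type frequencies and of type probabilities respectively.\<close>

lemma closed_walks_tendsto:
  "(\<lambda>n. (\<Sum>v\<in>verts (Gs n). real (card (closed_walks k (Gs n, v)))) / real (card (verts (Gs n))))
     \<longlonglongrightarrow> (\<integral>\<omega>. real (card (closed_walks k (G \<omega>))) \<partial>M)"
proof (rule ball_types_limit[of k])
  fix Hs :: "nat rooted_graph set"
  assume Hs: "finite Hs" "Hs \<subseteq> finite_rooted_graphs k"
    "\<And>n v. v \<in> verts (Gs n) \<Longrightarrow> \<exists>!H. H \<in> Hs \<and> rooted_isomorphic (rooted_ball k (Gs n, v)) H"
    "\<And>\<omega> H H'. \<omega> \<in> space M \<Longrightarrow> H \<in> Hs \<Longrightarrow> H' \<in> Hs \<Longrightarrow> rooted_isomorphic (rooted_ball k (G \<omega>)) H \<Longrightarrow>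
       rooted_isomorphic (rooted_ball k (G \<omega>)) H' \<Longrightarrow> H = H'"
    "AE \<omega> in M. \<exists>H\<in>Hs. rooted_isomorphic (rooted_ball k (G \<omega>)) H \<and> ball_prob k H > 0"
  define c where "c H = real (card (closed_walks k H))" for H :: "nat rooted_graph"
  let ?ev = "\<lambda>H. {\<omega> \<in> space M. rooted_isomorphic (rooted_ball k (G \<omega>)) H}"
  have ev: "?ev H \<in> sets M" if "H \<in> Hs" for H using ball_event that Hs(2) by blast
  have "(\<integral>\<omega>. real (card (closed_walks k (G \<omega>))) \<partial>M) = (\<integral>\<omega>. (\<Sum>H\<in>Hs. c H * indicator (?ev H) \<omega>) \<partial>M)"
  proof (rule integral_cong_AE[OF measurable_closed_walks])
    show "(\<lambda>\<omega>. \<Sum>H\<in>Hs. c H * indicator (?ev H) \<omega>) \<in> borel_measurable M"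
      using ev by (intro borel_measurable_sum borel_measurable_times) auto
    show "AE \<omega> in M. real (card (closed_walks k (G \<omega>))) = (\<Sum>H\<in>Hs. c H * indicator (?ev H) \<omega>)"
      using Hs(5) AE_space
    proof eventually_elim
      case (elim \<omega>)
      then obtain H where H: "H \<in> Hs" "rooted_isomorphic (rooted_ball k (G \<omega>)) H" by blast
      have "(\<Sum>H'\<in>Hs. c H' * indicator (?ev H') \<omega>) = (\<Sum>H'\<in>{H}. c H' * indicator (?ev H') \<omega>)"
      proof (rule sum.mono_neutral_right)
        show "\<forall>H'\<in>Hs - {H}. c H' * indicator (?ev H') \<omega> = 0"
        proof
          fix H' assume H': "H' \<in> Hs - {H}"
          then have "\<omega> \<notin> ?ev H'" using Hs(4)[OF elim(2), of H' H] H by blast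
          then show "c H' * indicator (?ev H') \<omega> = 0" by simp
        qed
      qed (use Hs(1) H in simp_all)
      also have "\<dots> = c H" using H elim by simp
      also have "\<dots> = real (card (closed_walks k (G \<omega>)))"
        unfolding c_def
        by (intro arg_cong[of _ _ real] closed_walks_ball_type[OF connected_graph_simple, symmetric])
          (use H Hs(2) G_rooted_graph[OF elim(2)] in auto)
      finally show ?case by simp
    qed
  qed
  also have "\<dots> = (\<Sum>H\<in>Hs. c H * ball_prob k H)"
    unfolding ball_prob_def using ev
    by (subst Bochner_Integration.integral_sum) (auto intro!: sum.cong simp: less_top[symmetric] emeasure_eq_measure)
  finally have int: "(\<integral>\<omega>. real (card (closed_walks k (G \<omega>))) \<partial>M) = (\<Sum>H\<in>Hs. c H * ball_prob k H)" .
  have "(\<Sum>v\<in>verts (Gs n). real (card (closed_walks k (Gs n, v)))) / real (card (verts (Gs n))) =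
    (\<Sum>H\<in>Hs. c H * ball_freq k H n)" for n
  proof -
    let ?V = "verts (Gs n)"
    define ty where "ty v = (THE H. H \<in> Hs \<and> rooted_isomorphic (rooted_ball k (Gs n, v)) H)" for v
    have ty: "ty v \<in> Hs \<and> rooted_isomorphic (rooted_ball k (Gs n, v)) (ty v)" if "v \<in> ?V" for v
      unfolding ty_def by (rule theI'[OF Hs(3)[OF that]])
    have ty_iff: "ty v = H \<longleftrightarrow> rooted_isomorphic (rooted_ball k (Gs n, v)) H" if "v \<in> ?V" "H \<in> Hs" for v H
      using ty[OF that(1)] Hs(3)[OF that(1)] that(2) by blast
    have "(\<Sum>v\<in>?V. real (card (closed_walks k (Gs n, v)))) = (\<Sum>v\<in>?V. c (ty v))"
    proof (intro sum.cong refl)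
      fix v assume v: "v \<in> ?V"
      then show "real (card (closed_walks k (Gs n, v))) = c (ty v)"
        unfolding c_def
        by (intro arg_cong[of _ _ real] closed_walks_ball_type) (use simple_Gs[of n] ty[OF v] Hs(2) in auto)
    qed
    also have "\<dots> = (\<Sum>H\<in>Hs. \<Sum>v\<in>{v\<in>?V. ty v = H}. c (ty v))"
      by (rule sum.group[symmetric]) (use finite_Gs Hs(1) ty in auto)
    also have "\<dots> = (\<Sum>H\<in>Hs. c H * real (card {v\<in>?V. rooted_isomorphic (rooted_ball k (Gs n, v)) H}))"
    proof (intro sum.cong refl)
      fix H assume H: "H \<in> Hs"
      have "(\<Sum>v\<in>{v\<in>?V. ty v = H}. c (ty v)) = (\<Sum>v\<in>{v\<in>?V. ty v = H}. c H)"
        by (rule sum.cong) auto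
      also have "\<dots> = c H * real (card {v\<in>?V. ty v = H})" by simp
      finally have s: "(\<Sum>v\<in>{v\<in>?V. ty v = H}. c (ty v)) = c H * real (card {v\<in>?V. ty v = H})" .
      have e: "{v\<in>?V. ty v = H} = {v\<in>?V. rooted_isomorphic (rooted_ball k (Gs n, v)) H}"
        using ty_iff H by blast
      show "(\<Sum>v\<in>{v\<in>?V. ty v = H}. c (ty v)) = c H * real (card {v\<in>?V. rooted_isomorphic (rooted_ball k (Gs n, v)) H})"
        unfolding s unfolding e ..
    qed
    finally show ?thesis unfolding ball_freq_def by (simp add: sum_divide_distrib)
  qed
  moreover have "(\<lambda>n. \<Sum>H\<in>Hs. c H * ball_freq k H n) \<longlonglongrightarrow> (\<Sum>H\<in>Hs. c H * ball_prob k H)"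
    by (intro tendsto_sum tendsto_mult_left ball_freq_tendsto) (use Hs(2) in blast)
  ultimately show ?thesis unfolding int by simp
qed

end

section \<open>Roots of log-convex sequences\<close>

text \<open>Log-convexity and \<open>m 0 = 1\<close> give
  \<open>m k ^ Suc k \<le> m (Suc k) ^ k\<close>, so the roots increase. Being bounded they
  converge, which is what gives \<open>lim\<close> its meaning, and the limit dominates each of
  them.\<close>

lemma log_convex_le_lim_root:
  fixes m :: "nat \<Rightarrow> real"
  assumes m0: "m 0 = 1" and pos: "\<And>k. 0 \<le> m k" and lc: "\<And>k. (m (Suc k))\<^sup>2 \<le> m k * m (Suc (Suc k))"
    and C: "0 \<le> C" "\<And>k. m k \<le> (C\<^sup>2) ^ k"
  shows "m k \<le> (lim (\<lambda>k. root (2 * k) (m k))) ^ (2 * k) \<and> 0 \<le> lim (\<lambda>k. root (2 * k) (m k))"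
proof -
  have pw: "m k ^ Suc k \<le> m (Suc k) ^ k" for k
  proof (induction k)
    case 0
    then show ?case using m0 by simp
  next
    case (Suc k)
    show ?case
    proof (cases "m (Suc k) = 0")
      case True
      then show ?thesis using pos by simp
    next
      case False
      then have p: "0 < m (Suc k)" using pos[of "Suc k"] by simp
      have "m (Suc k) ^ k * m (Suc k) ^ Suc (Suc k) = ((m (Suc k))\<^sup>2) ^ Suc k"
        by (simp add: power_mult[symmetric] power_add[symmetric] mult_2 flip: power_Suc)
      also have "\<dots> \<le> (m k * m (Suc (Suc k))) ^ Suc k" by (intro power_mono lc) simp
      also have "\<dots> = m k ^ Suc k * m (Suc (Suc k)) ^ Suc k" by (rule power_mult_distrib)
      also have "\<dots> \<le> m (Suc k) ^ k * m (Suc (Suc k)) ^ Suc k"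
        by (intro mult_right_mono Suc) (use pos in simp)
      finally show ?thesis using p by simp
    qed
  qed
  define x where "x k = root (2 * k) (m k)" for k
  have xp: "x k ^ (2 * k) = m k" if "0 < k" for k
    unfolding x_def using that pos by (intro real_root_pow_pos2) auto
  have x0: "0 \<le> x k" for k unfolding x_def using pos by (intro real_root_ge_zero) auto
  \<comment> \<open>Monotonicity starts at index 1, since \<open>root 0\<close> is 0 by
    convention.\<close>
  have step: "x (Suc k) \<le> x (Suc (Suc k))" for k
  proof (rule power_le_imp_le_base)
    let ?N = "2 * Suc k * Suc (Suc k)"
    have "x (Suc k) ^ ?N = m (Suc k) ^ Suc (Suc k)" by (subst power_mult) (simp only: xp[of "Suc k", OF zero_less_Suc])
    also have "\<dots> \<le> m (Suc (Suc k)) ^ Suc k" by (rule pw)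
    also have "\<dots> = x (Suc (Suc k)) ^ (2 * Suc (Suc k) * Suc k)" by (subst power_mult) (simp only: xp[of "Suc (Suc k)", OF zero_less_Suc])
    also have "2 * Suc (Suc k) * Suc k = ?N" by simp
    finally show "x (Suc k) ^ Suc (?N - 1) \<le> x (Suc (Suc k)) ^ Suc (?N - 1)" by simp
  qed (rule x0)
  have bound: "x (Suc k) \<le> C" for k
  proof (rule power_le_imp_le_base[of _ "2 * Suc k - 1"])
    have "x (Suc k) ^ (2 * Suc k) \<le> C ^ (2 * Suc k)"
      unfolding xp[of "Suc k", OF zero_less_Suc] using C(2)[of "Suc k"] by (simp only: power_mult)
    then show "x (Suc k) ^ Suc (2 * Suc k - 1) \<le> C ^ Suc (2 * Suc k - 1)" by simp
  qed (rule C)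
  have inc: "incseq (\<lambda>k. x (Suc k))" by (rule incseq_SucI) (rule step)
  obtain L where L: "(\<lambda>k. x (Suc k)) \<longlonglongrightarrow> L" "\<And>k. x (Suc k) \<le> L"
    using incseq_convergent[OF inc, of C] bound by auto
  have "x \<longlonglongrightarrow> L" using L(1) by (rule LIMSEQ_imp_Suc)
  then have lim: "lim (\<lambda>k. root (2 * k) (m k)) = L" unfolding x_def by (rule limI)
  have L0: "0 \<le> L" using L(2)[of 0] x0[of "Suc 0"] by linarith
  show ?thesis
  proof (cases k)
    case 0
    then show ?thesis using m0 lim L0 by simp
  next
    case (Suc j)
    have "m k = x k ^ (2 * k)" using xp[of k] Suc by simp
    also have "\<dots> \<le> L ^ (2 * k)" by (rule power_mono) (use L(2)[of j] Suc x0 in auto)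
    finally show ?thesis using lim L0 by simp
  qed
qed

section \<open>Recovering the tree from its balls\<close>

context tree_cover
begin

lemma proj_ball_verts:
  assumes "v \<in> verts T"
  shows "\<pi> ` ball_verts r (T, v) = ball_verts r (G, \<pi> v)"
proof
  show "\<pi> ` ball_verts r (T, v) \<subseteq> ball_verts r (G, \<pi> v)"
  proof
    fix y assume "y \<in> \<pi> ` ball_verts r (T, v)"
    then obtain x k where x: "y = \<pi> x" "x \<in> verts T" "k \<le> r" "(v, x) \<in> adj T ^^ k" by (auto elim: ball_vertsE)
    obtain w where w: "walk T w k" "w 0 = v" "w k = x" using relpow_walk[OF x(4) assms] by blast
    have "(\<pi> v, y) \<in> adj G ^^ k" using walk_relpow[OF proj_walk[OF w(1)], of 0 k] w x by simp
    then show "y \<in> ball_verts r (G, \<pi> v)" using x proj_verts by (intro ballI ball_vertsI) auto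
  qed
  show "ball_verts r (G, \<pi> v) \<subseteq> \<pi> ` ball_verts r (T, v)"
  proof
    fix y assume "y \<in> ball_verts r (G, \<pi> v)"
    then obtain k where k: "y \<in> verts G" "k \<le> r" "(\<pi> v, y) \<in> adj G ^^ k" by (rule ball_vertsE)
    obtain w where w: "walk G w k" "w 0 = \<pi> v" "w k = y" using relpow_walk[OF k(3) proj_verts[OF assms]] by blast
    obtain w' where w': "walk T w' k" "w' 0 = v" "\<forall>i\<le>k. \<pi> (w' i) = w i"
      using lift_exists[OF w(1) assms] w(2) by auto
    have "w' k \<in> ball_verts r (T, v)"
      by (rule ball_vertsI[of _ _ k]) (use walk_relpow[OF w'(1), of 0 k] w' walk_verts[OF simple_T w'(1), of k] k in auto)
    moreover have "\<pi> (w' k) = y" using w' w by simp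
    ultimately show "y \<in> \<pi> ` ball_verts r (T, v)" by blast
  qed
qed

text \<open>A geodesic inside the ball between two points with the same image projects to a reduced
  closed walk in the ball below, which contains a cycle.\<close>

lemma proj_inj_ball:
  assumes v: "v \<in> verts T" and acyclic: "\<nexists>xs. is_cycle (fst (rooted_ball r (G, \<pi> v))) xs"
  shows "inj_on \<pi> (ball_verts r (T, v))"
proof (rule inj_onI, rule ccontr)
  fix x y assume xy: "x \<in> ball_verts r (T, v)" "y \<in> ball_verts r (T, v)" "\<pi> x = \<pi> y" "x \<noteq> y"
  let ?B = "fst (rooted_ball r (T, v))" and ?C = "fst (rooted_ball r (G, \<pi> v))"
  have sB: "simple_graph ?B" using simple_rooted_ball[of "(T, v)"] simple_T by simp
  have sC: "simple_graph ?C" using simple_rooted_ball[of "(G, \<pi> v)"] simple by simp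
  have eqB: "(?B, v) = rooted_ball r (T, v)" by (simp add: rooted_ball_def)
  have "ball_verts r (?B, v) = verts ?B"
    unfolding eqB using ball_verts_rooted_ball[OF simple_T v, of r r] by simp
  then have conn: "connected_graph ?B"
    by (rule connected_from_root[OF sB, rotated]) (use root_in_ball[OF v] in simp)
  define d where "d = gdist ?B x y"
  obtain w where w: "walk ?B w d" "w 0 = x" "w d = y" "reduced_walk w d"
    using geodesic_walk[OF conn, of x y] xy unfolding d_def by auto
  have wT: "walk T w d" using w(1) unfolding walk_def by (auto simp: ball_verts_def)
  have wb: "w i \<in> ball_verts r (T, v)" if "i \<le> d" for i using walk_verts[OF sB w(1) that] by simp
  have "walk ?C (\<lambda>i. \<pi> (w i)) d"
    using proj_walk[OF wT] wb proj_ball_verts[OF v, of r] unfolding walk_def by auto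
  moreover have "reduced_walk (\<lambda>i. \<pi> (w i)) d" by (rule proj_reduced[OF wT w(4)])
  moreover have "0 < d" using w xy by (cases d) auto
  ultimately have "\<exists>xs. is_cycle ?C xs \<and> set xs \<subseteq> (\<lambda>i. \<pi> (w i)) ` {0..d}"
    using reduced_closed_imp_cycle[OF sC, of "\<lambda>i. \<pi> (w i)" d 0 d] w xy by auto
  then show False using acyclic by blast
qed

text \<open>The additional radius is for edges: the lift of an edge between two images might end
  outside the \<open>r\<close>-ball, and injectivity on the next ball identifies its end with the
  expected vertex.\<close>

lemma acyclic_ball_isomorphic:
  assumes v: "v \<in> verts T" and acyclic: "\<nexists>xs. is_cycle (fst (rooted_ball (Suc r) (G, \<pi> v))) xs"
  shows "rooted_isomorphic (rooted_ball r (T, v)) (rooted_ball r (G, \<pi> v))"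
proof -
  have inj: "inj_on \<pi> (ball_verts (Suc r) (T, v))" by (rule proj_inj_ball[OF v acyclic])
  have sub: "ball_verts r (T, v) \<subseteq> ball_verts (Suc r) (T, v)" by (rule ball_verts_mono) simp
  have "graph_isomorphism \<pi> (fst (rooted_ball r (T, v))) (fst (rooted_ball r (G, \<pi> v)))"
    unfolding graph_isomorphism_def
  proof (intro conjI ballI)
    show "bij_betw \<pi> (verts (fst (rooted_ball r (T, v)))) (verts (fst (rooted_ball r (G, \<pi> v))))"
      using inj_on_subset[OF inj sub] proj_ball_verts[OF v, of r] unfolding bij_betw_def by simp
    fix x y assume "x \<in> verts (fst (rooted_ball r (T, v)))" "y \<in> verts (fst (rooted_ball r (T, v)))"
    then have xy: "x \<in> ball_verts r (T, v)" "y \<in> ball_verts r (T, v)" by auto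
    have "(x, y) \<in> adj T" if adj: "(\<pi> x, \<pi> y) \<in> adj G"
    proof -
      obtain k where k: "x \<in> verts T" "k \<le> r" "(v, x) \<in> adj T ^^ k" using xy(1) by (rule ball_vertsE)
      obtain z where z: "(x, z) \<in> adj T" "\<pi> z = \<pi> y" using step_exists[OF k(1) adj] by blast
      have "(v, z) \<in> adj T ^^ Suc k" using k(3) z(1) by auto
      then have "z \<in> ball_verts (Suc r) (T, v)"
        by (intro ball_vertsI[of _ _ "Suc k"]) (use k simple_graph_adj_verts[OF simple_T z(1)] in auto)
      then have "z = y" using inj z(2) xy(2) sub by (auto dest: inj_onD)
      then show ?thesis using z by simp
    qed
    then show "(x, y) \<in> adj (fst (rooted_ball r (T, v))) \<longleftrightarrow> (\<pi> x, \<pi> y) \<in> adj (fst (rooted_ball r (G, \<pi> v)))"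
      using xy proj_adj[of x y] proj_ball_verts[OF v, of r] by auto
  qed
  then show ?thesis unfolding rooted_isomorphic_def by (intro exI[of _ \<pi>]) simp
qed

lemma deck_rooted_isomorphic:
  assumes "u \<in> verts T" "u' \<in> verts T" "\<pi> u = \<pi> u'"
  shows "rooted_isomorphic (rooted_ball r (T, u)) (rooted_ball r (T, u'))"
proof -
  obtain g where g: "deck g" "g u = u'" using deck_exists[OF assms] by blast
  have iso: "graph_isomorphism g T T" using g unfolding deck_def by simp
  have im: "g ` ball_verts r (T, u) = ball_verts r (T, u')"
    using graph_isomorphism_ball_verts[OF iso simple_T simple_T assms(1)] g by simp
  have sub: "ball_verts r (T, u) \<subseteq> verts T" unfolding ball_verts_def by auto
  have "graph_isomorphism g (fst (rooted_ball r (T, u))) (fst (rooted_ball r (T, u')))"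
    unfolding graph_isomorphism_def
  proof (intro conjI ballI)
    show "bij_betw g (verts (fst (rooted_ball r (T, u)))) (verts (fst (rooted_ball r (T, u'))))"
      using im inj_on_subset[OF deck_inj[OF g(1)] sub] unfolding bij_betw_def by simp
    fix x y assume "x \<in> verts (fst (rooted_ball r (T, u)))" "y \<in> verts (fst (rooted_ball r (T, u)))"
    then have xy: "x \<in> ball_verts r (T, u)" "y \<in> ball_verts r (T, u)" by auto
    then have "(x, y) \<in> adj T \<longleftrightarrow> (g x, g y) \<in> adj T" using iso sub unfolding graph_isomorphism_def by blast
    then show "(x, y) \<in> adj (fst (rooted_ball r (T, u))) \<longleftrightarrow> (g x, g y) \<in> adj (fst (rooted_ball r (T, u')))"
      using xy im by auto
  qed
  then show ?thesis unfolding rooted_isomorphic_def using g by (intro exI[of _ g]) simp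
qed

end

section \<open>From isomorphic balls to isomorphic graphs\<close>

lemma ball_isomorphism_smaller:
  assumes f: "graph_isomorphism f (fst (rooted_ball r (A, p))) (fst (rooted_ball r (C, q)))" "f p = q"
    and s: "simple_graph A" "p \<in> verts A" "simple_graph C" "q \<in> verts C" and sr: "s \<le> r"
  shows "f ` ball_verts s (A, p) = ball_verts s (C, q)"
proof -
  have eq: "rooted_ball r (A, p) = (fst (rooted_ball r (A, p)), p)" "rooted_ball r (C, q) = (fst (rooted_ball r (C, q)), q)"
    by (simp_all add: rooted_ball_def)
  have "f ` ball_verts s (fst (rooted_ball r (A, p)), p) = ball_verts s (fst (rooted_ball r (C, q)), f p)"
    by (rule graph_isomorphism_ball_verts[OF f(1)])
      (use simple_rooted_ball[of "(A, p)" r] simple_rooted_ball[of "(C, q)" r] s root_in_ball[OF s(2)] in auto)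
  then show ?thesis
    using ball_verts_rooted_ball[OF s(1,2) sr] ball_verts_rooted_ball[OF s(3,4) sr] f(2) eq by simp
qed

lemma ball_isomorphic_smaller:
  assumes iso: "rooted_isomorphic (rooted_ball r (A, p)) (rooted_ball r (C, q))"
    and s: "simple_graph A" "p \<in> verts A" "simple_graph C" "q \<in> verts C" and sr: "s \<le> r"
  shows "rooted_isomorphic (rooted_ball s (A, p)) (rooted_ball s (C, q))"
proof -
  obtain f where f: "graph_isomorphism f (fst (rooted_ball r (A, p))) (fst (rooted_ball r (C, q)))" "f p = q"
    using iso unfolding rooted_isomorphic_def by auto
  have im: "f ` ball_verts s (A, p) = ball_verts s (C, q)" by (rule ball_isomorphism_smaller[OF f s sr])
  have sub: "ball_verts s (A, p) \<subseteq> ball_verts r (A, p)" "ball_verts s (C, q) \<subseteq> ball_verts r (C, q)"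
    by (rule ball_verts_mono[OF sr])+
  have "graph_isomorphism f (fst (rooted_ball s (A, p))) (fst (rooted_ball s (C, q)))"
    unfolding graph_isomorphism_def
  proof (intro conjI ballI)
    have "inj_on f (ball_verts r (A, p))" using f(1) unfolding graph_isomorphism_def bij_betw_def by simp
    then show "bij_betw f (verts (fst (rooted_ball s (A, p)))) (verts (fst (rooted_ball s (C, q))))"
      using im inj_on_subset[OF _ sub(1)] unfolding bij_betw_def by simp
    fix x y assume "x \<in> verts (fst (rooted_ball s (A, p)))" "y \<in> verts (fst (rooted_ball s (A, p)))"
    then have xy: "x \<in> ball_verts s (A, p)" "y \<in> ball_verts s (A, p)" by auto
    then have xr: "x \<in> ball_verts r (A, p)" "y \<in> ball_verts r (A, p)" using sub by auto
    have fxy: "f x \<in> ball_verts s (C, q)" "f y \<in> ball_verts s (C, q)" using xy im by auto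
    then have fr: "f x \<in> ball_verts r (C, q)" "f y \<in> ball_verts r (C, q)" using sub by auto
    have "(x, y) \<in> adj (fst (rooted_ball r (A, p))) \<longleftrightarrow> (f x, f y) \<in> adj (fst (rooted_ball r (C, q)))"
      using f(1) xr unfolding graph_isomorphism_def by simp
    then show "(x, y) \<in> adj (fst (rooted_ball s (A, p))) \<longleftrightarrow> (f x, f y) \<in> adj (fst (rooted_ball s (C, q)))"
      using xr fr xy fxy by simp
  qed
  then show ?thesis unfolding rooted_isomorphic_def using f(2) by (intro exI[of _ f]) simp
qed

text \<open>Koenig's lemma: among the isomorphisms of the \<open>r\<close>-balls, infinitely many agree on each ball.\<close>

lemma isomorphic_of_balls:
  fixes A :: "'a graph" and C :: "'c graph"
  assumes A: "connected_graph A" "p \<in> verts A" and C: "connected_graph C" "q \<in> verts C"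
    and fin: "\<And>r. finite (ball_verts r (A, p))" "\<And>r. finite (ball_verts r (C, q))"
    and iso: "\<And>r. rooted_isomorphic (rooted_ball r (A, p)) (rooted_ball r (C, q))"
  shows "isomorphic A C"
proof -
  let ?a = "\<lambda>s. ball_verts s (A, p)" and ?c = "\<lambda>s. ball_verts s (C, q)"
  have sA: "simple_graph A" and sC: "simple_graph C" using A C connected_graph_simple by auto
  have "\<exists>f. graph_isomorphism f (fst (rooted_ball r (A, p))) (fst (rooted_ball r (C, q))) \<and> f p = q" for r
    using iso[of r] unfolding rooted_isomorphic_def by auto
  then obtain f where f: "\<And>r. graph_isomorphism (f r) (fst (rooted_ball r (A, p))) (fst (rooted_ball r (C, q)))"
    "\<And>r. f r p = q" by metis
  have im: "f r ` ?a s = ?c s" if "s \<le> r" for r s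
    by (rule ball_isomorphism_smaller[OF f sA A(2) sC C(2) that])
  have step: "\<exists>J'. infinite J' \<and> (\<exists>h. \<forall>r\<in>J'. restrict (f r) (?a s) = h) \<and> J' \<subseteq> J" if J: "infinite J" for J s
  proof -
    let ?J = "{r\<in>J. s \<le> r}"
    have inf: "infinite ?J"
    proof
      assume "finite ?J"
      moreover have "J \<subseteq> ?J \<union> {..<s}" by auto
      ultimately show False using J finite_subset by blast
    qed
    have fim: "finite ((\<lambda>r. restrict (f r) (?a s)) ` ?J)"
    proof (rule finite_subset)
      show "(\<lambda>r. restrict (f r) (?a s)) ` ?J \<subseteq> ?a s \<rightarrow>\<^sub>E ?c s"
      proof
        fix h assume "h \<in> (\<lambda>r. restrict (f r) (?a s)) ` ?J"
        then obtain r where r: "s \<le> r" "h = restrict (f r) (?a s)" by auto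
        have "f r x \<in> ?c s" if "x \<in> ?a s" for x using im[OF r(1)] that by auto
        then show "h \<in> ?a s \<rightarrow>\<^sub>E ?c s" unfolding r(2) by auto
      qed
      show "finite (?a s \<rightarrow>\<^sub>E ?c s)" using fin by (intro finite_PiE) auto
    qed
    obtain r0 where r0: "r0 \<in> ?J" "infinite {r\<in>?J. restrict (f r) (?a s) = restrict (f r0) (?a s)}"
      using pigeonhole_infinite[OF inf fim] by (elim bexE)
    let ?I = "{r\<in>?J. restrict (f r) (?a s) = restrict (f r0) (?a s)}"
    have "\<forall>r\<in>?I. restrict (f r) (?a s) = restrict (f r0) (?a s)" by simp
    moreover have "?I \<subseteq> J" by auto
    ultimately show ?thesis using r0(2) by (intro exI[of _ ?I] conjI exI[of _ "restrict (f r0) (?a s)"])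
  qed
  define P where "P s J \<longleftrightarrow> infinite J \<and> (\<exists>h. \<forall>r\<in>J. restrict (f r) (?a s) = h)" for s J
  have ex: "\<exists>J'. P s J' \<and> J' \<subseteq> J" if "infinite J" for s J
    unfolding P_def conj_assoc by (rule step[OF that])
  \<comment> \<open>Nested infinite sets of indices: the isomorphisms indexed by \<open>J s\<close>
    all agree on the \<open>s\<close>-ball.\<close>
  have "\<exists>J. \<forall>s. P s (J s) \<and> J (Suc s) \<subseteq> J s"
  proof (rule dependent_nat_choice)
    show "\<exists>J. P 0 J" using ex[OF infinite_UNIV_nat, of 0] by blast
    show "\<exists>J'. P (Suc s) J' \<and> J' \<subseteq> J" if "P s J" for J s
      by (rule ex) (use that in \<open>simp add: P_def\<close>)
  qed
  then obtain J where J': "\<forall>s. P s (J s) \<and> J (Suc s) \<subseteq> J s" by (elim exE)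
  have J: "infinite (J s)" "\<exists>h. \<forall>r\<in>J s. restrict (f r) (?a s) = h" "J (Suc s) \<subseteq> J s" for s
    using J'[rule_format, of s] unfolding P_def by simp_all
  have Jmono: "J t \<subseteq> J s" if "s \<le> t" for s t using J(3) that by (rule lift_Suc_antimono_le)
  have "\<exists>r. r \<in> J s \<and> s \<le> r" for s using J(1)[of s] by (meson infinite_nat_iff_unbounded_le)
  then obtain rr where rr: "\<And>s. rr s \<in> J s" "\<And>s. s \<le> rr s" by metis
  \<comment> \<open>\<open>F x\<close> is read off at an index for the smallest ball containing
    \<open>x\<close>; the indices chosen for larger balls give the same value.\<close>
  define lv where "lv x = (LEAST s. x \<in> ?a s)" for x
  define F where "F x = f (rr (lv x)) x" for x
  have Feq: "F x = f (rr s) x" if x: "x \<in> ?a s" for x s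
  proof -
    have l: "lv x \<le> s" "x \<in> ?a (lv x)" unfolding lv_def using x by (auto intro: Least_le LeastI)
    have "rr s \<in> J (lv x)" using Jmono[OF l(1)] rr(1) by blast
    then have "restrict (f (rr s)) (?a (lv x)) = restrict (f (rr (lv x))) (?a (lv x))"
      using J(2)[of "lv x"] rr(1)[of "lv x"] by auto
    then have "restrict (f (rr s)) (?a (lv x)) x = restrict (f (rr (lv x))) (?a (lv x)) x" by simp
    then show ?thesis unfolding F_def using l(2) by simp
  qed
  have allA: "\<exists>s. x \<in> ?a s" if "x \<in> verts A" for x
    using ball_vertsI[OF that order_refl gdist_relpow[OF A that]] by blast
  have allC: "\<exists>s. x \<in> ?c s" if "x \<in> verts C" for x
    using ball_vertsI[OF that order_refl gdist_relpow[OF C that]] by blast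
  have both: "\<exists>s. x \<in> ?a s \<and> y \<in> ?a s" if xy: "x \<in> verts A" "y \<in> verts A" for x y
  proof -
    obtain s t where "x \<in> ?a s" "y \<in> ?a t" using allA[OF xy(1)] allA[OF xy(2)] by blast
    then have "x \<in> ?a (max s t)" "y \<in> ?a (max s t)"
      using ball_verts_mono[of s "max s t" "(A, p)"] ball_verts_mono[of t "max s t" "(A, p)"] by auto
    then show ?thesis by blast
  qed
  have subC: "?c s \<subseteq> verts C" for s unfolding ball_verts_def by auto
  have subA: "?a s \<subseteq> verts A" for s unfolding ball_verts_def by auto
  have "graph_isomorphism F A C"
    unfolding graph_isomorphism_def bij_betw_def
  proof (intro conjI ballI)
    show "inj_on F (verts A)"
    proof (rule inj_onI)
      fix x y assume xy: "x \<in> verts A" "y \<in> verts A" "F x = F y"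
      obtain s where s: "x \<in> ?a s" "y \<in> ?a s" using both xy by blast
      have "inj_on (f (rr s)) (?a (rr s))"
        using f(1)[of "rr s"] unfolding graph_isomorphism_def bij_betw_def by simp
      moreover have "x \<in> ?a (rr s)" "y \<in> ?a (rr s)" using s ball_verts_mono[OF rr(2)[of s], of "(A, p)"] by auto
      ultimately show "x = y" using Feq[OF s(1)] Feq[OF s(2)] xy(3) by (auto dest: inj_onD)
    qed
    show "F ` verts A = verts C"
    proof
      show "F ` verts A \<subseteq> verts C"
      proof
        fix y assume "y \<in> F ` verts A"
        then obtain x s where x: "y = F x" "x \<in> ?a s" using allA by blast
        then have "y \<in> ?c s" using Feq[OF x(2)] im[OF rr(2)[of s]] by auto
        then show "y \<in> verts C" using subC by blast
      qed
      show "verts C \<subseteq> F ` verts A"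
      proof
        fix y assume "y \<in> verts C"
        then obtain s where "y \<in> ?c s" using allC by blast
        then obtain x where x: "x \<in> ?a s" "y = f (rr s) x" using im[OF rr(2)[of s]] by blast
        show "y \<in> F ` verts A" by (rule image_eqI[of _ _ x]) (use x Feq[OF x(1)] subA[of s] in auto)
      qed
    qed
    fix x y assume xy: "x \<in> verts A" "y \<in> verts A"
    obtain s where s: "x \<in> ?a s" "y \<in> ?a s" using both xy by blast
    have r: "x \<in> ?a (rr s)" "y \<in> ?a (rr s)" using s ball_verts_mono[OF rr(2)[of s], of "(A, p)"] by auto
    have "(x, y) \<in> adj (fst (rooted_ball (rr s) (A, p))) \<longleftrightarrow>
      (f (rr s) x, f (rr s) y) \<in> adj (fst (rooted_ball (rr s) (C, q)))"
      using f(1)[of "rr s"] r unfolding graph_isomorphism_def by simp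
    moreover have "f (rr s) x \<in> ?c (rr s)" "f (rr s) y \<in> ?c (rr s)" using im[of "rr s" "rr s"] r by auto
    ultimately show "(x, y) \<in> adj A \<longleftrightarrow> (F x, F y) \<in> adj C" using r Feq[OF s(1)] Feq[OF s(2)] by simp
  qed
  then show ?thesis unfolding isomorphic_def by blast
qed

section \<open>Cycles in the limit increase the spectral radius\<close>

lemma power_approx_below:
  fixes L e :: real
  assumes "0 < L" "0 < e"
  shows "\<exists>t. 0 < t \<and> t < L \<and> L ^ n - e < t ^ n"
proof -
  have "((\<lambda>t. t ^ n) \<longlongrightarrow> L ^ n) (at_left L)" by (intro tendsto_intros)
  then have "\<forall>\<^sub>F t in at_left L. L ^ n - e < t ^ n" using assms(2) by (intro order_tendstoD(1)) auto
  moreover have "\<forall>\<^sub>F t in at_left L. t \<in> {0<..<L}" by (rule eventually_at_left_real[OF assms(1)])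
  ultimately have "\<forall>\<^sub>F t in at_left L. 0 < t \<and> t < L \<and> L ^ n - e < t ^ n" by eventually_elim auto
  then show ?thesis using eventually_happens'[OF trivial_limit_at_left_real] by blast
qed

text \<open>The balls of \<open>X\<close> are balls of \<open>T\<close>, at first about roots that
  vary with the radius. These roots lie in finitely many fibres over \<open>Gs 0\<close>, so one
  fibre serves infinitely many radii, and deck transformations move them to a single root.\<close>

lemma isomorphic_tree_of_acyclic_balls:
  fixes X :: "'v graph" and Gs :: "nat \<Rightarrow> 'u graph" and T :: "'t graph"
  assumes cov: "\<And>n. tree_cover T (Gs n) (\<pi> n)" and fin0: "finite (verts (Gs 0))"
    and T: "loc_fin T" and X: "connected_graph X" "loc_fin X" "p \<in> verts X"
    and acyclic: "\<And>r. \<nexists>xs. is_cycle (fst (rooted_ball r (X, p))) xs"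
    and occurs: "\<And>r. \<exists>n. \<exists>v\<in>verts (Gs n). rooted_isomorphic (rooted_ball r (X, p)) (rooted_ball r (Gs n, v))"
  shows "isomorphic X T"
proof -
  have sX: "simple_graph X" using X(1) connected_graph_simple by blast
  have connT: "connected_graph T" using tree_cover.connected_T[OF cov] .
  have sT: "simple_graph T" using connT connected_graph_simple by blast
  have "\<exists>u\<in>verts T. rooted_isomorphic (rooted_ball r (X, p)) (rooted_ball r (T, u))" for r
  proof -
    \<comment> \<open>One extra unit of radius, consumed when the ball is lifted to the
      tree.\<close>
    obtain n v where v: "v \<in> verts (Gs n)" and
      iso: "rooted_isomorphic (rooted_ball (Suc r) (X, p)) (rooted_ball (Suc r) (Gs n, v))"
      using occurs[of "Suc r"] by blast
    interpret tree_cover T "Gs n" "\<pi> n" by (rule cov)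
    obtain u where u: "u \<in> verts T" "\<pi> n u = v" using proj_surj[OF v] by blast
    have "\<nexists>xs. is_cycle (fst (rooted_ball (Suc r) (Gs n, v))) xs"
    proof
      assume "\<exists>xs. is_cycle (fst (rooted_ball (Suc r) (Gs n, v))) xs"
      then obtain xs where xs: "is_cycle (fst (rooted_ball (Suc r) (Gs n, v))) xs" by blast
      have "rooted_isomorphic (rooted_ball (Suc r) (Gs n, v)) (rooted_ball (Suc r) (X, p))"
        by (rule rooted_isomorphic_sym[OF iso]) (use root_in_ball[OF X(3)] in simp)
      then obtain f where "graph_isomorphism f (fst (rooted_ball (Suc r) (Gs n, v))) (fst (rooted_ball (Suc r) (X, p)))"
        unfolding rooted_isomorphic_def by blast
      then have "is_cycle (fst (rooted_ball (Suc r) (X, p))) (map f xs)"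
        by (rule graph_isomorphism_cycle[OF _ _ xs]) (use simple_rooted_ball[of "(Gs n, v)"] simple in simp)
      then show False using acyclic by blast
    qed
    then have "rooted_isomorphic (rooted_ball r (T, u)) (rooted_ball r (Gs n, v))"
      using acyclic_ball_isomorphic[OF u(1)] u(2) by simp
    then have "rooted_isomorphic (rooted_ball r (Gs n, v)) (rooted_ball r (T, u))"
      by (rule rooted_isomorphic_sym) (use root_in_ball[OF u(1)] in simp)
    moreover have "rooted_isomorphic (rooted_ball r (X, p)) (rooted_ball r (Gs n, v))"
      by (rule ball_isomorphic_smaller[OF iso sX X(3) simple v]) simp
    ultimately show ?thesis using rooted_isomorphic_trans u(1) by blast
  qed
  then obtain u where u: "\<And>r. u r \<in> verts T" "\<And>r. rooted_isomorphic (rooted_ball r (X, p)) (rooted_ball r (T, u r))"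
    by metis
  interpret tree_cover T "Gs 0" "\<pi> 0" by (rule cov)
  have "finite ((\<lambda>r. \<pi> 0 (u r)) ` UNIV)"
    by (rule finite_subset[OF _ fin0]) (use u(1) proj_verts in auto)
  then obtain r0 where r0: "infinite {r. \<pi> 0 (u r) = \<pi> 0 (u r0)}"
    using pigeonhole_infinite[of "UNIV :: nat set" "\<lambda>r. \<pi> 0 (u r)"] by auto
  have "rooted_isomorphic (rooted_ball s (X, p)) (rooted_ball s (T, u r0))" for s
  proof -
    obtain r where r: "s \<le> r" "\<pi> 0 (u r) = \<pi> 0 (u r0)"
      using r0 unfolding infinite_nat_iff_unbounded_le by blast
    have "rooted_isomorphic (rooted_ball r (X, p)) (rooted_ball r (T, u r0))"
      using rooted_isomorphic_trans[OF u(2)[of r] deck_rooted_isomorphic[OF u(1) u(1) r(2)]] .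
    then show ?thesis by (rule ball_isomorphic_smaller[OF _ sX X(3) sT u(1) r(1)])
  qed
  then show ?thesis
    by (rule isomorphic_of_balls[OF X(1,3) connT u(1) finite_ball_verts[OF X(2,3)] finite_ball_verts[OF T u(1)]])
qed

section \<open>Moments of the limit and the strict inequality of spectral radii\<close>

locale covered_limit = local_limit M G Gs "\<lambda>r. (D + 1) ^ r"
  for M :: "'w measure" and G :: "'w \<Rightarrow> 'v rooted_graph" and Gs :: "nat \<Rightarrow> 'u graph" and D :: nat +
  fixes T :: "'t graph" and \<pi> :: "nat \<Rightarrow> 't \<Rightarrow> 'u"
  assumes covers: "\<And>n. finite_tree_cover T (Gs n) (\<pi> n) D"
    and infinite_G: "AE \<omega> in M. infinite (verts (fst (G \<omega>)))"
begin

lemma loc_fin_Gs: "loc_fin (Gs n)"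
  using finite_tree_cover.loc_fin_G[OF covers] .

lemma G_loc_fin: "\<omega> \<in> space M \<Longrightarrow> loc_fin (fst (G \<omega>))"
  using G_rooted_graph[of \<omega>] connected_graph_simple unfolding loc_fin_def by blast

text \<open>In an infinite connected graph the \<open>m\<close>-ball has at least
  \<open>m + 1\<close> vertices. Some ball type of such a size has positive probability and so
  occurs in \<open>Gs n\<close> for all large \<open>n\<close>.\<close>

lemma card_Gs_unbounded: "\<forall>\<^sub>F n in sequentially. m + 1 \<le> card (verts (Gs n))"
proof -
  have "\<exists>\<omega>. \<omega> \<in> space M \<and> infinite (verts (fst (G \<omega>))) \<and>
    (\<exists>H\<in>finite_rooted_graphs m. rooted_isomorphic (rooted_ball m (G \<omega>)) H \<and> ball_prob m H > 0)"
    by (rule eventually_happens'[OF ae_filter_bot])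
      (use AE_space infinite_G AE_ball_positive[of m] in \<open>eventually_elim, blast\<close>)
  then obtain \<omega> H where w: "\<omega> \<in> space M" "infinite (verts (fst (G \<omega>)))" and
    H: "H \<in> finite_rooted_graphs m" "rooted_isomorphic (rooted_ball m (G \<omega>)) H" "ball_prob m H > 0" by blast
  have "m + 1 \<le> card (ball_verts m (fst (G \<omega>), snd (G \<omega>)))"
    by (rule card_ball_verts_ge[OF G_rooted_graph(1,3)[OF w(1)]])
      (use w finite_ball_verts[OF G_loc_fin[OF w(1)] G_rooted_graph(3)[OF w(1)]] in auto)
  also have "\<dots> = card (verts (fst H))"
    using H(2) bij_betw_same_card unfolding rooted_isomorphic_def graph_isomorphism_def by fastforce
  finally have cH: "m + 1 \<le> card (verts (fst H))" .
  from ball_positive_occurs[OF H(1,3)] show ?thesis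
  proof eventually_elim
    case (elim n)
    then have "0 < ball_freq m H n" using H(3) by linarith
    then obtain v where v: "v \<in> verts (Gs n)" "rooted_isomorphic (rooted_ball m (Gs n, v)) H"
      using ball_freq_pos_ex by blast
    have "card (ball_verts m (Gs n, v)) = card (verts (fst H))"
      using v(2) bij_betw_same_card unfolding rooted_isomorphic_def graph_isomorphism_def by fastforce
    moreover have "card (ball_verts m (Gs n, v)) \<le> card (verts (Gs n))"
      by (rule card_mono[OF finite_Gs]) (auto simp: ball_verts_def)
    ultimately show ?case using cH by linarith
  qed
qed

lemma T_has_nbrs:
  assumes "u \<in> verts T"
  shows "\<exists>w. (u, w) \<in> adj T"
proof -
  obtain n where n: "1 + 1 \<le> card (verts (Gs n))"
    using card_Gs_unbounded[of 1] by (auto simp: eventually_sequentially)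
  interpret finite_tree_cover T "Gs n" "\<pi> n" D by (rule covers)
  have "\<pi> n u \<in> verts (Gs n)" using proj_verts[OF assms] .
  moreover have "\<not> verts (Gs n) \<subseteq> {\<pi> n u}"
  proof
    assume "verts (Gs n) \<subseteq> {\<pi> n u}"
    then have "card (verts (Gs n)) \<le> card {\<pi> n u}" by (intro card_mono) auto
    then show False using n by simp
  qed
  ultimately obtain y where "(\<pi> n u, y) \<in> adj (Gs n)" using connected_graph_nbr[OF connected_G] by blast
  then show ?thesis using step_exists[OF assms] by blast
qed

definition moment :: "nat \<Rightarrow> real" where
  "moment k = (\<integral>\<omega>. real (card (closed_walks (2 * k) (G \<omega>))) \<partial>M)"

lemma moment_tendsto:
  "(\<lambda>n. (\<Sum>v\<in>verts (Gs n). return_count (Gs n) k v) / real (card (verts (Gs n)))) \<longlonglongrightarrow> moment k"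
  using closed_walks_tendsto[of "2 * k"] card_closed_walks[OF loc_fin_Gs] unfolding moment_def by simp

lemma card_Gs_pos: "0 < real (card (verts (Gs n)))"
  using connected_Gs[of n] finite_Gs[of n] unfolding connected_graph_def by (simp add: card_gt_0_iff)

lemma moment_0: "moment 0 = 1"
proof -
  have "(\<lambda>n. (\<Sum>v\<in>verts (Gs n). return_count (Gs n) 0 v) / real (card (verts (Gs n)))) = (\<lambda>n. 1)"
    using card_Gs_pos by (intro ext) (simp add: return_count_0)
  then show ?thesis using moment_tendsto[of 0] by (simp add: LIMSEQ_const_iff)
qed

lemma moment_nonneg: "0 \<le> moment k"
  by (rule LIMSEQ_le_const[OF moment_tendsto]) (auto intro!: sum_nonneg divide_nonneg_nonneg return_count_nonneg)

text \<open>Averages of log-convex sequences are log-convex by Cauchy-Schwarz, and the inequality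
  passes to the limit.\<close>

lemma moment_log_convex: "(moment (Suc k))\<^sup>2 \<le> moment k * moment (Suc (Suc k))"
proof (rule LIMSEQ_le[OF tendsto_power[OF moment_tendsto] tendsto_mult[OF moment_tendsto moment_tendsto]])
  have "((\<Sum>v\<in>verts (Gs n). return_count (Gs n) (Suc k) v) / real (card (verts (Gs n))))\<^sup>2 \<le>
    (\<Sum>v\<in>verts (Gs n). return_count (Gs n) k v) / real (card (verts (Gs n))) *
    ((\<Sum>v\<in>verts (Gs n). return_count (Gs n) (Suc (Suc k)) v) / real (card (verts (Gs n))))" for n
  proof -
    have "(\<Sum>v\<in>verts (Gs n). return_count (Gs n) (Suc k) v)\<^sup>2 \<le>
      (\<Sum>v\<in>verts (Gs n). return_count (Gs n) k v) * (\<Sum>v\<in>verts (Gs n). return_count (Gs n) (Suc (Suc k)) v)"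
      by (rule sum_log_convex) (rule return_count_nonneg, rule return_count_nonneg,
        rule return_count_log_convex[OF loc_fin_Gs])
    then show ?thesis by (simp add: power_divide power2_eq_square divide_right_mono)
  qed
  then show "\<exists>N. \<forall>n\<ge>N. ((\<Sum>v\<in>verts (Gs n). return_count (Gs n) (Suc k) v) / real (card (verts (Gs n))))\<^sup>2 \<le>
    (\<Sum>v\<in>verts (Gs n). return_count (Gs n) k v) / real (card (verts (Gs n))) *
    ((\<Sum>v\<in>verts (Gs n). return_count (Gs n) (Suc (Suc k)) v) / real (card (verts (Gs n))))" by blast
qed

lemma moment_le: "moment k \<le> ((real D)\<^sup>2) ^ k"
proof (rule LIMSEQ_le_const2[OF moment_tendsto])
  have "return_count (Gs n) k v \<le> ((real D)\<^sup>2) ^ k" for n v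
  proof (induction k)
    case (Suc k)
    have "return_count (Gs n) (Suc k) v \<le> (real D)\<^sup>2 * return_count (Gs n) k v"
      by (rule return_count_Suc_le[OF loc_fin_Gs finite_tree_cover.degree_G[OF covers]])
    also have "\<dots> \<le> (real D)\<^sup>2 * ((real D)\<^sup>2) ^ k" using Suc by (intro mult_left_mono) auto
    finally show ?case by simp
  qed (simp add: return_count_0)
  then have "(\<Sum>v\<in>verts (Gs n). return_count (Gs n) k v) \<le> real (card (verts (Gs n))) * ((real D)\<^sup>2) ^ k" for n
    by (intro sum_bounded_above)
  then show "\<exists>N. \<forall>n\<ge>N. (\<Sum>v\<in>verts (Gs n). return_count (Gs n) k v) / real (card (verts (Gs n))) \<le> ((real D)\<^sup>2) ^ k"
    using card_Gs_pos by (simp add: pos_divide_le_eq mult.commute)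
qed

lemma moment_le_spectral_radius: "moment k \<le> (spectral_radius M G) ^ (2 * k)" "0 \<le> spectral_radius M G"
  using log_convex_le_lim_root[of moment, OF moment_0 moment_nonneg moment_log_convex _ moment_le]
  unfolding spectral_radius_def moment_def by auto

text \<open>A ball type that contains a cycle and has positive probability keeps the density of good
  vertices bounded below for all large \<open>n\<close>. The moments of the limit then outgrow every
  multiple of the powers of \<Lambda>, while \<open>adjacency_norm T\<close> is at most sqrt
  \<Lambda>.\<close>

lemma spectral_radius_gt:
  assumes cyclic: "\<not> (AE \<omega> in M. \<nexists>xs. is_cycle (fst (rooted_ball r0 (G \<omega>))) xs)"
  shows "adjacency_norm T < spectral_radius M G"
proof -
  \<comment> \<open>The constants of the tree are taken from the cover of \<open>Gs 0\<close> alone,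
    so they do not vary with \<open>n\<close>.\<close>
  interpret T0: finite_tree_cover T "Gs 0" "\<pi> 0" D by (rule covers)
  have "\<exists>H xs. H \<in> finite_rooted_graphs r0 \<and> ball_prob r0 H > 0 \<and> is_cycle (fst H) xs"
  proof (rule ccontr)
    assume none: "\<not> ?thesis"
    have "AE \<omega> in M. \<nexists>xs. is_cycle (fst (rooted_ball r0 (G \<omega>))) xs"
      using AE_ball_positive[of r0] AE_space
    proof eventually_elim
      case (elim \<omega>)
      then obtain H f where H: "H \<in> finite_rooted_graphs r0" "ball_prob r0 H > 0"
        and f: "graph_isomorphism f (fst (rooted_ball r0 (G \<omega>))) (fst H)"
        unfolding rooted_isomorphic_def by blast
      show ?case
      proof
        assume "\<exists>xs. is_cycle (fst (rooted_ball r0 (G \<omega>))) xs"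
        then obtain xs where "is_cycle (fst (rooted_ball r0 (G \<omega>))) xs" by blast
        then have "is_cycle (fst H) (map f xs)"
          by (rule graph_isomorphism_cycle[OF f simple_rooted_ball[OF connected_graph_simple[OF G_rooted_graph(1)[OF elim(2)]]]])
        then show False using none H by blast
      qed
    qed
    then show False using cyclic by blast
  qed
  then obtain H xs where H: "H \<in> finite_rooted_graphs r0" "ball_prob r0 H > 0" "is_cycle (fst H) xs" by blast
  have sH: "simple_graph (fst H)" using H(1) connected_graph_simple unfolding finite_rooted_graphs_def by auto
  \<comment> \<open>Half of the limiting probability, which the frequencies exceed from some
    \<open>n\<close> on.\<close>
  define \<delta> where "\<delta> = ball_prob r0 H / 2"
  have \<delta>: "0 < \<delta>" using H(2) unfolding \<delta>_def by simp
  have dense: "\<forall>\<^sub>F n in sequentially. \<delta> * real (card (verts (Gs n))) \<le>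
    real (card {v\<in>verts (Gs n). \<exists>xs. is_cycle (fst (rooted_ball r0 (Gs n, v))) xs})"
    using ball_positive_occurs[OF H(1,2)]
  proof eventually_elim
    case (elim n)
    let ?S = "{v\<in>verts (Gs n). rooted_isomorphic (rooted_ball r0 (Gs n, v)) H}"
    have "?S \<subseteq> {v\<in>verts (Gs n). \<exists>xs. is_cycle (fst (rooted_ball r0 (Gs n, v))) xs}"
    proof
      fix v assume v: "v \<in> ?S"
      then have "rooted_isomorphic H (rooted_ball r0 (Gs n, v))"
        using rooted_isomorphic_sym Gs_ball_root by blast
      then obtain f where "graph_isomorphism f (fst H) (fst (rooted_ball r0 (Gs n, v)))"
        unfolding rooted_isomorphic_def by blast
      then have "is_cycle (fst (rooted_ball r0 (Gs n, v))) (map f xs)"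
        by (rule graph_isomorphism_cycle[OF _ sH H(3)])
      then show "v \<in> {v\<in>verts (Gs n). \<exists>xs. is_cycle (fst (rooted_ball r0 (Gs n, v))) xs}" using v by blast
    qed
    then have "card ?S \<le> card {v\<in>verts (Gs n). \<exists>xs. is_cycle (fst (rooted_ball r0 (Gs n, v))) xs}"
      by (intro card_mono) (use finite_Gs[of n] in auto)
    moreover have "\<delta> * real (card (verts (Gs n))) < real (card ?S)"
      using elim card_Gs_pos[of n] unfolding \<delta>_def ball_freq_def by (simp add: pos_less_divide_eq)
    ultimately show ?case by linarith
  qed
  define K where "K = (D + 1) ^ r0"
  have K: "0 < real K" unfolding K_def by simp
  \<comment> \<open>\<open>R\<close> is large enough for the double counting. Good vertices then see
    their cycles within \<open>2 * R\<close>, which therefore takes the place of the radius in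
    \<open>l\<close>.\<close>
  obtain R :: nat where R: "2 * (real K)\<^sup>2 / \<delta> \<le> real R" using real_arch_simple by blast
  have "2 * (real K)\<^sup>2 \<le> \<delta> * real R" using R \<delta> by (simp add: pos_divide_le_eq mult.commute)
  also have "\<dots> \<le> \<delta> * real (R + 1)" using \<delta> by simp
  finally have R': "2 * (real K)\<^sup>2 \<le> \<delta> * real (R + 1)" .
  define d where "d = \<delta> / (2 * real K)"
  have d: "0 < d" unfolding d_def using \<delta> K by simp
  have good: "\<forall>\<^sub>F n in sequentially. d * real (card (verts (Gs n))) \<le>
    real (card {y\<in>verts (Gs n). good_vertex (Gs n) K (2 * R) y})"
    using dense card_Gs_unbounded[of R]
  proof eventually_elim
    case (elim n)
    show ?case unfolding d_def
      by (rule good_vertex_density[OF loc_fin_Gs connected_Gs finite_Gs finite_tree_cover.degree_G[OF covers]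
        K_def elim(1) \<delta> elim(2) R'])
  qed
  define l where "l = 2 * R + (2 * R + K) * K"
  obtain \<Lambda> where \<Lambda>: "1 \<le> \<Lambda>" "\<And>u k. u \<in> verts T \<Longrightarrow> return_count T k u \<le> \<Lambda> ^ k"
    "\<And>\<theta>. 0 < \<theta> \<Longrightarrow> \<theta> < \<Lambda> \<Longrightarrow> \<exists>k. \<forall>u\<in>verts T. \<forall>m. \<theta> ^ m * return_count T k u \<le> return_count T (k + m) u"
    using T0.growth_rate[OF T_has_nbrs] by blast
  obtain c where c: "0 < c" "\<And>k u v. u \<in> verts T \<Longrightarrow> v \<in> verts T \<Longrightarrow> return_count T k u \<le> c * return_count T k v"
    using T0.return_count_comparable by blast
  \<comment> \<open>The gain of one boosted step. It does not involve \<open>k\<close>, which is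
    chosen only after \<theta>.\<close>
  define g where "g = d / (4 * real ((D + 1) ^ (2 * l)) * c)"
  have g: "0 < g" unfolding g_def using d c by simp
  \<comment> \<open>Half of the gain pays for approximating \<Lambda>^l from below; the other half
    is the amount by which \<open>x\<close> exceeds \<Lambda>^l.\<close>
  obtain \<theta> where \<theta>: "0 < \<theta>" "\<theta> < \<Lambda>" "\<Lambda> ^ l - g / 2 < \<theta> ^ l"
    using power_approx_below[of \<Lambda> "g / 2" l] \<Lambda>(1) g by auto
  obtain k where k: "\<And>u m. u \<in> verts T \<Longrightarrow> \<theta> ^ m * return_count T k u \<le> return_count T (k + m) u"
    using \<Lambda>(3)[OF \<theta>(1,2)] by blast
  define x where "x = (\<Lambda> ^ l - g / 2) + g"
  have x: "\<Lambda> ^ l < x" unfolding x_def using g by simp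
  have lpos: "0 < \<Lambda> ^ l" using \<Lambda>(1) by simp
  have lower: "(x\<^sup>2) ^ m \<le> moment (k + 2 * l * m)" for m
  proof (rule tendsto_lowerbound[OF moment_tendsto])
    show "\<forall>\<^sub>F n in sequentially. (x\<^sup>2) ^ m \<le>
      (\<Sum>v\<in>verts (Gs n). return_count (Gs n) (k + 2 * l * m) v) / real (card (verts (Gs n)))"
      using good
    proof eventually_elim
      case (elim n)
      have "real (card (verts (Gs n))) * (x\<^sup>2) ^ m \<le> (\<Sum>y\<in>verts (Gs n). return_count (Gs n) (k + 2 * l * m) y)"
      proof (rule finite_tree_cover.return_count_growth[OF covers l_def _ c(1) _ _ elim])
        show "(\<Lambda> ^ l - g / 2) * return_count T k u \<le> return_count T (k + l) u" if "u \<in> verts T" for u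
          using mult_right_mono[OF less_imp_le[OF \<theta>(3)] return_count_nonneg[of T k u]] k[OF that, of l] by linarith
        show "x = (\<Lambda> ^ l - g / 2) + d / (4 * real ((D + 1) ^ (2 * l)) * c)" unfolding x_def g_def ..
        show "0 < x" using x lpos by linarith
      qed (use c(2) T0.return_count_ge_1[OF T_has_nbrs] in auto)
      then show ?case using card_Gs_pos[of n] by (simp add: pos_le_divide_eq mult.commute)
    qed
  qed simp
  show ?thesis
  proof (rule ccontr)
    assume "\<not> ?thesis"
    moreover have "adjacency_norm T \<le> sqrt \<Lambda>" by (rule adjacency_norm_le[OF T0.loc_fin_T \<Lambda>(1,2)])
    ultimately have "spectral_radius M G \<le> sqrt \<Lambda>" by linarith
    then have "(spectral_radius M G)\<^sup>2 \<le> (sqrt \<Lambda>)\<^sup>2"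
      using moment_le_spectral_radius(2) by (rule power_mono)
    then have "(spectral_radius M G)\<^sup>2 \<le> \<Lambda>" using \<Lambda>(1) by simp
    then have upper: "moment j \<le> \<Lambda> ^ j" for j
      using moment_le_spectral_radius(1)[of j] power_mono[of "(spectral_radius M G)\<^sup>2" \<Lambda> j]
      by (simp add: power_mult)
    have "(x\<^sup>2) ^ m \<le> \<Lambda> ^ k * ((\<Lambda> ^ l)\<^sup>2) ^ m" for m
    proof -
      have "(x\<^sup>2) ^ m \<le> \<Lambda> ^ (k + 2 * l * m)" using lower[of m] upper[of "k + 2 * l * m"] by linarith
      also have "\<dots> = \<Lambda> ^ k * ((\<Lambda> ^ l)\<^sup>2) ^ m" by (simp add: power_add power_mult[symmetric] mult.commute mult.left_commute)
      finally show ?thesis .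
    qed
    moreover have "(\<Lambda> ^ l)\<^sup>2 < x\<^sup>2" using x lpos by (intro power_strict_mono) auto
    then obtain m where "\<Lambda> ^ k * ((\<Lambda> ^ l)\<^sup>2) ^ m < (x\<^sup>2) ^ m"
      using power_ratio_unbounded[OF zero_less_power[OF lpos]] by blast
    ultimately show False by (meson not_le)
  qed
qed

end

theorem theorem3:
  fixes M :: "'\<omega> measure"
    and G :: "'\<omega> \<Rightarrow> 'v rooted_graph"
    and Gs :: "nat \<Rightarrow> 'u graph"
    and T :: "'t graph"
  assumes "random_rooted_graph M G"
    and "AE \<omega> in M. infinite (verts (fst (G \<omega>)))"
    and "\<And>n. connected_graph (Gs n)"
    and "\<And>n. finite (verts (Gs n))"
    and "\<And>n. universal_cover T (Gs n)"
    and "converges_locally Gs M G"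
    and "spectral_radius M G = adjacency_norm T"
  shows "AE \<omega> in M. isomorphic (fst (G \<omega>)) T"
proof -
  obtain \<pi> where \<pi>: "\<And>n. covering_map (\<pi> n) T (Gs n)"
    using assms(5) unfolding universal_cover_def by metis
  have tree: "tree T" using assms(5) unfolding universal_cover_def by blast
  have cov: "tree_cover T (Gs n) (\<pi> n)" for n
    by (rule tree_cover.intro[OF tree connected_graph_simple[OF assms(3)] \<pi>])
  \<comment> \<open>The number of vertices of \<open>Gs 0\<close> bounds the degrees of
    \<open>T\<close>, and through the coverings those of every \<open>Gs n\<close>.\<close>
  define D where "D = card (verts (Gs 0))"
  have degree: "card (nbrs T u) \<le> D" for u
  proof (cases "u \<in> verts T")
    case True
    have "card (nbrs T u) = card (nbrs (Gs 0) (\<pi> 0 u))"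
      by (rule bij_betw_same_card[OF tree_cover.proj_nbrs_bij[OF cov True]])
    also have "\<dots> \<le> D" unfolding D_def
      by (rule card_mono[OF assms(4)])
        (use simple_graph_adj_verts[OF connected_graph_simple[OF assms(3)]] in \<open>auto simp: nbrs_def\<close>)
    finally show ?thesis .
  next
    case False
    then have "nbrs T u = {}" using simple_graph_adj_verts[OF tree_simple[OF tree]] unfolding nbrs_def by auto
    then show ?thesis by simp
  qed
  have ftc: "finite_tree_cover T (Gs n) (\<pi> n) D" for n
    by (intro finite_tree_cover.intro cov finite_tree_cover_axioms.intro assms(3,4) degree)
  have "prob_space M" "G \<in> measurable M rooted_graph_space"
    using assms(1) unfolding random_rooted_graph_def by auto
  moreover have "card (ball_verts r (Gs n, v)) \<le> (D + 1) ^ r" if "v \<in> verts (Gs n)" for n v r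
    using card_ball_verts[OF finite_tree_cover.loc_fin_G[OF ftc] finite_tree_cover.degree_G[OF ftc] that] by blast
  ultimately have "covered_limit M G Gs D T \<pi>"
    by (intro covered_limit.intro local_limit.intro local_limit_axioms.intro covered_limit_axioms.intro assms(2,3,4,6) ftc)
  then interpret covered_limit M G Gs D T \<pi> .
  have "AE \<omega> in M. \<nexists>xs. is_cycle (fst (rooted_ball r (G \<omega>))) xs" for r
    using spectral_radius_gt[of r] assms(7) by (metis less_irrefl)
  then have "AE \<omega> in M. \<forall>r. \<nexists>xs. is_cycle (fst (rooted_ball r (G \<omega>))) xs"
    by (subst AE_all_countable) blast
  moreover have "AE \<omega> in M. \<forall>r. \<exists>n. \<exists>v\<in>verts (Gs n). rooted_isomorphic (rooted_ball r (G \<omega>)) (rooted_ball r (Gs n, v))"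
    using AE_ball_occurs by (subst AE_all_countable) blast
  ultimately show ?thesis using AE_space
  proof eventually_elim
    case (elim \<omega>)
    have "isomorphic (fst (G \<omega>)) T"
      by (rule isomorphic_tree_of_acyclic_balls[of T Gs \<pi>, OF cov assms(4) finite_tree_cover.loc_fin_T[OF ftc]
        G_rooted_graph(1)[OF elim(3)] G_loc_fin[OF elim(3)] G_rooted_graph(3)[OF elim(3)]])
        (use elim in auto)
    then show ?case .
  qed
qed

end
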